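(* Let $\ell>-1/2$, $p\in[1,\infty]$, and let $q,\tilde q\in L^p(0,1)$ be real-valued. If $\sigma(\ell,q,\infty)=\sigma(\ell,\tilde q,\infty)$ and $\sigma(\ell,q,0)=\sigma(\ell,\tilde q,0)$, then $q=\tilde q$ a.e. on $(0,1)$.
   Context: For $\ell>-1/2$, a real-valued $q\in L^1(0,1)$ and $\beta\in\mathbb{R}\cup\{\infty\}$, consider the radial Schrödinger operator $L(q)u=-u''+\frac{\ell(\ell+1)}{x^2}u+q(x)u$ on $(0,1]$ with boundary conditions $\lim_{x\to0}u(x)/x^{\ell+1}<\infty$ and $u'(1)+\beta u(1)=0$ (for $\beta=\infty$ the latter means $u(1)=0$). It is self-adjoint in $L^2(0,1)$, bounded below, with simple discrete spectrum denoted $\sigma(\ell,q,\beta)$. *)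

theory Defs
  imports "HOL-Analysis.Analysis"
begin

text \<open>Elements of \<open>L\<^sup>p(0,1)\<close> are represented by functions on the whole real line, of which only
  the restriction to \<open>(0,1)\<close> matters; they are identified when they agree almost everywhere
  on \<open>(0,1)\<close>.\<close>

abbreviation M01 :: "real measure" where
  "M01 \<equiv> lebesgue_on {0<..<1}"

definition Lp :: "ereal \<Rightarrow> (real \<Rightarrow> 'a::real_normed_vector) set" where
  "Lp p = {f. f \<in> borel_measurable M01 \<and>
     (if p = \<infinity> then \<exists>C. AE x in M01. norm (f x) \<le> C
      else integrable M01 (\<lambda>x. norm (f x) powr real_of_ereal p))}"

definition norm_L2 :: "(real \<Rightarrow> complex) \<Rightarrow> real" where
  "norm_L2 f = sqrt (\<integral>x. (norm (f x))\<^sup>2 \<partial>M01)"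

text \<open>\<open>f\<close> is locally absolutely continuous on \<open>(0,1]\<close> with (almost everywhere) derivative \<open>g\<close>.\<close>

definition has_loc_ac_deriv :: "(real \<Rightarrow> complex) \<Rightarrow> (real \<Rightarrow> complex) \<Rightarrow> bool" where
  "has_loc_ac_deriv f g \<longleftrightarrow>
     (\<forall>a\<in>{0<..<1}. g absolutely_integrable_on {a..1} \<and>
        (\<forall>x\<in>{a..1}. (g has_integral (f x - f a)) {a..x}))"

text \<open>The boundary condition \<open>u'(1) + \<beta> u(1) = 0\<close>, where \<open>du\<close> is \<open>u'(1)\<close>; the value
  \<open>-\<infinity>\<close> of type \<^typ>\<open>ereal\<close> is identified with \<open>\<infinity>\<close>.\<close>

definition bc_right :: "ereal \<Rightarrow> complex \<Rightarrow> complex \<Rightarrow> bool" where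
  "bc_right \<beta> u du \<longleftrightarrow>
     (if \<bar>\<beta>\<bar> = \<infinity> then u = 0 else du + complex_of_real (real_of_ereal \<beta>) * u = 0)"

text \<open>The graph of the differential expression on the functions that satisfy both boundary
  conditions. At the left endpoint, the condition is that the limit exists and is finite.\<close>

definition radial_graph0 ::
    "real \<Rightarrow> (real \<Rightarrow> real) \<Rightarrow> ereal \<Rightarrow> ((real \<Rightarrow> complex) \<times> (real \<Rightarrow> complex)) set" where
  "radial_graph0 l q \<beta> = {(u, f). u \<in> Lp 2 \<and> f \<in> Lp 2 \<and>
     (\<exists>u' u''. has_loc_ac_deriv u u' \<and> has_loc_ac_deriv u' u'' \<and>
        (AE x in M01. f x = - u'' x + complex_of_real (l * (l + 1) / x\<^sup>2) * u x
                              + complex_of_real (q x) * u x) \<and>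
        (\<exists>c. ((\<lambda>x. u x / complex_of_real (x powr (l + 1))) \<longlongrightarrow> c) (at_right 0)) \<and>
        bc_right \<beta> (u 1) (u' 1))}"

text \<open>The graph of the self-adjoint operator \<open>L(q)\<close>. For \<open>-1/2 < l < 1/2\<close> taking the closure in
  \<open>L\<^sup>2 \<times> L\<^sup>2\<close> changes nothing (up to null sets). For \<open>l \<ge> 1/2\<close> the endpoint \<open>0\<close> is limit point, and
  functions in the self-adjoint domain need not be \<open>O(x\<^bsup>l+1\<^esup>)\<close> at \<open>0\<close> (only the eigenfunctions
  are): the operator above is then merely essentially self-adjoint, and without the closure its
  resolvent set would be empty.\<close>

definition radial_graph ::
    "real \<Rightarrow> (real \<Rightarrow> real) \<Rightarrow> ereal \<Rightarrow> ((real \<Rightarrow> complex) \<times> (real \<Rightarrow> complex)) set" where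
  "radial_graph l q \<beta> = {(u, f). u \<in> Lp 2 \<and> f \<in> Lp 2 \<and>
     (\<forall>\<epsilon>>0. \<exists>(v, g)\<in>radial_graph0 l q \<beta>.
        norm_L2 (\<lambda>x. v x - u x) < \<epsilon> \<and> norm_L2 (\<lambda>x. g x - f x) < \<epsilon>)}"

text \<open>\<open>z\<close> is in the resolvent set of the operator with graph \<open>G\<close> in \<open>L\<^sup>2(0,1)\<close>: \<open>L - z\<close> maps its
  domain bijectively onto \<open>L\<^sup>2(0,1)\<close>, with bounded inverse.\<close>

definition resolvent_set ::
    "((real \<Rightarrow> complex) \<times> (real \<Rightarrow> complex)) set \<Rightarrow> complex set" where
  "resolvent_set G = {z.
     (\<forall>f\<in>Lp 2. \<exists>u. (u, \<lambda>x. z * u x + f x) \<in> G \<and>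
        (\<forall>v. (v, \<lambda>x. z * v x + f x) \<in> G \<longrightarrow> (AE x in M01. v x = u x))) \<and>
     (\<exists>C. \<forall>(u, f)\<in>G. norm_L2 u \<le> C * norm_L2 (\<lambda>x. f x - z * u x))}"

definition radial_spectrum :: "real \<Rightarrow> (real \<Rightarrow> real) \<Rightarrow> ereal \<Rightarrow> complex set" where
  "radial_spectrum l q \<beta> = - resolvent_set (radial_graph l q \<beta>)"

end

theory Submission
  imports Defs "HOL-Complex_Analysis.Complex_Analysis" "HOL-Real_Asymp.Real_Asymp"
begin

text \<open>Let \<open>phi(z, x)\<close> be the solution of \<open>-u'' + (l(l+1)/x\<^sup>2 + q) u = z u\<close> that behaves like \<open>x\<^bsup>l+1\<^esup>\<close> at \<open>0\<close>.
  The two spectra are the zero sets of the entire functions \<open>phi(z, 1)\<close> and \<open>phi'(z, 1)\<close>. The zeros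
  are simple and \<open>m = phi'(z, 1) / phi(z, 1)\<close> maps the upper half plane to the lower one, so the
  quotient of the functions \<open>m\<close> of two potentials with the same spectra is a zero-free entire function.
  It does not meet \<open>(-\<infinity>, 0]\<close>, hence it is constant, and by comparison with the free solution as
  \<open>z \<rightarrow> -\<infinity>\<close> the constant is \<open>1\<close>.

  Let \<open>c, s\<close> be the solutions with data \<open>(1, 0)\<close> and \<open>(0, 1)\<close> at \<open>1\<close>, and \<open>c2, s2\<close> those of the
  second potential. For fixed \<open>x\<close> the function \<open>D = c s2 - c2 s\<close> of \<open>z\<close> is entire of order \<open>1/2\<close> and tends
  to \<open>0\<close> on the positive axis. Since the functions \<open>m\<close> agree, \<open>c\<close> and \<open>c2\<close> may be replaced in \<open>D\<close> by
  \<open>phi(z, x) / phi(z, 1)\<close> and its analogue, and this bounds \<open>D\<close> on the negative axis; so \<open>D = 0\<close> by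
  Phragmen-Lindeloef. At one very negative \<open>z\<close>, the identity \<open>D = 0\<close> says that
  \<open>phi(z, 1)\<^sup>2 \<integral>\<^sub>x\<^sup>1 phi(z, t)\<^sup>-\<^sup>2 dt\<close> is the same for both potentials, so the two functions \<open>phi\<close> are proportional,
  and the differential equations give \<open>q = q2\<close>.\<close>

subsection \<open>Integrals on compact intervals\<close>

text \<open>Two obstacles shape the proof. The potential is merely integrable, so u'' exists only
  almost everywhere; solutions are handled as absolutely continuous functions in integrated form,
  and most identities come from Wronskians. The term l(l+1)/x^2 is singular at 0; writing phi =
  x^(l+1) w gives a Volterra equation whose kernel is dominated by |q - z|. The asymptotics at z =
  -k^2 do not use Bessel functions: they follow from positivity and monotonicity of the free
  solution.

  The half plane argument works because the order 1/2 is below 1. The decay of D on the positive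
  axis comes from a factor 1/sqrt z in s and s2. On the negative axis c and s both may grow
  exponentially; but phi(z, x) / phi(z, 1) is at most of the size phi0(x) / phi0(1) for the free
  solution phi0, and s at most of the reciprocal size, so the products stay bounded. Initial data
  are placed at 1 for c and s because these solutions only see [x, 1], where the whole potential is
  integrable.\<close>

lemma absolutely_integrable_continuous_mult:
  fixes f g :: "real \<Rightarrow> 'a::{real_normed_algebra,euclidean_space}"
  assumes "continuous_on {a..b} f" "g absolutely_integrable_on {a..b}"
  shows "(\<lambda>x. f x * g x) absolutely_integrable_on {a..b}"
proof (rule absolutely_integrable_bounded_measurable_product[where h = "(*)"])
  show "bilinear ((*) :: 'a \<Rightarrow> 'a \<Rightarrow> 'a)"
    by (simp add: bilinear_conv_bounded_bilinear bounded_bilinear_mult)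
  show "f \<in> borel_measurable (lebesgue_on {a..b})"
    by (intro continuous_imp_measurable_on_sets_lebesgue assms) auto
  show "bounded (f ` {a..b})"
    by (intro compact_imp_bounded compact_continuous_image assms) auto
qed (use assms in auto)

lemma absolutely_integrable_of_real:
  fixes f :: "real \<Rightarrow> real"
  assumes "f absolutely_integrable_on S"
  shows "(\<lambda>x. complex_of_real (f x)) absolutely_integrable_on S"
  using absolutely_integrable_linear[OF assms bounded_linear_of_real] by (simp add: o_def)

text \<open>Continuity is asked only inside the interval because the integrands of interest, such as
  \<open>wa\<close> times an inner integral, contain a factor that is singular at 0.\<close>

lemma integrable_on_bounded_continuous_interior:
  fixes f :: "real \<Rightarrow> 'a::euclidean_space"
  assumes cont: "continuous_on {a<..<b} f" and bd: "\<And>x. x \<in> {a<..<b} \<Longrightarrow> norm (f x) \<le> B"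
  shows "f absolutely_integrable_on {a..b}"
proof -
  have "f absolutely_integrable_on {a<..<b}"
  proof (rule measurable_bounded_by_integrable_imp_absolutely_integrable[where g = "\<lambda>_. B"])
    show "f \<in> borel_measurable (lebesgue_on {a<..<b})"
      by (intro continuous_imp_measurable_on_sets_lebesgue cont) auto
    show "(\<lambda>_. B) integrable_on {a<..<b}"
      by (rule integrable_on_const) simp
  qed (use bd in auto)
  thus ?thesis
    using absolutely_integrable_on_Icc_iff_Ioo by blast
qed

lemma integral_abs_le_const:
  fixes f :: "real \<Rightarrow> 'a::euclidean_space"
  assumes "f integrable_on {a..b}" "g integrable_on {a..b}" "\<And>x. x \<in> {a..b} \<Longrightarrow> norm (f x) \<le> B * g x"
  shows "norm (integral {a..b} f) \<le> B * integral {a..b} g"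
proof -
  have "norm (integral {a..b} f) \<le> integral {a..b} (\<lambda>x. B * g x)"
    using integrable_on_mult_right[OF assms(2), of B] by (intro integral_norm_bound_integral assms) auto
  thus ?thesis by simp
qed

text \<open>On a partition of small mesh, uniform continuity of \<open>\<alpha>\<close> bounds each
  squared increment by \<open>e\<close> times the increment, and the sum telescopes to
  \<open>e * (\<alpha> b - \<alpha> a)\<close>. This gives constancy without differentiating
  anything almost everywhere.\<close>

lemma constant_if_square_increments:
  fixes H :: "real \<Rightarrow> 'a::real_normed_vector" and \<alpha> :: "real \<Rightarrow> real"
  assumes ab: "a \<le> b" and cont: "continuous_on {a..b} \<alpha>"
    and mono: "\<And>x y. a \<le> x \<Longrightarrow> x \<le> y \<Longrightarrow> y \<le> b \<Longrightarrow> \<alpha> x \<le> \<alpha> y"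
    and H: "\<And>x y. a \<le> x \<Longrightarrow> x \<le> y \<Longrightarrow> y \<le> b \<Longrightarrow> norm (H y - H x) \<le> (\<alpha> y - \<alpha> x)\<^sup>2"
  shows "H b = H a"
proof -
  have "norm (H b - H a) \<le> e * (\<alpha> b - \<alpha> a)" if e: "e > 0" for e
  proof -
    have "uniformly_continuous_on {a..b} \<alpha>"
      using cont compact_uniformly_continuous by blast
    then obtain d where d: "d > 0" "\<And>x y. x \<in> {a..b} \<Longrightarrow> y \<in> {a..b} \<Longrightarrow> dist y x < d \<Longrightarrow> dist (\<alpha> y) (\<alpha> x) < e"
      using e unfolding uniformly_continuous_on_def by metis
    obtain N :: nat where N: "N > 0" "(b - a) / N < d"
    proof -
      obtain N :: nat where "(b - a) / d < N" using reals_Archimedean2 by blast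
      hence "(b - a) / d < Suc N" by simp
      hence "(b - a) / Suc N < d" using d by (simp add: field_simps)
      thus ?thesis using that[of "Suc N"] by blast
    qed
    define t where "t i = a + i * ((b - a) / N)" for i :: nat
    have tm: "t i \<in> {a..b}" if "i \<le> N" for i
    proof -
      have "real i * ((b - a) / N) \<le> real N * ((b - a) / N)"
        using that ab by (intro mult_right_mono) auto
      thus ?thesis using ab N unfolding t_def by auto
    qed
    have ti: "t (Suc i) - t i = (b - a) / N" for i by (simp add: t_def add_divide_distrib distrib_right)
    have tle: "t i \<le> t (Suc i)" for i using ti[of i] ab N(1)
      by (metis diff_ge_0_iff_ge divide_nonneg_nonneg of_nat_0_le_iff)
    have step: "norm (H (t (Suc i)) - H (t i)) \<le> e * (\<alpha> (t (Suc i)) - \<alpha> (t i))" if "i < N" for i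
    proof -
      have 1: "t i \<in> {a..b}" "t (Suc i) \<in> {a..b}" using that tm by auto
      have "dist (t (Suc i)) (t i) < d" using ti[of i] N tle[of i] by (simp add: dist_real_def)
      hence "dist (\<alpha> (t (Suc i))) (\<alpha> (t i)) < e" using d(2) 1 by blast
      moreover have "\<alpha> (t i) \<le> \<alpha> (t (Suc i))" using mono 1 tle by auto
      ultimately have "(\<alpha> (t (Suc i)) - \<alpha> (t i))\<^sup>2 \<le> e * (\<alpha> (t (Suc i)) - \<alpha> (t i))"
        unfolding power2_eq_square dist_real_def by (intro mult_right_mono) auto
      thus ?thesis using H[of "t i" "t (Suc i)"] 1 tle[of i] by auto
    qed
    have "norm (H (t N) - H (t 0)) \<le> e * (\<alpha> (t N) - \<alpha> (t 0))"
    proof -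
      have "norm (H (t n) - H (t 0)) \<le> e * (\<alpha> (t n) - \<alpha> (t 0))" if "n \<le> N" for n
        using that
      proof (induction n)
        case (Suc n)
        have "norm (H (t (Suc n)) - H (t 0)) \<le> norm (H (t (Suc n)) - H (t n)) + norm (H (t n) - H (t 0))"
          by (metis diff_add_cancel add_diff_eq norm_triangle_ineq)
        also have "\<dots> \<le> e * (\<alpha> (t (Suc n)) - \<alpha> (t n)) + e * (\<alpha> (t n) - \<alpha> (t 0))"
          using Suc step[of n] by (intro add_mono) auto
        finally show ?case by (simp add: algebra_simps)
      qed simp
      thus ?thesis by simp
    qed
    moreover have "t 0 = a" "t N = b" using N(1) unfolding t_def by auto
    ultimately show ?thesis by simp
  qed
  hence *: "norm (H b - H a) \<le> e * (\<alpha> b - \<alpha> a)" if "e > 0" for e using that by blast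
  have nn: "\<alpha> b - \<alpha> a \<ge> 0" using mono ab by auto
  have "norm (H b - H a) \<le> 0 + e" if "e > 0" for e
  proof -
    have "norm (H b - H a) \<le> e / (\<alpha> b - \<alpha> a + 1) * (\<alpha> b - \<alpha> a)"
      using *[of "e / (\<alpha> b - \<alpha> a + 1)"] that nn by simp
    also have "\<dots> = e * ((\<alpha> b - \<alpha> a) / (\<alpha> b - \<alpha> a + 1))" by simp
    also have "\<dots> \<le> e * 1" using nn that by (intro mult_left_mono) auto
    finally show ?thesis by simp
  qed
  hence "norm (H b - H a) \<le> 0" using field_le_epsilon by blast
  thus ?thesis by simp
qed

subsection \<open>Absolutely continuous functions\<close>

text \<open>The same integrated form as in \<open>has_loc_ac_deriv\<close>, on an arbitrary compact
  interval: \<open>g\<close> matters only up to null sets, and no pointwise derivative is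
  mentioned.\<close>

definition ac_on :: "(real \<Rightarrow> complex) \<Rightarrow> (real \<Rightarrow> complex) \<Rightarrow> real \<Rightarrow> real \<Rightarrow> bool" where
  "ac_on f g a b \<longleftrightarrow> g absolutely_integrable_on {a..b} \<and>
     (\<forall>x\<in>{a..b}. (g has_integral (f x - f a)) {a..x})"

lemma has_loc_ac_deriv_iff: "has_loc_ac_deriv f g \<longleftrightarrow> (\<forall>a\<in>{0<..<1}. ac_on f g a 1)"
  unfolding has_loc_ac_deriv_def ac_on_def by simp

lemma ac_on_has_integral:
  assumes "ac_on f g a b" "a \<le> x" "x \<le> y" "y \<le> b"
  shows "(g has_integral (f y - f x)) {x..y}"
proof -
  have 1: "(g has_integral (f x - f a)) {a..x}" "(g has_integral (f y - f a)) {a..y}"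
    using assms unfolding ac_on_def by auto
  have "g integrable_on {x..y}"
    by (rule integrable_on_subinterval[where S = "{a..y}"]) (use 1 assms in \<open>auto simp: has_integral_iff\<close>)
  then obtain I where I: "(g has_integral I) {x..y}" by blast
  have "(g has_integral ((f x - f a) + I)) {a..y}"
    using has_integral_combine[OF assms(2,3) 1(1) I] .
  hence "f y - f a = f x - f a + I" using 1(2) has_integral_unique by blast
  hence "I = f y - f x" by (simp add: algebra_simps)
  thus ?thesis using I by simp
qed

lemma ac_on_integral:
  assumes "ac_on f g a b" "a \<le> x" "x \<le> y" "y \<le> b"
  shows "integral {x..y} g = f y - f x"
  using ac_on_has_integral[OF assms] by (simp add: has_integral_iff)

lemma ac_on_abs_int: "ac_on f g a b \<Longrightarrow> g absolutely_integrable_on {a..b}"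
  unfolding ac_on_def by simp

lemma ac_on_subinterval:
  assumes "ac_on f g a b" "a \<le> c" "d \<le> b"
  shows "ac_on f g c d"
  unfolding ac_on_def
proof (intro conjI ballI)
  show "g absolutely_integrable_on {c..d}"
    by (rule absolutely_integrable_on_subinterval[OF ac_on_abs_int[OF assms(1)]]) (use assms in auto)
  show "(g has_integral (f x - f c)) {c..x}" if "x \<in> {c..d}" for x
    using that assms by (intro ac_on_has_integral[OF assms(1)]) auto
qed

lemma ac_on_continuous:
  assumes "ac_on f g a b"
  shows "continuous_on {a..b} f"
proof -
  have "continuous_on {a..b} (\<lambda>x. f a + integral {a..x} g)"
    using assms absolutely_integrable_on_def unfolding ac_on_def
    by (intro continuous_intros indefinite_integral_continuous_1) auto
  moreover have "f a + integral {a..x} g = f x" if "x \<in> {a..b}" for x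
    using ac_on_integral[OF assms, of a x] that by auto
  ultimately show ?thesis using continuous_on_cong[OF refl] by (metis (no_types, lifting))
qed

lemma ac_on_cong:
  assumes "ac_on f g a b" "\<And>x. x \<in> {a..b} \<Longrightarrow> f x = f' x" "\<And>x. x \<in> {a..b} \<Longrightarrow> g x = g' x"
  shows "ac_on f' g' a b"
  unfolding ac_on_def
proof (intro conjI ballI)
  show "g' absolutely_integrable_on {a..b}"
    using assms(1,3) unfolding ac_on_def by (metis (no_types, lifting) set_integrable_cong)
  show "(g' has_integral (f' x - f' a)) {a..x}" if "x \<in> {a..b}" for x
  proof -
    have "(g has_integral (f x - f a)) {a..x}" using assms(1) that unfolding ac_on_def by auto
    thus ?thesis using assms(2)[of x] assms(2)[of a] that
      by (simp, subst has_integral_cong[where g = g]) (use assms(3) that in auto)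
  qed
qed

lemma ac_on_C1:
  assumes "\<And>x. x \<in> {a..b} \<Longrightarrow> (f has_vector_derivative g x) (at x within {a..b})"
    and "continuous_on {a..b} g"
  shows "ac_on f g a b"
  unfolding ac_on_def
proof (intro conjI ballI)
  show "g absolutely_integrable_on {a..b}" using assms(2) absolutely_integrable_continuous_real by blast
  show "(g has_integral (f x - f a)) {a..x}" if "x \<in> {a..b}" for x
    using that
    by (intro fundamental_theorem_of_calculus has_vector_derivative_within_subset[OF assms(1)]) auto
qed

lemma ac_on_indefinite_integral:
  assumes "g absolutely_integrable_on {a..b}"
  shows "ac_on (\<lambda>x. c + integral {a..x} g) g a b"
  unfolding ac_on_def
proof (intro conjI ballI assms)
  show "(g has_integral (c + integral {a..x} g - (c + integral {a..a} g))) {a..x}" if "x \<in> {a..b}" for x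
  proof -
    have "g integrable_on {a..x}"
      by (rule integrable_on_subinterval[where S = "{a..b}"]) (use that assms absolutely_integrable_on_def in auto)
    thus ?thesis by (simp add: has_integral_iff)
  qed
qed

lemma ac_on_const: "ac_on (\<lambda>x. c) (\<lambda>x. 0) a b"
  by (rule ac_on_C1) (auto intro!: derivative_eq_intros)

lemma ac_on_linear:
  assumes "ac_on f g a b" "bounded_linear L"
  shows "ac_on (\<lambda>x. L (f x)) (\<lambda>x. L (g x)) a b"
  unfolding ac_on_def
proof (intro conjI ballI)
  interpret bounded_linear L by fact
  show "(\<lambda>x. L (g x)) absolutely_integrable_on {a..b}"
    using absolutely_integrable_linear[OF ac_on_abs_int[OF assms(1)] assms(2)] by (simp add: o_def)
  show "((\<lambda>x. L (g x)) has_integral (L (f x) - L (f a))) {a..x}" if "x \<in> {a..b}" for x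
  proof -
    have "(g has_integral (f x - f a)) {a..x}" using assms(1) that unfolding ac_on_def by auto
    from has_integral_linear[OF this assms(2)] show ?thesis by (simp add: o_def diff)
  qed
qed

lemma ac_on_add:
  assumes "ac_on f g a b" "ac_on f' g' a b"
  shows "ac_on (\<lambda>x. f x + f' x) (\<lambda>x. g x + g' x) a b"
  using assms unfolding ac_on_def
  by (auto intro: set_integral_add simp: add_diff_add intro!: has_integral_add)

lemma ac_on_cmult: "ac_on f g a b \<Longrightarrow> ac_on (\<lambda>x. c * f x) (\<lambda>x. c * g x) a b"
  using ac_on_linear[OF _ bounded_linear_mult_right] .

lemma ac_on_cnj: "ac_on f g a b \<Longrightarrow> ac_on (\<lambda>x. cnj (f x)) (\<lambda>x. cnj (g x)) a b"
  using ac_on_linear[OF _ bounded_linear_cnj] .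

lemma ac_on_diff:
  assumes "ac_on f g a b" "ac_on f' g' a b"
  shows "ac_on (\<lambda>x. f x - f' x) (\<lambda>x. g x - g' x) a b"
  using ac_on_add[OF assms(1) ac_on_cmult[OF assms(2), of "-1"]] by simp

text \<open>The defect \<open>fg - \<integral>(f'g + fg')\<close> has increments that are quadratically small
  in the increments of \<open>\<integral>(\<bar>f'\<bar> + \<bar>g'\<bar>)\<close>, hence it is constant.\<close>

lemma ac_on_mult:
  assumes f: "ac_on f f1 a b" and g: "ac_on g g1 a b"
  shows "ac_on (\<lambda>x. f x * g x) (\<lambda>x. f1 x * g x + f x * g1 x) a b"
proof -
  have cf: "continuous_on {a..b} f" and cg: "continuous_on {a..b} g"
    using assms ac_on_continuous by auto
  have ai: "(\<lambda>x. f1 x * g x) absolutely_integrable_on {a..b}" "(\<lambda>x. f x * g1 x) absolutely_integrable_on {a..b}"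
    using absolutely_integrable_continuous_mult[OF cg ac_on_abs_int[OF f]]
      absolutely_integrable_continuous_mult[OF cf ac_on_abs_int[OF g]] by (simp_all add: mult.commute)
  define k where "k = (\<lambda>x. f1 x * g x + f x * g1 x)"
  have aik: "k absolutely_integrable_on {a..b}" unfolding k_def using ai by (rule set_integral_add)
  have ik: "k integrable_on {x..y}" if "a \<le> x" "y \<le> b" for x y
    by (rule integrable_on_subinterval[where S = "{a..b}"]) (use that aik absolutely_integrable_on_def in auto)
  define n where "n = (\<lambda>x. norm (f1 x) + norm (g1 x))"
  have ni: "n integrable_on {a..b}"
    unfolding n_def using f g unfolding ac_on_def absolutely_integrable_on_def by (intro integrable_add) auto
  have ni': "n integrable_on {x..y}" if "a \<le> x" "y \<le> b" for x y
    by (rule integrable_on_subinterval[OF ni]) (use that in auto)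
  \<comment> \<open>The factor 2 leaves room for the two error terms below: their sum is at most 2
    N^2 <= (2 N)^2.\<close>
  define al where "al x = 2 * integral {a..x} n" for x
  have al_diff: "al y - al x = 2 * integral {x..y} n" if "a \<le> x" "x \<le> y" "y \<le> b" for x y
    using Henstock_Kurzweil_Integration.integral_combine[OF that(1,2) ni'[of a y]] that
    unfolding al_def by (simp add: algebra_simps)
  have nnn: "n x \<ge> 0" for x unfolding n_def by simp
  have al_nn: "integral {x..y} n \<ge> 0" for x y
    by (cases "n integrable_on {x..y}") (auto intro: Henstock_Kurzweil_Integration.integral_nonneg nnn simp: not_integrable_integral)
  have inc: "norm (f t - f s) \<le> integral {x..y} n" "norm (g t - g s) \<le> integral {x..y} n"
    if "a \<le> x" "x \<le> s" "s \<le> t" "t \<le> y" "y \<le> b" for x y s t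
  proof -
    have st: "f1 integrable_on {s..t}" "g1 integrable_on {s..t}"
      using ac_on_has_integral[OF f, of s t] ac_on_has_integral[OF g, of s t] that by (auto simp: has_integral_iff)
    have "norm (integral {s..t} f1) \<le> integral {s..t} n"
      by (intro integral_norm_bound_integral st ni') (use that in \<open>auto simp: n_def\<close>)
    moreover have "norm (integral {s..t} g1) \<le> integral {s..t} n"
      by (intro integral_norm_bound_integral st ni') (use that in \<open>auto simp: n_def\<close>)
    moreover have "integral {s..t} n \<le> integral {x..y} n"
      by (intro integral_subset_le ni') (use that nnn in auto)
    ultimately show "norm (f t - f s) \<le> integral {x..y} n" "norm (g t - g s) \<le> integral {x..y} n"
      using ac_on_integral[OF f, of s t] ac_on_integral[OF g, of s t] that by auto
  qed
  define H where "H x = f x * g x - integral {a..x} k" for x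
  have Hinc: "norm (H y - H x) \<le> (al y - al x)\<^sup>2" if xy: "a \<le> x" "x \<le> y" "y \<le> b" for x y
  proof -
    define N where "N = integral {x..y} n"
    have N0: "N \<ge> 0" unfolding N_def by (rule al_nn)
    have h: "(f1 has_integral (f y - f x)) {x..y}" "(g1 has_integral (g y - g x)) {x..y}"
      using ac_on_has_integral[OF f, of x y] ac_on_has_integral[OF g, of x y] xy by auto
    \<comment> \<open>Freezing \<open>g\<close> at the right end and \<open>f\<close> at the left
      end gives exactly the increment of the product. The difference to \<open>k\<close> is a
      derivative times an oscillation, hence its integral is quadratically small.\<close>
    have 1: "((\<lambda>t. f1 t * g y + f x * g1 t) has_integral ((f y - f x) * g y + f x * (g y - g x))) {x..y}"
      by (intro has_integral_add has_integral_mult_left has_integral_mult_right h)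
    have 2: "(k has_integral (integral {x..y} k)) {x..y}" using ik[of x y] xy by blast
    have 3: "((\<lambda>t. f1 t * g y + f x * g1 t - k t) has_integral
       ((f y - f x) * g y + f x * (g y - g x) - integral {x..y} k)) {x..y}"
      by (intro has_integral_diff 1 2)
    have "H y - H x = (f y - f x) * g y + f x * (g y - g x) - integral {x..y} k"
      using Henstock_Kurzweil_Integration.integral_combine[OF xy(1,2) ik[of a y]] xy
      unfolding H_def by (simp add: algebra_simps)
    also have "\<dots> = integral {x..y} (\<lambda>t. f1 t * g y + f x * g1 t - k t)"
      using 3 by (simp add: has_integral_iff)
    also have "norm \<dots> \<le> (2 * N) * integral {x..y} n"
    proof (rule integral_abs_le_const)
      show "norm (f1 t * g y + f x * g1 t - k t) \<le> 2 * N * n t" if t: "t \<in> {x..y}" for t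
      proof -
        have "f1 t * g y + f x * g1 t - k t = f1 t * (g y - g t) - g1 t * (f t - f x)"
          unfolding k_def by (simp add: algebra_simps)
        also have "norm \<dots> \<le> norm (f1 t) * norm (g y - g t) + norm (g1 t) * norm (f t - f x)"
          by (metis norm_mult norm_triangle_ineq4)
        also have "\<dots> \<le> n t * N + n t * N"
          unfolding N_def using inc[of x t y y] inc[of x x t y] t xy
          by (intro add_mono mult_mono) (auto simp: n_def)
        finally show ?thesis by (simp add: algebra_simps)
      qed
    qed (use 3 ni'[of x y] xy in \<open>auto simp: has_integral_iff\<close>)
    also have "\<dots> = 2 * N\<^sup>2" unfolding N_def by (simp add: power2_eq_square)
    also have "\<dots> \<le> (2 * N)\<^sup>2" using N0 by (simp add: power2_eq_square)
    finally show ?thesis using al_diff xy unfolding N_def by simp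
  qed
  have al_cont: "continuous_on {a..b} al"
    unfolding al_def by (intro continuous_intros indefinite_integral_continuous_1 ni)
  have Hc: "H x = H a" if "x \<in> {a..b}" for x
  proof (rule constant_if_square_increments[where \<alpha> = al])
    show "continuous_on {a..x} al" using al_cont that by (auto intro: continuous_on_subset)
    show "al s \<le> al t" if "a \<le> s" "s \<le> t" "t \<le> x" for s t
      using al_diff[of s t] al_nn[of s t] that \<open>x \<in> {a..b}\<close> by auto
    show "norm (H t - H s) \<le> (al t - al s)\<^sup>2" if "a \<le> s" "s \<le> t" "t \<le> x" for s t
      using Hinc[of s t] that \<open>x \<in> {a..b}\<close> by auto
  qed (use that in auto)
  show ?thesis
    unfolding ac_on_def k_def[symmetric]
  proof (intro conjI ballI aik)
    show "(k has_integral (f x * g x - f a * g a)) {a..x}" if "x \<in> {a..b}" for x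
      using Hc[OF that] ik[of a x] that unfolding H_def by (auto simp: has_integral_iff algebra_simps)
  qed
qed

subsection \<open>Holomorphic parameter integrals\<close>

text \<open>A bound on \<open>f\<close> itself suffices: Cauchy's inequality on unit circles turns
  it into a Lipschitz bound in \<open>z\<close> with the same \<open>g\<close>, and this dominates
  the difference quotients.\<close>

lemma holomorphic_on_parameter_integral:
  fixes f :: "complex \<Rightarrow> real \<Rightarrow> complex"
  assumes holo: "\<And>y. y \<in> S \<Longrightarrow> (\<lambda>z. f z y) holomorphic_on UNIV"
    and int: "\<And>z. f z integrable_on S"
    and dom: "\<And>R. \<exists>g. g integrable_on S \<and> (\<forall>z y. norm z \<le> R \<longrightarrow> y \<in> S \<longrightarrow> norm (f z y) \<le> g y)"
  shows "(\<lambda>z. integral S (f z)) holomorphic_on UNIV"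
  unfolding holomorphic_on_open[OF open_UNIV]
proof
  fix z0 :: complex
  \<comment> \<open>The 2 accounts for points up to distance 1 from \<open>z0\<close> and for Cauchy
    circles of radius 1 around them.\<close>
  obtain g where g: "g integrable_on S" "\<And>z y. norm z \<le> norm z0 + 2 \<Longrightarrow> y \<in> S \<Longrightarrow> norm (f z y) \<le> g y"
    using dom[of "norm z0 + 2"] by blast
  define f1 where "f1 y = deriv (\<lambda>z. f z y) z0" for y
  have der: "((\<lambda>z. f z y) has_field_derivative f1 y) (at z0)" if "y \<in> S" for y
    unfolding f1_def using holo[OF that] by (simp add: holomorphic_derivI)
  have lip: "norm (f z y - f z0 y) \<le> g y * norm (z - z0)" if "y \<in> S" "norm (z - z0) \<le> 1" for z y
  proof (rule field_differentiable_bound[where S = "cball z0 1" and f' = "\<lambda>w. deriv (\<lambda>z. f z y) w"])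
    show "((\<lambda>z. f z y) has_field_derivative deriv (\<lambda>z. f z y) w) (at w within cball z0 1)" for w
      using holo[OF that(1)] holomorphic_derivI[of _ UNIV w] by (metis UNIV_I has_field_derivative_at_within open_UNIV)
    show "norm (deriv (\<lambda>z. f z y) w) \<le> g y" if w: "w \<in> cball z0 1" for w
    proof -
      have "norm ((deriv ^^ 1) (\<lambda>z. f z y) w) \<le> fact 1 * g y / 1 ^ 1"
      proof (rule Cauchy_inequality)
        show "(\<lambda>z. f z y) holomorphic_on ball w 1" using holo[OF \<open>y \<in> S\<close>] holomorphic_on_subset by blast
        show "continuous_on (cball w 1) (\<lambda>z. f z y)"
          using holo[OF \<open>y \<in> S\<close>] holomorphic_on_imp_continuous_on holomorphic_on_subset by blast
        fix x assume x: "norm (w - x) = 1"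
        have "norm x \<le> norm (x - w) + norm (w - z0) + norm z0"
          using norm_triangle_ineq[of "x - w + (w - z0)" z0] norm_triangle_ineq[of "x - w" "w - z0"] by simp
        also have "\<dots> \<le> 1 + 1 + norm z0" using x w by (simp add: norm_minus_commute dist_norm)
        finally show "norm (f x y) \<le> g y" using g(2)[OF _ \<open>y \<in> S\<close>] by simp
      qed simp
      thus ?thesis by simp
    qed
  qed (use that in \<open>auto simp: dist_norm norm_minus_commute\<close>)
  have "((\<lambda>z. (integral S (f z) - integral S (f z0)) / (z - z0)) \<longlongrightarrow> integral S f1) (at z0)"
    unfolding tendsto_at_iff_sequentially
  proof (intro allI impI)
    fix Z :: "nat \<Rightarrow> complex" assume Z: "\<forall>i. Z i \<in> UNIV - {z0}" "Z \<longlonglongrightarrow> z0"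
    obtain n0 where n0: "\<And>n. n \<ge> n0 \<Longrightarrow> norm (Z n - z0) < 1"
      using Z(2) unfolding LIMSEQ_iff by (meson zero_less_one)
    \<comment> \<open>Dropping the first \<open>n0\<close> terms puts the whole sequence into the
      unit ball around \<open>z0\<close>, where the Lipschitz bound holds.\<close>
    define Y where "Y n = Z (n + n0)" for n
    have Y: "Y \<longlonglongrightarrow> z0" "\<And>n. Y n \<noteq> z0" "\<And>n. norm (Y n - z0) \<le> 1"
      unfolding Y_def using LIMSEQ_ignore_initial_segment[OF Z(2)] Z(1) by (auto intro!: order.strict_implies_order[OF n0])
    define F where "F n y = (f (Y n) y - f z0 y) / (Y n - z0)" for n y
    have Fi: "F n integrable_on S" for n
      unfolding F_def by (intro integrable_on_divide integrable_diff int)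
    have "(\<lambda>n. integral S (F n)) \<longlonglongrightarrow> integral S f1"
    proof (rule dominated_convergence(2))
      show "norm (F n y) \<le> g y" if "y \<in> S" for n y
        unfolding F_def using lip[OF that Y(3)[of n]] Y(2)[of n] by (simp add: norm_divide divide_simps)
      show "(\<lambda>n. F n y) \<longlonglongrightarrow> f1 y" if "y \<in> S" for y
      proof -
        have "((\<lambda>z. (f z y - f z0 y) / (z - z0)) \<longlongrightarrow> f1 y) (at z0)"
          using der[OF that] by (simp add: has_field_derivative_iff)
        hence "((\<lambda>z. (f z y - f z0 y) / (z - z0)) \<circ> Y) \<longlonglongrightarrow> f1 y"
          using Y unfolding tendsto_at_iff_sequentially by auto
        thus ?thesis by (simp add: F_def o_def)
      qed
    qed (use Fi g in auto)
    moreover have "integral S (F n) = (integral S (f (Y n)) - integral S (f z0)) / (Y n - z0)" for n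
      unfolding F_def by (simp add: Henstock_Kurzweil_Integration.integral_diff int divide_inverse)
    ultimately have "(\<lambda>n. (integral S (f (Y n)) - integral S (f z0)) / (Y n - z0)) \<longlonglongrightarrow> integral S f1" by simp
    thus "((\<lambda>z. (integral S (f z) - integral S (f z0)) / (z - z0)) \<circ> Z) \<longlonglongrightarrow> integral S f1"
      unfolding Y_def o_def
      by (rule LIMSEQ_offset)
  qed
  thus "\<exists>f'. ((\<lambda>z. integral S (f z)) has_field_derivative f') (at z0)"
    using has_field_derivative_iff by blast
qed

subsection \<open>Singular Volterra equations\<close>

text \<open>The equation \<open>u(x) = h(x) + \<integral>\<^sub>0\<^sup>x a(t) \<integral>\<^sub>0\<^sup>t b(y) (Q(y) - z) u(y) dy dt\<close>. The coefficient \<open>a\<close> may be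
  singular at \<open>0\<close>; only \<open>\<bar>a(t) b(y)\<bar> \<le> 1\<close> for \<open>y \<le> t\<close> is needed for the Picard iteration.\<close>

locale volterra =
  fixes X :: real and a b :: "real \<Rightarrow> real" and Q :: "real \<Rightarrow> real" and h :: "real \<Rightarrow> complex"
  assumes a_cont: "continuous_on {0<..<X} a"
    and b_cont: "continuous_on {0..<X} b"
    and ab: "\<And>y t. 0 \<le> y \<Longrightarrow> y \<le> t \<Longrightarrow> 0 < t \<Longrightarrow> t < X \<Longrightarrow> \<bar>a t * b y\<bar> \<le> 1"
    and Q_int: "\<And>c. c < X \<Longrightarrow> Q absolutely_integrable_on {0..c}"
    and h_cont: "continuous_on {0..<X} h"
begin

definition integrand :: "complex \<Rightarrow> (real \<Rightarrow> complex) \<Rightarrow> real \<Rightarrow> complex" where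
  "integrand z f y = complex_of_real (b y) * (complex_of_real (Q y) - z) * f y"

definition inner :: "complex \<Rightarrow> (real \<Rightarrow> complex) \<Rightarrow> real \<Rightarrow> complex" where
  "inner z f t = integral {0..t} (integrand z f)"

definition outer :: "complex \<Rightarrow> (real \<Rightarrow> complex) \<Rightarrow> real \<Rightarrow> complex" where
  "outer z f x = integral {0..x} (\<lambda>t. complex_of_real (a t) * inner z f t)"

primrec pic :: "complex \<Rightarrow> nat \<Rightarrow> real \<Rightarrow> complex" where
  "pic z 0 = h"
| "pic z (Suc n) = outer z (pic z n)"

definition U :: "complex \<Rightarrow> real \<Rightarrow> complex" where
  "U z x = (\<Sum>n. pic z n x)"

text \<open>Bounds the integral of |Q - z| over [0, c] for all |z| <= R; together with |a(t) b(y)|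
  <= 1 it controls one Picard step.\<close>

definition K :: "real \<Rightarrow> real \<Rightarrow> real" where
  "K c R = integral {0..c} (\<lambda>y. \<bar>Q y\<bar>) + R * c"

lemma K_nonneg: "0 \<le> c \<Longrightarrow> 0 \<le> R \<Longrightarrow> 0 \<le> K c R"
  unfolding K_def
  by (intro add_nonneg_nonneg mult_nonneg_nonneg)
    (cases "(\<lambda>y. \<bar>Q y\<bar>) integrable_on {0..c}",
     auto intro: Henstock_Kurzweil_Integration.integral_nonneg simp: not_integrable_integral)

lemma coeff_integrable: "c < X \<Longrightarrow> (\<lambda>y. complex_of_real (Q y) - z) absolutely_integrable_on {0..c}"
  by (intro set_integral_diff(1) absolutely_integrable_of_real Q_int) auto

lemma integrand_integrable:
  assumes "c < X" "continuous_on {0..c} f"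
  shows "integrand z f absolutely_integrable_on {0..c}"
proof -
  have "(\<lambda>y. (complex_of_real (b y) * f y) * (complex_of_real (Q y) - z)) absolutely_integrable_on {0..c}"
    using assms(1) continuous_on_subset[OF b_cont, of "{0..c}"]
    by (intro assms(2) absolutely_integrable_continuous_mult coeff_integrable continuous_intros) (auto simp: subset_iff)
  thus ?thesis unfolding integrand_def by (simp add: mult_ac)
qed

lemma integrand_integrable':
  assumes "t \<le> c" "c < X" "continuous_on {0..c} f"
  shows "integrand z f integrable_on {0..t}"
  using integrand_integrable[of t f z] assms continuous_on_subset[of "{0..c}" f "{0..t}"]
    absolutely_integrable_on_def by auto

lemma inner_cont:
  assumes "c < X" "continuous_on {0..c} f"
  shows "continuous_on {0..c} (inner z f)"
  unfolding inner_def
  using integrand_integrable[OF assms] absolutely_integrable_on_def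
  by (intro indefinite_integral_continuous_1) auto

lemma inner_0 [simp]: "inner z f 0 = 0"
  unfolding inner_def by simp

lemma inner_ac_on:
  assumes "c < X" "continuous_on {0..c} f"
  shows "ac_on (inner z f) (integrand z f) 0 c"
  using ac_on_indefinite_integral[OF integrand_integrable[OF assms], of 0]
  unfolding inner_def by simp

text \<open>The singular factor a(t) is never estimated alone: it is moved under the integral and
  paired with b(y). At t = 0, where a(0) is arbitrary, the inner integral is 0.\<close>

lemma inner_bound:
  assumes t: "0 \<le> t" "t \<le> c" and c: "c < X" and f: "continuous_on {0..c} f"
    and B: "\<And>y. y \<in> {0..t} \<Longrightarrow> norm (f y) \<le> B" and R: "norm z \<le> R"
  shows "norm (complex_of_real (a t) * inner z f t) \<le> B * K c R"
proof (cases "t = 0")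
  case True
  have "0 \<le> B" using order_trans[OF norm_ge_zero B[of 0]] t by simp
  moreover have "0 \<le> K c R" using t order_trans[OF norm_ge_zero R] by (intro K_nonneg) auto
  ultimately show ?thesis using True by simp
next
  case False
  hence t0: "0 < t" using t by simp
  have Qi: "(\<lambda>y. \<bar>Q y\<bar>) integrable_on {0..s}" if "s \<le> c" for s
    using Q_int[of s] that c unfolding absolutely_integrable_on_def by auto
  have iQ: "(\<lambda>y. \<bar>Q y\<bar> + norm z) integrable_on {0..t}"
    using Qi t by (intro integrable_add) auto
  have B0: "0 \<le> B" using order_trans[OF norm_ge_zero B[of 0]] t by simp
  have "complex_of_real (a t) * inner z f t = integral {0..t} (\<lambda>y. complex_of_real (a t) * integrand z f y)"
    unfolding inner_def by simp
  also have "norm \<dots> \<le> B * integral {0..t} (\<lambda>y. \<bar>Q y\<bar> + norm z)"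
  proof (rule integral_abs_le_const[OF _ iQ])
    show "(\<lambda>y. complex_of_real (a t) * integrand z f y) integrable_on {0..t}"
      using integrand_integrable'[OF t(2) c f] by (rule integrable_on_mult_right)
    show "norm (complex_of_real (a t) * integrand z f y) \<le> B * (\<bar>Q y\<bar> + norm z)" if y: "y \<in> {0..t}" for y
    proof -
      have "norm (complex_of_real (a t) * integrand z f y)
          = \<bar>a t * b y\<bar> * (norm (complex_of_real (Q y) - z) * norm (f y))"
        unfolding integrand_def by (simp add: norm_mult abs_mult)
      also have "\<dots> \<le> 1 * ((\<bar>Q y\<bar> + norm z) * B)"
      proof (intro mult_mono)
        show "\<bar>a t * b y\<bar> \<le> 1" using ab[of y t] y t0 t c by auto
        show "norm (complex_of_real (Q y) - z) \<le> \<bar>Q y\<bar> + norm z"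
          by (metis norm_of_real norm_triangle_ineq4)
      qed (use B[OF y] B0 in auto)
      finally show ?thesis by (simp add: mult_ac)
    qed
  qed
  also have "\<dots> \<le> B * K c R"
  proof (rule mult_left_mono[OF _ B0])
    have "integral {0..t} (\<lambda>y. \<bar>Q y\<bar> + norm z) = integral {0..t} (\<lambda>y. \<bar>Q y\<bar>) + t * norm z"
      using Qi[of t] t by (subst Henstock_Kurzweil_Integration.integral_add) auto
    also have "\<dots> \<le> integral {0..c} (\<lambda>y. \<bar>Q y\<bar>) + c * R"
      using t R Qi by (intro add_mono integral_subset_le mult_mono) auto
    finally show "integral {0..t} (\<lambda>y. \<bar>Q y\<bar> + norm z) \<le> K c R" unfolding K_def by (simp add: mult_ac)
  qed
  finally show ?thesis .
qed

lemma cont_bounded: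
  assumes "continuous_on {0..c} (f :: real \<Rightarrow> complex)"
  obtains B where "\<And>y. y \<in> {0..c} \<Longrightarrow> norm (f y) \<le> B" "B \<ge> 0"
proof -
  have "bounded (f ` {0..c})" by (intro compact_imp_bounded compact_continuous_image assms) auto
  then obtain B where "\<And>y. y \<in> {0..c} \<Longrightarrow> norm (f y) \<le> B" unfolding bounded_iff by blast
  thus ?thesis using that[of "max B 0"] by (simp add: le_max_iff_disj)
qed

lemma outer_integrable:
  assumes c: "c < X" and f: "continuous_on {0..c} f"
  shows "(\<lambda>t. complex_of_real (a t) * inner z f t) absolutely_integrable_on {0..c}"
proof -
  obtain B where B: "\<And>y. y \<in> {0..c} \<Longrightarrow> norm (f y) \<le> B" using cont_bounded[OF f] by blast
  show ?thesis
  proof (rule integrable_on_bounded_continuous_interior)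
    show "continuous_on {0<..<c} (\<lambda>t. complex_of_real (a t) * inner z f t)"
      using c by (intro continuous_intros continuous_on_subset[OF a_cont]
          continuous_on_subset[OF inner_cont[OF c f]]) auto
    show "norm (complex_of_real (a t) * inner z f t) \<le> B * K c (norm z)" if "t \<in> {0<..<c}" for t
      using that by (intro inner_bound[OF _ _ c f]) (auto intro: B)
  qed
qed

lemma outer_integrable':
  assumes "t \<le> c" "c < X" "continuous_on {0..c} f"
  shows "(\<lambda>t. complex_of_real (a t) * inner z f t) integrable_on {0..t}"
  using outer_integrable[of t f z] assms continuous_on_subset[of "{0..c}" f "{0..t}"]
    absolutely_integrable_on_def by auto

lemma outer_cont:
  assumes "c < X" "continuous_on {0..c} f"
  shows "continuous_on {0..c} (outer z f)"
  unfolding outer_def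
  using outer_integrable[OF assms] absolutely_integrable_on_def
  by (intro indefinite_integral_continuous_1) auto

text \<open>Each integration turns (K x)^n / n! into the next term of the exponential series, so the
  iteration converges on the whole interval, however large K is.\<close>

lemma outer_bound:
  assumes c: "c < X" and f: "continuous_on {0..c} f"
    and B: "\<And>y. y \<in> {0..c} \<Longrightarrow> norm (f y) \<le> M * (K c R * y) ^ n / fact n" and R: "norm z \<le> R"
    and M: "0 \<le> M" and x: "x \<in> {0..c}"
  shows "norm (outer z f x) \<le> M * (K c R * x) ^ Suc n / fact (Suc n)"
proof -
  have K0: "K c R \<ge> 0" using x order_trans[OF norm_ge_zero R] by (intro K_nonneg) auto
  have "((\<lambda>t. M * (K c R * t) ^ n / fact n * K c R) has_integral
      (M * (K c R * x) ^ Suc n / fact (Suc n) - M * (K c R * 0) ^ Suc n / fact (Suc n))) {0..x}"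
  proof (rule fundamental_theorem_of_calculus)
    show "((\<lambda>t. M * (K c R * t) ^ Suc n / fact (Suc n)) has_vector_derivative
        M * (K c R * t) ^ n / fact n * K c R) (at t within {0..x})" for t
    proof -
      have "((\<lambda>t. M * (K c R * t) ^ Suc n / fact (Suc n)) has_real_derivative
        M * (real (Suc n) * (K c R * t) ^ n * K c R) / fact (Suc n)) (at t within {0..x})"
        by (rule derivative_eq_intros refl | simp del: power_Suc fact_Suc)+
      moreover have "M * (real (Suc n) * (K c R * t) ^ n * K c R) / fact (Suc n)
          = M * (K c R * t) ^ n / fact n * K c R"
        by (simp add: divide_simps)
      ultimately show ?thesis by (simp only: has_real_derivative_iff_has_vector_derivative)
    qed
  qed (use x in auto)
  hence hi: "((\<lambda>t. M * (K c R * t) ^ n / fact n * K c R) has_integral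
      (M * (K c R * x) ^ Suc n / fact (Suc n))) {0..x}" by simp
  show ?thesis
    unfolding outer_def
  proof (rule order_trans[OF integral_norm_bound_integral])
    show "(\<lambda>t. complex_of_real (a t) * inner z f t) integrable_on {0..x}"
      using outer_integrable'[of x c] x c f by auto
    show "norm (complex_of_real (a t) * inner z f t) \<le> M * (K c R * t) ^ n / fact n * K c R"
      if t: "t \<in> {0..x}" for t
    proof (rule inner_bound[OF _ _ c f _ R])
      show "norm (f y) \<le> M * (K c R * t) ^ n / fact n" if "y \<in> {0..t}" for y
      proof -
        have "norm (f y) \<le> M * (K c R * y) ^ n / fact n" using B[of y] that t x by auto
        also have "\<dots> \<le> M * (K c R * t) ^ n / fact n"
          using that K0 M by (intro divide_right_mono mult_left_mono power_mono) auto
        finally show ?thesis .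
      qed
    qed (use t x in auto)
  qed (use hi in \<open>auto simp: has_integral_iff\<close>)
qed

lemma h_cont': "c < X \<Longrightarrow> continuous_on {0..c} h"
  by (rule continuous_on_subset[OF h_cont]) auto

lemma pic_cont: "c < X \<Longrightarrow> continuous_on {0..c} (pic z n)"
  by (induction n) (auto intro: outer_cont h_cont')

lemma pic_bound:
  assumes c: "c < X" and M: "\<And>y. y \<in> {0..c} \<Longrightarrow> norm (h y) \<le> M" and R: "norm z \<le> R"
    and x: "x \<in> {0..c}"
  shows "norm (pic z n x) \<le> M * (K c R * x) ^ n / fact n"
  using x
proof (induction n arbitrary: x)
  case (Suc n)
  have "0 \<le> M" using M[of x] Suc.prems norm_ge_zero[of "h x"] by linarith
  thus ?case using outer_bound[OF c pic_cont[OF c] Suc.IH R] Suc.prems by simp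
qed (use M in auto)

lemma pic_bound':
  assumes c: "c < X" and M: "\<And>y. y \<in> {0..c} \<Longrightarrow> norm (h y) \<le> M" and R: "norm z \<le> R"
    and x: "x \<in> {0..c}"
  shows "norm (pic z n x) \<le> M * (K c R * c) ^ n / fact n"
proof -
  have M0: "0 \<le> M" using M[of x] x norm_ge_zero[of "h x"] by linarith
  have K0: "K c R \<ge> 0" using x order_trans[OF norm_ge_zero R] by (intro K_nonneg) auto
  have "norm (pic z n x) \<le> M * (K c R * x) ^ n / fact n" by (rule pic_bound[OF c M R x])
  also have "\<dots> \<le> M * (K c R * c) ^ n / fact n"
    using x K0 M0 by (intro divide_right_mono mult_left_mono power_mono) auto
  finally show ?thesis .
qed

lemma summable_exp_bound: "summable (\<lambda>n. M * (k :: real) ^ n / fact n)"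
  using summable_mult[OF summable_exp_generic[of k], of M] by (simp add: divide_inverse mult_ac)

lemma suminf_exp_bound: "(\<Sum>n. M * (k :: real) ^ n / fact n) = M * exp k"
proof -
  have "(\<lambda>n. M * (inverse (fact n) * k ^ n)) sums (M * exp k)"
    using sums_mult[OF exp_converges[of k], of M] by (simp add: scaleR_conv_of_real divide_inverse)
  thus ?thesis by (simp add: sums_iff divide_inverse mult_ac)
qed

lemma pic_summable:
  assumes x: "x \<in> {0..<X}"
  shows "summable (\<lambda>n. pic z n x)"
proof -
  obtain B where B: "\<And>y. y \<in> {0..x} \<Longrightarrow> norm (h y) \<le> B" using cont_bounded[OF h_cont'[of x]] x by auto
  show ?thesis
    by (rule summable_comparison_test'[OF summable_exp_bound[of B "K x (norm z) * x"]])
      (use pic_bound[of x B z "norm z" x] B x in auto)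
qed

text \<open>Uniformity jointly in x and, on discs, in z is the source of both continuity in x and
  holomorphy in z.\<close>

lemma U_uniform:
  assumes c: "c < X"
  shows "uniform_limit ({0..c} \<times> cball 0 R) (\<lambda>N p. \<Sum>n<N. pic (snd p) n (fst p)) (\<lambda>p. U (snd p) (fst p)) sequentially"
proof -
  obtain B where B: "\<And>y. y \<in> {0..c} \<Longrightarrow> norm (h y) \<le> B" using cont_bounded[OF h_cont'[OF c]] by auto
  show ?thesis
    unfolding U_def
    by (rule Weierstrass_m_test[OF _ summable_exp_bound[of B "K c R * c"]])
       (use pic_bound'[OF c B] in auto)
qed

lemma U_uniform':
  assumes c: "c < X"
  shows "uniform_limit {0..c} (\<lambda>N x. \<Sum>n<N. pic z n x) (U z) sequentially"
proof (rule uniform_limitI)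
  fix e :: real assume "e > 0"
  from uniform_limitD[OF U_uniform[OF c, of "norm z"] this]
  show "\<forall>\<^sub>F n in sequentially. \<forall>x\<in>{0..c}. dist (\<Sum>n<n. pic z n x) (U z x) < e"
    by eventually_elim auto
qed

lemma U_cont: "c < X \<Longrightarrow> continuous_on {0..c} (U z)"
  by (rule uniform_limit_theorem[OF _ U_uniform'])
     (auto intro!: always_eventually continuous_intros pic_cont)

text \<open>The second bound tends to 0 with x, uniformly for |z| <= R; later it makes phi
  comparable to x^(l+1) near 0.\<close>

lemma U_bound:
  assumes c: "c < X" and M: "\<And>y. y \<in> {0..c} \<Longrightarrow> norm (h y) \<le> M" and R: "norm z \<le> R"
    and x: "x \<in> {0..c}"
  shows "norm (U z x) \<le> M * exp (K c R * x)" and "norm (U z x - h x) \<le> M * (exp (K c R * x) - 1)"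
proof -
  have s: "summable (\<lambda>n. pic z n x)" using pic_summable[of x z] x c by auto
  have nb: "norm (pic z n x) \<le> M * (K c R * x) ^ n / fact n" for n by (rule pic_bound[OF c M R x])
  have sb: "summable (\<lambda>n. M * (K c R * x) ^ n / fact n)" by (rule summable_exp_bound)
  have sn: "summable (\<lambda>n. norm (pic z n x))"
    by (rule summable_comparison_test'[OF sb]) (use nb in auto)
  have "norm (U z x) \<le> (\<Sum>n. norm (pic z n x))" unfolding U_def by (rule summable_norm[OF sn])
  also have "\<dots> \<le> (\<Sum>n. M * (K c R * x) ^ n / fact n)" by (rule suminf_le[OF nb sn sb])
  finally show "norm (U z x) \<le> M * exp (K c R * x)" by (simp only: suminf_exp_bound)
  have "U z x - h x = (\<Sum>n. pic z (Suc n) x)"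
    unfolding U_def using suminf_split_head[OF s] by simp
  also have "norm \<dots> \<le> (\<Sum>n. norm (pic z (Suc n) x))"
    using sn by (intro summable_norm) (subst summable_Suc_iff)
  also have "\<dots> \<le> (\<Sum>n. M * (K c R * x) ^ (Suc n) / fact (Suc n))"
  proof (rule suminf_le)
    show "norm (pic z (Suc n) x) \<le> M * (K c R * x) ^ (Suc n) / fact (Suc n)" for n using nb[of "Suc n"] .
    show "summable (\<lambda>n. norm (pic z (Suc n) x))"
      using sn by (subst summable_Suc_iff[where f = "\<lambda>n. norm (pic z n x)"])
    show "summable (\<lambda>n. M * (K c R * x) ^ (Suc n) / fact (Suc n))"
      using sb by (subst summable_Suc_iff[where f = "\<lambda>n. M * (K c R * x) ^ n / fact n"])
  qed
  also have "\<dots> = M * exp (K c R * x) - M"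
    using suminf_split_head[OF sb] by (simp add: suminf_exp_bound)
  finally show "norm (U z x - h x) \<le> M * (exp (K c R * x) - 1)" by (simp add: algebra_simps)
qed

lemma inner_add:
  assumes "c < X" "continuous_on {0..c} f" "continuous_on {0..c} g" "t \<in> {0..c}"
  shows "inner z (\<lambda>y. f y + g y) t = inner z f t + inner z g t"
proof -
  have "inner z (\<lambda>y. f y + g y) t = integral {0..t} (\<lambda>y. integrand z f y + integrand z g y)"
    unfolding inner_def integrand_def by (simp add: algebra_simps)
  thus ?thesis unfolding inner_def
    using integrand_integrable'[of t c] assms by (simp add: Henstock_Kurzweil_Integration.integral_add)
qed

lemma outer_add:
  assumes "c < X" "continuous_on {0..c} f" "continuous_on {0..c} g" "x \<in> {0..c}"
  shows "outer z (\<lambda>y. f y + g y) x = outer z f x + outer z g x"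
proof -
  have "outer z (\<lambda>y. f y + g y) x =
      integral {0..x} (\<lambda>t. complex_of_real (a t) * inner z f t + complex_of_real (a t) * inner z g t)"
    unfolding outer_def
  proof (rule Henstock_Kurzweil_Integration.integral_cong)
    fix t assume "t \<in> {0..x}"
    thus "complex_of_real (a t) * inner z (\<lambda>y. f y + g y) t =
        complex_of_real (a t) * inner z f t + complex_of_real (a t) * inner z g t"
      using inner_add[of c f g t] assms by (simp add: algebra_simps)
  qed
  thus ?thesis unfolding outer_def
    using outer_integrable'[of x c] assms by (simp add: Henstock_Kurzweil_Integration.integral_add)
qed

text \<open>The partial sums satisfy the equation up to a shift of the index, and
  \<open>outer_bound\<close> with exponent 0 makes \<open>outer\<close> continuous for uniform
  convergence, so the limit can be taken on both sides.\<close>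

lemma U_eq:
  assumes x: "x \<in> {0..<X}"
  shows "U z x = h x + outer z (U z) x"
proof -
  have c: "x < X" and xx: "x \<in> {0..x}" using x by auto
  define S where "S N y = (\<Sum>n<N. pic z n y)" for N y
  have S_cont: "continuous_on {0..x} (S N)" for N
    unfolding S_def by (intro continuous_intros pic_cont c)
  have S_lim: "(\<lambda>N. S N x) \<longlonglongrightarrow> U z x"
    unfolding S_def U_def by (rule summable_LIMSEQ[OF pic_summable[OF x]])
  have S_T: "outer z (S N) x + h x = S (Suc N) x" for N
  proof (induction N)
    case 0
    show ?case by (simp add: S_def outer_def inner_def integrand_def [abs_def])
  next
    case (Suc N)
    have "S (Suc N) = (\<lambda>y. S N y + pic z N y)" unfolding S_def by auto
    hence "outer z (S (Suc N)) x = outer z (S N) x + pic z (Suc N) x"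
      using outer_add[OF c S_cont pic_cont[OF c] xx] by simp
    thus ?case using Suc.IH unfolding S_def by simp
  qed
  have "(\<lambda>N. outer z (S N) x) \<longlonglongrightarrow> outer z (U z) x"
  proof (rule LIMSEQ_I)
    fix e :: real assume e: "e > 0"
    \<comment> \<open>The extra 1 makes \<open>k\<close> positive and the final error strictly
      smaller than \<open>e\<close>.\<close>
    define k where "k = K x (norm z) * x + 1"
    have k0: "k > 0" unfolding k_def using K_nonneg[of x "norm z"] x
      by (intro add_nonneg_pos mult_nonneg_nonneg) auto
    have "\<forall>\<^sub>F N in sequentially. \<forall>y\<in>{0..x}. dist (S N y) (U z y) < e / k"
      using uniform_limitD[OF U_uniform'[OF c], of "e / k"] e k0 unfolding S_def by auto
    then obtain N0 where N0: "\<And>N y. N \<ge> N0 \<Longrightarrow> y \<in> {0..x} \<Longrightarrow> dist (S N y) (U z y) < e / k"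
      unfolding eventually_sequentially by blast
    show "\<exists>N0. \<forall>N\<ge>N0. norm (outer z (S N) x - outer z (U z) x) < e"
    proof (intro exI allI impI)
      fix N assume N: "N \<ge> N0"
      define d where "d y = S N y - U z y" for y
      have dc: "continuous_on {0..x} d" unfolding d_def by (intro continuous_intros S_cont U_cont c)
      have "S N = (\<lambda>y. U z y + d y)" unfolding d_def by auto
      hence "outer z (S N) x = outer z (U z) x + outer z d x"
        using outer_add[OF c U_cont[OF c] dc xx] by simp
      moreover have "norm (outer z d x) \<le> (e / k) * (K x (norm z) * x) ^ Suc 0 / fact (Suc 0)"
        using N0[OF N] e k0 xx by (intro outer_bound[OF c dc]) (auto simp: d_def dist_norm intro: less_imp_le)
      moreover have "(e / k) * (K x (norm z) * x) < (e / k) * k"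
        using e k0 by (intro mult_strict_left_mono) (auto simp: k_def)
      ultimately show "norm (outer z (S N) x - outer z (U z) x) < e" using k0 by auto
    qed
  qed
  hence "(\<lambda>N. S (Suc N) x) \<longlonglongrightarrow> outer z (U z) x + h x"
    unfolding S_T[symmetric] by (intro tendsto_intros)
  moreover have "(\<lambda>N. S (Suc N) x) \<longlonglongrightarrow> U z x" using S_lim by (rule LIMSEQ_Suc)
  ultimately show ?thesis using LIMSEQ_unique by (metis add.commute)
qed

lemma inner_outer_holomorphic:
  assumes c: "c < X" and F: "\<And>z. continuous_on {0..c} (F z)"
    and holo: "\<And>y. y \<in> {0..c} \<Longrightarrow> (\<lambda>z. F z y) holomorphic_on UNIV"
    and bd: "\<And>R. \<exists>B. \<forall>z y. norm z \<le> R \<longrightarrow> y \<in> {0..c} \<longrightarrow> norm (F z y) \<le> B"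
    and x: "x \<in> {0..c}"
  shows "(\<lambda>z. inner z (F z) x) holomorphic_on UNIV" and "(\<lambda>z. outer z (F z) x) holomorphic_on UNIV"
proof -
  have inn: "(\<lambda>z. inner z (F z) t) holomorphic_on UNIV" if t: "t \<in> {0..c}" for t
    unfolding inner_def
  proof (rule holomorphic_on_parameter_integral)
    show "(\<lambda>z. integrand z (F z) y) holomorphic_on UNIV" if "y \<in> {0..t}" for y
      unfolding integrand_def using that t by (intro holomorphic_intros holo) auto
    show "integrand z (F z) integrable_on {0..t}" for z
      using integrand_integrable'[OF _ c F] t by auto
    show "\<exists>g. g integrable_on {0..t} \<and>
             (\<forall>z y. norm z \<le> R \<longrightarrow> y \<in> {0..t} \<longrightarrow> norm (integrand z (F z) y) \<le> g y)" for R
    proof -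
      obtain B where B: "\<And>z y. norm z \<le> R \<Longrightarrow> y \<in> {0..c} \<Longrightarrow> norm (F z y) \<le> B" using bd by blast
      have bc: "continuous_on {0..c} (\<lambda>y. complex_of_real (b y))"
        using c by (intro continuous_intros continuous_on_subset[OF b_cont]) auto
      obtain b1 where b1: "\<And>y. y \<in> {0..c} \<Longrightarrow> norm (complex_of_real (b y)) \<le> b1" "b1 \<ge> 0"
        using cont_bounded[OF bc] by blast
      have Qi: "(\<lambda>y. \<bar>Q y\<bar>) integrable_on {0..t}"
        using Q_int[of t] t c unfolding absolutely_integrable_on_def by auto
      show ?thesis
      proof (intro exI conjI allI impI)
        show "(\<lambda>y. b1 * (\<bar>Q y\<bar> + \<bar>R\<bar>) * \<bar>B\<bar>) integrable_on {0..t}"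
          using Qi by (intro integrable_on_mult_left integrable_on_mult_right integrable_add) auto
        fix z :: complex and y :: real assume zy: "norm z \<le> R" "y \<in> {0..t}"
        have "norm (complex_of_real (Q y) - z) \<le> \<bar>Q y\<bar> + \<bar>R\<bar>"
          using norm_triangle_ineq4[of "complex_of_real (Q y)" z] zy(1) by simp
        moreover have "norm (F z y) \<le> \<bar>B\<bar>" using B[of z y] zy t by auto
        ultimately show "norm (integrand z (F z) y) \<le> b1 * (\<bar>Q y\<bar> + \<bar>R\<bar>) * \<bar>B\<bar>"
          unfolding integrand_def norm_mult using b1(1)[of y] b1(2) zy t by (intro mult_mono) auto
      qed
    qed
  qed
  thus "(\<lambda>z. inner z (F z) x) holomorphic_on UNIV" using x by blast
  show "(\<lambda>z. outer z (F z) x) holomorphic_on UNIV"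
    unfolding outer_def
  proof (rule holomorphic_on_parameter_integral)
    show "(\<lambda>z. complex_of_real (a t) * inner z (F z) t) holomorphic_on UNIV" if "t \<in> {0..x}" for t
      using that x by (intro holomorphic_intros inn) auto
    show "(\<lambda>t. complex_of_real (a t) * inner z (F z) t) integrable_on {0..x}" for z
      using outer_integrable'[OF _ c F] x by auto
    show "\<exists>g. g integrable_on {0..x} \<and>
             (\<forall>z t. norm z \<le> R \<longrightarrow> t \<in> {0..x} \<longrightarrow> norm (complex_of_real (a t) * inner z (F z) t) \<le> g t)" for R
    proof -
      obtain B where B: "\<And>z y. norm z \<le> R \<Longrightarrow> y \<in> {0..c} \<Longrightarrow> norm (F z y) \<le> B" using bd by blast
      show ?thesis
      proof (intro exI conjI allI impI)
        show "(\<lambda>_. B * K c R) integrable_on {0..x}" by auto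
        show "norm (complex_of_real (a t) * inner z (F z) t) \<le> B * K c R"
          if "norm z \<le> R" "t \<in> {0..x}" for z t
          using that x by (intro inner_bound[OF _ _ c F]) (auto intro!: B)
      qed
    qed
  qed
qed

lemma pic_holomorphic:
  assumes "c < X" "x \<in> {0..c}"
  shows "(\<lambda>z. pic z n x) holomorphic_on UNIV"
  using assms(2)
proof (induction n arbitrary: x)
  case (Suc n)
  obtain M where M: "\<And>y. y \<in> {0..c} \<Longrightarrow> norm (h y) \<le> M" using cont_bounded[OF h_cont'[OF assms(1)]] by blast
  have "\<exists>B. \<forall>z y. norm z \<le> R \<longrightarrow> y \<in> {0..c} \<longrightarrow> norm (pic z n y) \<le> B" for R
    using pic_bound'[OF assms(1) M] by blast
  thus ?case using inner_outer_holomorphic(2)[OF assms(1) pic_cont[OF assms(1)] Suc.IH _ Suc.prems] by simp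
qed simp

lemma U_holomorphic:
  assumes x: "x \<in> {0..<X}"
  shows "(\<lambda>z. U z x) holomorphic_on UNIV"
proof (rule holomorphic_uniform_sequence[OF open_UNIV, where f = "\<lambda>N z. \<Sum>n<N. pic z n x"])
  have c: "x < X" "x \<in> {0..x}" using x by auto
  show "(\<lambda>z. \<Sum>n<N. pic z n x) holomorphic_on UNIV" for N
    by (intro holomorphic_intros pic_holomorphic[OF c])
  show "\<exists>d>0. cball z d \<subseteq> UNIV \<and> uniform_limit (cball z d) (\<lambda>N z. \<Sum>n<N. pic z n x) (\<lambda>z. U z x) sequentially" for z
  proof (intro exI conjI)
    show "uniform_limit (cball z 1) (\<lambda>N z. \<Sum>n<N. pic z n x) (\<lambda>z. U z x) sequentially"
    proof (rule uniform_limitI)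
      fix e :: real assume "e > 0"
      from uniform_limitD[OF U_uniform[OF c(1), of "norm z + 1"] this]
      show "\<forall>\<^sub>F n in sequentially. \<forall>w\<in>cball z 1. dist (\<Sum>n<n. pic w n x) (U w x) < e"
      proof eventually_elim
        case (elim n)
        show ?case
        proof
          fix w assume "w \<in> cball z 1"
          hence "norm w \<le> norm z + 1"
            using norm_triangle_ineq2[of w z] by (simp add: dist_norm norm_minus_commute)
          thus "dist (\<Sum>n<n. pic w n x) (U w x) < e" using elim c(2) by auto
        qed
      qed
    qed
  qed auto
qed

lemma U_locally_bounded:
  assumes c: "c < X"
  shows "\<exists>B. \<forall>z y. norm z \<le> R \<longrightarrow> y \<in> {0..c} \<longrightarrow> norm (U z y) \<le> B"
proof -
  obtain M where M: "\<And>y. y \<in> {0..c} \<Longrightarrow> norm (h y) \<le> M" "M \<ge> 0" using cont_bounded[OF h_cont'[OF c]] by blast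
  show ?thesis
  proof (intro exI allI impI)
    fix z :: complex and y :: real assume zy: "norm z \<le> R" "y \<in> {0..c}"
    have K0: "K c R \<ge> 0" using zy(2) order_trans[OF norm_ge_zero zy(1)] by (intro K_nonneg) auto
    have "norm (U z y) \<le> M * exp (K c R * y)" by (rule U_bound(1)[OF c M(1) zy]) auto
    also have "\<dots> \<le> M * exp (K c R * c)" using zy K0 M(2) by (intro mult_left_mono) (auto intro!: mult_left_mono)
    finally show "norm (U z y) \<le> M * exp (K c R * c)" .
  qed
qed

lemma inner_U_holomorphic:
  assumes "x \<in> {0..<X}"
  shows "(\<lambda>z. inner z (U z) x) holomorphic_on UNIV"
  using assms by (intro inner_outer_holomorphic(1)[of x U x] U_cont U_holomorphic U_locally_bounded) auto

lemma integral_nonneg_Reals: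
  fixes f :: "real \<Rightarrow> complex"
  assumes "f integrable_on S" "\<And>x. x \<in> S \<Longrightarrow> f x \<in> \<real>\<^sub>\<ge>\<^sub>0"
  shows "integral S f \<in> \<real>\<^sub>\<ge>\<^sub>0"
proof -
  have "Re (integral S f) = integral S (\<lambda>x. Re (f x))" "Im (integral S f) = integral S (\<lambda>x. Im (f x))"
    using integral_linear[OF assms(1) bounded_linear_Re] integral_linear[OF assms(1) bounded_linear_Im]
    by (simp_all add: o_def)
  moreover have "(\<lambda>x. Re (f x)) integrable_on S"
    using integrable_linear[OF assms(1) bounded_linear_Re] by (simp add: o_def)
  moreover have "integral S (\<lambda>x. Im (f x)) = integral S (\<lambda>x. 0)"
    using assms(2) by (intro Henstock_Kurzweil_Integration.integral_cong) (simp add: complex_nonneg_Reals_iff)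
  ultimately show ?thesis using assms(2)
    by (auto simp: complex_nonneg_Reals_iff intro!: Henstock_Kurzweil_Integration.integral_nonneg)
qed

lemma inner_nonneg:
  assumes c: "c < X" and f: "continuous_on {0..c} f" "\<And>y. y \<in> {0..c} \<Longrightarrow> f y \<in> \<real>\<^sub>\<ge>\<^sub>0"
    and bb: "\<And>y. y \<in> {0..c} \<Longrightarrow> b y \<ge> 0" and Qr: "\<And>y. y \<in> {0..c} \<Longrightarrow> Q y \<ge> r" and x: "x \<in> {0..c}"
  shows "inner (complex_of_real r) f x \<in> \<real>\<^sub>\<ge>\<^sub>0"
  unfolding inner_def
proof (rule integral_nonneg_Reals)
  show "integrand (complex_of_real r) f integrable_on {0..x}"
    using integrand_integrable'[OF _ c f(1)] x by auto
  show "integrand (complex_of_real r) f y \<in> \<real>\<^sub>\<ge>\<^sub>0" if "y \<in> {0..x}" for y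
    unfolding integrand_def using that x f(2)[of y] bb[of y] Qr[of y]
    by (intro nonneg_Reals_mult_I) (auto simp: complex_nonneg_Reals_iff)
qed

text \<open>Every ingredient of the iteration is nonnegative when z = r lies below Q. For the free
  equation at z = -k^2 this replaces the positivity of modified Bessel functions.\<close>

lemma U_nonneg:
  assumes c: "c < X" and hh: "\<And>y. y \<in> {0..c} \<Longrightarrow> h y \<in> \<real>\<^sub>\<ge>\<^sub>0"
    and aa: "\<And>t. 0 < t \<Longrightarrow> t \<le> c \<Longrightarrow> a t \<ge> 0"
    and bb: "\<And>y. y \<in> {0..c} \<Longrightarrow> b y \<ge> 0" and Qr: "\<And>y. y \<in> {0..c} \<Longrightarrow> Q y \<ge> r" and x: "x \<in> {0..c}"
  shows "U (complex_of_real r) x \<in> \<real>\<^sub>\<ge>\<^sub>0"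
proof -
  have nn: "pic (complex_of_real r) n x \<in> \<real>\<^sub>\<ge>\<^sub>0" if "x \<in> {0..c}" for n x
    using that
  proof (induction n arbitrary: x)
    case (Suc n)
    have "outer (complex_of_real r) (pic (complex_of_real r) n) x \<in> \<real>\<^sub>\<ge>\<^sub>0"
      unfolding outer_def
    proof (rule integral_nonneg_Reals)
      show "(\<lambda>t. complex_of_real (a t) * inner (complex_of_real r) (pic (complex_of_real r) n) t) integrable_on {0..x}"
        using outer_integrable'[OF _ c pic_cont[OF c]] Suc.prems by auto
      show "complex_of_real (a t) * inner (complex_of_real r) (pic (complex_of_real r) n) t \<in> \<real>\<^sub>\<ge>\<^sub>0"
        if "t \<in> {0..x}" for t
      proof (cases "t = 0")
        case False
        have "inner (complex_of_real r) (pic (complex_of_real r) n) t \<in> \<real>\<^sub>\<ge>\<^sub>0"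
          using that Suc.prems by (intro inner_nonneg[OF c pic_cont[OF c] Suc.IH bb Qr]) auto
        thus ?thesis using aa[of t] False that Suc.prems by (intro nonneg_Reals_mult_I) auto
      qed simp
    qed
    thus ?case by simp
  qed (use hh in auto)
  have s: "summable (\<lambda>n. pic (complex_of_real r) n x)" using pic_summable x c by auto
  have "Re (U (complex_of_real r) x) = (\<Sum>n. Re (pic (complex_of_real r) n x))"
    "Im (U (complex_of_real r) x) = (\<Sum>n. Im (pic (complex_of_real r) n x))"
    unfolding U_def using bounded_linear.suminf[OF bounded_linear_Re s] bounded_linear.suminf[OF bounded_linear_Im s] by auto
  moreover have "summable (\<lambda>n. Re (pic (complex_of_real r) n x))"
    using bounded_linear.summable[OF bounded_linear_Re s] .
  ultimately show ?thesis using nn[OF x]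
    by (auto simp: complex_nonneg_Reals_iff intro!: suminf_nonneg)
qed

lemma U_cnj:
  assumes hh: "\<And>y. y \<in> {0..<X} \<Longrightarrow> h y \<in> \<real>" and x: "x \<in> {0..<X}"
  shows "U (cnj z) x = cnj (U z x)"
proof -
  have cn: "pic (cnj z) n x = cnj (pic z n x)" if "x \<in> {0..<X}" for n x
    using that
  proof (induction n arbitrary: x)
    case (Suc n)
    have inn: "inner (cnj z) (pic (cnj z) n) t = cnj (inner z (pic z n) t)" if "t \<in> {0..x}" for t
      unfolding inner_def integral_cnj
    proof (rule Henstock_Kurzweil_Integration.integral_cong)
      fix y assume "y \<in> {0..t}"
      thus "integrand (cnj z) (pic (cnj z) n) y = cnj (integrand z (pic z n) y)"
        unfolding integrand_def using Suc.IH[of y] that Suc.prems by simp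
    qed
    have "outer (cnj z) (pic (cnj z) n) x = cnj (outer z (pic z n) x)"
      unfolding outer_def integral_cnj
      by (rule Henstock_Kurzweil_Integration.integral_cong) (simp add: inn)
    thus ?case by simp
  qed (use hh in \<open>auto simp: Reals_cnj_iff\<close>)
  show ?thesis unfolding U_def using cn[OF x] bounded_linear.suminf[OF bounded_linear_cnj pic_summable[OF x]] by simp
qed

lemma inner_U_cnj:
  assumes hh: "\<And>y. y \<in> {0..<X} \<Longrightarrow> h y \<in> \<real>" and x: "x \<in> {0..<X}"
  shows "inner (cnj z) (U (cnj z)) x = cnj (inner z (U z) x)"
  unfolding inner_def integral_cnj
proof (rule Henstock_Kurzweil_Integration.integral_cong)
  fix y assume "y \<in> {0..x}"
  thus "integrand (cnj z) (U (cnj z)) y = cnj (integrand z (U z) y)"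
    unfolding integrand_def using U_cnj[OF hh, of y z] x by simp
qed

end

lemma (in volterra) U_ac_on:
  assumes c: "c < X" and h: "ac_on h h1 0 c"
  shows "ac_on (U z) (\<lambda>t. h1 t + complex_of_real (a t) * inner z (U z) t) 0 c"
proof -
  have "ac_on (\<lambda>x. h x + outer z (U z) x) (\<lambda>t. h1 t + complex_of_real (a t) * inner z (U z) t) 0 c"
    using ac_on_indefinite_integral[OF outer_integrable[OF c U_cont[OF c]], of 0]
    by (intro ac_on_add h) (simp add: outer_def[abs_def])
  thus ?thesis by (rule ac_on_cong) (use c U_eq in auto)
qed

section \<open>Reflection of the interval, powers, and pointwise derivatives\<close>

lemma has_integral_reflect01:
  fixes g :: "real \<Rightarrow> 'a::euclidean_space"
  assumes "(g has_integral I) {c..d}"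
  shows "((\<lambda>x. g (1 - x)) has_integral I) {1 - d..1 - c}"
proof -
  have "(\<lambda>x::real. - x + 1) ` {c..d} = {1 - d..1 - c}"
    by (auto simp: image_iff intro!: bexI[of _ "1 - _"])
  thus ?thesis using has_integral_affinity[of g I c d "-1" 1] assms by (simp add: algebra_simps)
qed

lemma absolutely_integrable_reflect01:
  fixes g :: "real \<Rightarrow> 'a::euclidean_space"
  assumes "g absolutely_integrable_on {c..d}"
  shows "(\<lambda>x. g (1 - x)) absolutely_integrable_on {1 - d..1 - c}"
  using assms has_integral_reflect01[of g _ c d] has_integral_reflect01[of "\<lambda>x. norm (g x)" _ c d]
  unfolding absolutely_integrable_on_def integrable_on_def by blast

lemma ac_on_reflect01:
  assumes "ac_on f g c d"
  shows "ac_on (\<lambda>x. f (1 - x)) (\<lambda>x. - g (1 - x)) (1 - d) (1 - c)"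
  unfolding ac_on_def
proof (intro conjI ballI)
  have "(\<lambda>x. g (1 - x)) absolutely_integrable_on {1 - d..1 - c}"
    by (rule absolutely_integrable_reflect01[OF ac_on_abs_int[OF assms]])
  thus "(\<lambda>x. - g (1 - x)) absolutely_integrable_on {1 - d..1 - c}"
    unfolding set_integrable_def by simp
  show "((\<lambda>x. - g (1 - x)) has_integral (f (1 - x) - f (1 - (1 - d)))) {1 - d..x}"
    if x: "x \<in> {1 - d..1 - c}" for x
  proof -
    have "(g has_integral (f d - f (1 - x))) {1 - x..d}"
      by (rule ac_on_has_integral[OF assms]) (use x in auto)
    from has_integral_neg[OF has_integral_reflect01[OF this]] show ?thesis by simp
  qed
qed

lemma ac_on_powr:
  assumes "0 < a"
  shows "ac_on (\<lambda>x. complex_of_real (x powr r)) (\<lambda>x. complex_of_real (r * x powr (r - 1))) a b"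
proof (rule ac_on_C1)
  show "((\<lambda>x. complex_of_real (x powr r)) has_vector_derivative complex_of_real (r * x powr (r - 1))) (at x within {a..b})"
    if "x \<in> {a..b}" for x
  proof -
    have "((\<lambda>x. x powr r) has_real_derivative r * x powr (r - 1)) (at x within {a..b})"
      using that assms by (auto intro!: derivative_eq_intros simp: powr_diff divide_simps)
    thus ?thesis
      by (intro has_vector_derivative_of_real) (simp add: has_real_derivative_iff_has_vector_derivative)
  qed
  show "continuous_on {a..b} (\<lambda>x. complex_of_real (r * x powr (r - 1)))"
    using assms by (intro continuous_intros) auto
qed

lemma ac_on_vector_derivative:
  assumes "ac_on f g a b" "continuous_on {a..b} g" "x \<in> {a..b}"
  shows "(f has_vector_derivative g x) (at x within {a..b})"
proof -
  have "((\<lambda>u. f a + integral {a..u} g) has_vector_derivative g x) (at x within {a..b})"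
    using integral_has_vector_derivative[OF assms(2,3)] by (auto intro!: derivative_eq_intros)
  moreover have "f a + integral {a..y} g = f y" if "y \<in> {a..b}" for y
    using ac_on_integral[OF assms(1), of a y] that by auto
  ultimately show ?thesis
    using assms(3) by (metis (no_types, lifting) has_vector_derivative_transform)
qed

subsection \<open>Locally absolutely continuous functions and Wronskians\<close>

lemma has_loc_ac_derivD:
  assumes "has_loc_ac_deriv f g" "0 < a" "b \<le> 1"
  shows "ac_on f g a b"
proof (cases "a < 1")
  case True
  thus ?thesis using assms ac_on_subinterval[of f g a 1 a b] unfolding has_loc_ac_deriv_iff by auto
next
  case False
  then consider "b < a" | "a = 1" "b = 1" using assms by linarith
  thus ?thesis
  proof cases
    case 1 thus ?thesis unfolding ac_on_def by auto
  next
    case 2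
    have "g absolutely_integrable_on {1/2..1}" using assms(1) unfolding has_loc_ac_deriv_def by auto
    hence "g absolutely_integrable_on {1..1}" by (rule absolutely_integrable_on_subinterval) auto
    thus ?thesis using 2 unfolding ac_on_def by auto
  qed
qed

lemma has_loc_ac_deriv_continuous:
  assumes "has_loc_ac_deriv f g"
  shows "continuous_on {0<..1} f"
  unfolding continuous_on_eq_continuous_within
proof
  fix x :: real assume x: "x \<in> {0<..1}"
  have "continuous_on {x/2..1} f"
    by (rule ac_on_continuous[OF has_loc_ac_derivD[OF assms]]) (use x in auto)
  hence "continuous (at x within {x/2..1}) f" using x by (auto simp: continuous_on_eq_continuous_within)
  moreover have "at x within {x/2..1} = at x within {0<..1}"
  proof (rule at_within_nhd[of _ "{x/2<..}"])
    show "{x/2..1} \<inter> {x/2<..} - {x} = {0<..1} \<inter> {x/2<..} - {x}" using x by auto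
  qed (use x in auto)
  ultimately show "continuous (at x within {0<..1}) f"
    by (metis continuous_within)
qed

lemma has_loc_ac_deriv_wronskian:
  assumes "has_loc_ac_deriv u u1" "has_loc_ac_deriv u1 u2" "has_loc_ac_deriv v v1" "has_loc_ac_deriv v1 v2"
  shows "has_loc_ac_deriv (\<lambda>x. u1 x * v x - u x * v1 x) (\<lambda>x. u2 x * v x - u x * v2 x)"
  unfolding has_loc_ac_deriv_iff
proof
  fix a :: real assume "a \<in> {0<..<1}"
  hence *: "ac_on u u1 a 1" "ac_on u1 u2 a 1" "ac_on v v1 a 1" "ac_on v1 v2 a 1"
    using assms unfolding has_loc_ac_deriv_iff by auto
  show "ac_on (\<lambda>x. u1 x * v x - u x * v1 x) (\<lambda>x. u2 x * v x - u x * v2 x) a 1"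
    by (rule ac_on_cong[OF ac_on_diff[OF ac_on_mult[OF *(2,3)] ac_on_mult[OF *(1,4)]]])
      (simp_all add: algebra_simps)
qed

lemma has_loc_ac_deriv_zero_const:
  assumes "has_loc_ac_deriv F g" "\<And>x. x \<in> {0<..1} \<Longrightarrow> g x = 0" "x \<in> {0<..1}"
  shows "F x = F 1"
proof -
  have "integral {x..1} g = F 1 - F x"
    using assms(3) by (intro ac_on_integral[OF has_loc_ac_derivD[OF assms(1), of x 1]]) auto
  moreover have "integral {x..1} g = integral {x..1} (\<lambda>_. 0)"
    using assms by (intro Henstock_Kurzweil_Integration.integral_cong) auto
  ultimately show ?thesis by simp
qed

text \<open>The fundamental theorem started at the singular endpoint. It is applied to Wronskians,
  which tend to 0 there and have derivatives integrable on [0, 1].\<close>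

lemma has_loc_ac_deriv_from_0:
  assumes F: "has_loc_ac_deriv F g" and g: "g absolutely_integrable_on {0..1}"
    and lim: "(F \<longlongrightarrow> F0) (at_right 0)" and x: "x \<in> {0<..1}"
  shows "F x = F0 + integral {0..x} g"
proof -
  have x0: "0 < x" using x by simp
  have gi: "g integrable_on {0..x}"
    using absolutely_integrable_on_subinterval[OF g, of 0 x] x absolutely_integrable_on_def by auto
  have "continuous_on {0..x} (\<lambda>y. integral {0..y} g)"
    by (rule indefinite_integral_continuous_1[OF gi])
  hence "((\<lambda>y. integral {0..y} g) \<longlongrightarrow> 0) (at 0 within {0..x})"
    unfolding continuous_on_def using x by force
  hence "((\<lambda>y. integral {0..y} g) \<longlongrightarrow> 0) (at_right 0)"
    using x by (simp add: at_within_Icc_at_right)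
  hence "((\<lambda>y. F y + (integral {0..x} g - integral {0..y} g)) \<longlongrightarrow> F0 + (integral {0..x} g - 0)) (at_right 0)"
    by (intro tendsto_intros lim)
  moreover have "\<forall>\<^sub>F y in at_right 0. F y + (integral {0..x} g - integral {0..y} g) = F x"
    using eventually_at_right_real[of 0 x, OF x0]
  proof (eventually_elim)
    case (elim y)
    have "integral {0..y} g + integral {y..x} g = integral {0..x} g"
      using elim by (intro Henstock_Kurzweil_Integration.integral_combine gi) auto
    moreover have "integral {y..x} g = F x - F y"
      using elim x by (intro ac_on_integral[OF has_loc_ac_derivD[OF F, of y 1]]) auto
    ultimately show ?case by (simp add: algebra_simps)
  qed
  ultimately have "((\<lambda>y::real. F x) \<longlongrightarrow> F0 + (integral {0..x} g - 0)) (at_right 0)"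
    using tendsto_cong by force
  thus ?thesis by (simp add: tendsto_const_iff)
qed

lemma has_loc_ac_deriv_vector_derivative:
  assumes "has_loc_ac_deriv u u1" "has_loc_ac_deriv u1 u2" "0 < a" "b \<le> 1" "x \<in> {a..b}"
  shows "(u has_vector_derivative u1 x) (at x within {a..b})"
  using assms(5) has_loc_ac_derivD[OF assms(1,3,4)] ac_on_continuous[OF has_loc_ac_derivD[OF assms(2,3,4)]]
  by (intro ac_on_vector_derivative) auto

text \<open>Reduction of order: (u/v)' is the Wronskian divided by v^2. Since \<open>u1\<close> and
  \<open>v1\<close> are themselves absolutely continuous, u and v are continuously differentiable
  and the pointwise fundamental theorem applies.\<close>

lemma has_loc_ac_deriv_quotient_has_integral:
  assumes u: "has_loc_ac_deriv u u1" "has_loc_ac_deriv u1 u2" and v: "has_loc_ac_deriv v v1" "has_loc_ac_deriv v1 v2"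
    and ab: "0 < a" "a \<le> b" "b \<le> 1" and nz: "\<And>x. x \<in> {a..b} \<Longrightarrow> v x \<noteq> 0"
  shows "((\<lambda>x. (u1 x * v x - u x * v1 x) / (v x)\<^sup>2) has_integral (u b / v b - u a / v a)) {a..b}"
proof (rule fundamental_theorem_of_calculus[OF ab(2)])
  fix x assume x: "x \<in> {a..b}"
  have "((\<lambda>x. u x * inverse (v x)) has_vector_derivative
     (u x * (- (inverse (v x) * v1 x * inverse (v x))) + u1 x * inverse (v x))) (at x within {a..b})"
  proof (rule has_vector_derivative_mult)
    show "(u has_vector_derivative u1 x) (at x within {a..b})"
      using has_loc_ac_deriv_vector_derivative[OF u ab(1,3) x] .
    have "(v has_vector_derivative v1 x) (at x within {a..b})"
      using has_loc_ac_deriv_vector_derivative[OF v ab(1,3) x] .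
    thus "((\<lambda>x. inverse (v x)) has_vector_derivative - (inverse (v x) * v1 x * inverse (v x))) (at x within {a..b})"
      unfolding has_vector_derivative_def
      by (auto intro!: derivative_eq_intros nz x simp: algebra_simps)
  qed
  moreover have "u x * (- (inverse (v x) * v1 x * inverse (v x))) + u1 x * inverse (v x) = (u1 x * v x - u x * v1 x) / (v x)\<^sup>2"
    using nz[OF x] by (simp add: field_simps power2_eq_square)
  ultimately show "((\<lambda>x. u x / v x) has_vector_derivative (u1 x * v x - u x * v1 x) / (v x)\<^sup>2) (at x within {a..b})"
    by (simp add: divide_inverse)
qed

text \<open>Both products are of size x^(2l+1), and the exponent is positive exactly because l >
  -1/2.\<close>

lemma wronskian_tendsto_0:
  assumes l: "l > - 1 / 2"
    and "\<And>x. x \<in> {0<..1} \<Longrightarrow> norm (u x) \<le> C * x powr (l + 1)" "\<And>x. x \<in> {0<..1} \<Longrightarrow> norm (u1 x) \<le> C * x powr l"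
    and "\<And>x. x \<in> {0<..1} \<Longrightarrow> norm (v x) \<le> D * x powr (l + 1)" "\<And>x. x \<in> {0<..1} \<Longrightarrow> norm (v1 x) \<le> D * x powr l"
  shows "((\<lambda>x. u1 x * v x - u x * v1 x :: complex) \<longlongrightarrow> 0) (at_right 0)"
proof (rule Lim_null_comparison)
  show "\<forall>\<^sub>F x in at_right 0. norm (u1 x * v x - u x * v1 x) \<le> 2 * C * D * x powr (2 * l + 1)"
    using eventually_at_right_real[OF zero_less_one]
  proof (eventually_elim)
    case (elim x)
    have C: "0 \<le> C * x powr (l + 1)" "0 \<le> C * x powr l"
      using assms(2,3)[of x] elim norm_ge_zero order_trans by (metis greaterThanAtMost_iff greaterThanLessThan_iff less_imp_le)+
    have "norm (u1 x * v x - u x * v1 x) \<le> norm (u1 x) * norm (v x) + norm (u x) * norm (v1 x)"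
      by (metis norm_mult norm_triangle_ineq4)
    also have "\<dots> \<le> (C * x powr l) * (D * x powr (l + 1)) + (C * x powr (l + 1)) * (D * x powr l)"
      using elim assms(2-) C by (intro add_mono mult_mono) auto
    also have "\<dots> = 2 * C * D * (x powr l * x powr (l + 1))" by simp
    also have "x powr l * x powr (l + 1) = x powr (2 * l + 1)"
      by (simp add: powr_add [symmetric])
    finally show ?case .
  qed
  have "((\<lambda>x. x powr (2 * l + 1)) \<longlongrightarrow> 0) (at_right 0)"
    using l by (intro tendsto_zero_powrI[where b = "2 * l + 1"] tendsto_intros)
      (auto simp: eventually_at_filter)
  from tendsto_mult_right_zero[OF this]
  show "((\<lambda>x. 2 * C * D * x powr (2 * l + 1)) \<longlongrightarrow> 0) (at_right 0)" .
qed

subsection \<open>Solutions of the radial equation\<close>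

text \<open>The algebra behind phi'' = (V - z) phi, with X = x, Y = x^l, L = l and c = q(x); the
  terms with P cancel. It is separated so that powers and inverses become plain variables subject to
  X i = Y j = 1.\<close>

lemma phi_ode_identity:
  fixes X Y L W P c z :: complex
  assumes "X \<noteq> 0" "Y \<noteq> 0"
  shows "(L + 1) * (L * (Y / X)) * W + (L + 1) * Y * (inverse (Y * Y * X * X) * P) +
      ((- L - 1) * inverse (Y * X * X) * P + inverse (Y * X) * (Y * Y * X * X * (c - z) * W)) =
    (L * (L + 1) / X\<^sup>2 + c - z) * (Y * X * W)"
proof -
  define i j where "i = inverse X" and "j = inverse Y"
  have ij: "X * i = 1" "Y * j = 1" unfolding i_def j_def using assms by auto
  have "(L + 1) * (L * (Y * i)) * W + (L + 1) * Y * (j * j * i * i * P) +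
      ((- L - 1) * (j * i * i) * P + j * i * (Y * Y * X * X * (c - z) * W)) =
    (L * (L + 1) * (i * i) + c - z) * (Y * X * W)"
    using ij by algebra
  thus ?thesis unfolding i_def j_def by (simp only: divide_inverse inverse_mult_distrib power2_eq_square)
qed

locale radial =
  fixes l :: real and q :: "real \<Rightarrow> real"
  assumes l: "l > - 1 / 2" and q: "q absolutely_integrable_on {0..1}"
begin

definition V :: "real \<Rightarrow> real" where
  "V x = l * (l + 1) / x\<^sup>2 + q x"

text \<open>The right side of the equation itself serves as the derivative of \<open>u1\<close>;
  this is a legitimate representative because derivatives matter only up to null sets.\<close>

definition solves :: "complex \<Rightarrow> (real \<Rightarrow> complex) \<Rightarrow> (real \<Rightarrow> complex) \<Rightarrow> bool" where
  "solves z u u1 \<longleftrightarrow> has_loc_ac_deriv u u1 \<and>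
     has_loc_ac_deriv u1 (\<lambda>x. (complex_of_real (V x) - z) * u x)"

text \<open>Extension by zero, so that the Volterra equation lives on [0, 2) and x = 1 becomes an
  interior point.\<close>

definition q01 :: "real \<Rightarrow> real" where
  "q01 x = (if x \<in> {0..1} then q x else 0)"

lemma q01_integrable: "q01 absolutely_integrable_on {0..c}"
proof -
  have "(\<lambda>x. if x \<in> {0..1} then q x else 0) absolutely_integrable_on UNIV"
    using q by (simp only: absolutely_integrable_restrict_UNIV)
  hence "q01 absolutely_integrable_on UNIV" unfolding q01_def[abs_def] .
  thus ?thesis by (rule set_integrable_subset) auto
qed

text \<open>With u = x^(l+1) w the equation reads (x^(2l+2) w')' = x^(2l+2) (q - z) w. Integrating
  twice with w(0) = 1 gives a Volterra equation with the coefficients \<open>wa\<close> outside and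
  \<open>wb\<close> inside.\<close>

definition wa :: "real \<Rightarrow> real" where "wa t = t powr (- (2 * l + 2))"
definition wb :: "real \<Rightarrow> real" where "wb y = y powr (2 * l + 2)"

sublocale fwd: volterra 2 wa wb q01 "\<lambda>_. 1"
proof
  show "continuous_on {0<..<2::real} wa"
    unfolding wa_def by (intro continuous_intros) auto
  show "continuous_on {0..<2::real} wb"
    unfolding wb_def using l by (intro continuous_on_powr' continuous_intros) auto
  show "\<bar>wa t * wb y\<bar> \<le> 1" if "0 \<le> y" "y \<le> t" "0 < t" for y t :: real
  proof -
    have "y powr (2 * l + 2) \<le> t powr (2 * l + 2)" using that l by (intro powr_mono2) auto
    hence "t powr (- (2 * l + 2)) * y powr (2 * l + 2) \<le> t powr (- (2 * l + 2)) * t powr (2 * l + 2)"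
      by (intro mult_left_mono) auto
    also have "\<dots> = 1" using that by (simp add: powr_add [symmetric])
    finally show ?thesis by (simp add: wa_def wb_def)
  qed
qed (auto intro: q01_integrable)

definition w :: "complex \<Rightarrow> real \<Rightarrow> complex" where "w = fwd.U"
text \<open>The quasi-derivative x^(2l+2) w'. The formula for \<open>phi1\<close> is then the
  product rule for x^(l+1) w.\<close>

definition P :: "complex \<Rightarrow> real \<Rightarrow> complex" where "P z = fwd.inner z (fwd.U z)"

definition phi :: "complex \<Rightarrow> real \<Rightarrow> complex" where
  "phi z x = complex_of_real (x powr (l + 1)) * w z x"

definition phi1 :: "complex \<Rightarrow> real \<Rightarrow> complex" where
  "phi1 z x = complex_of_real ((l + 1) * x powr l) * w z x + complex_of_real (x powr (- l - 1)) * P z x"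

lemma phi_solves: "solves z (phi z) (phi1 z)"
  unfolding solves_def has_loc_ac_deriv_iff
proof (intro conjI ballI)
  fix a :: real assume a: "a \<in> {0<..<1}"
  have w: "ac_on (w z) (\<lambda>t. complex_of_real (wa t) * P z t) a 1"
    using ac_on_subinterval[OF fwd.U_ac_on[OF _ ac_on_const, of 1 z], of a 1] a unfolding w_def P_def by simp
  have P: "ac_on (P z) (fwd.integrand z (w z)) a 1"
    using ac_on_subinterval[OF fwd.inner_ac_on[OF _ fwd.U_cont, of 1 z z], of a 1] a unfolding w_def P_def by simp
  show "ac_on (phi z) (phi1 z) a 1"
  proof (rule ac_on_cong[OF ac_on_mult[OF ac_on_powr w]])
    fix x assume x: "x \<in> {a..1}"
    have "x powr (l + 1) * wa x = x powr (- l - 1)"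
      by (simp add: wa_def powr_add [symmetric])
    hence "complex_of_real (x powr (l + 1)) * complex_of_real (wa x) = complex_of_real (x powr (- l - 1))"
      by (metis of_real_mult)
    thus "complex_of_real ((l + 1) * x powr (l + 1 - 1)) * w z x +
        complex_of_real (x powr (l + 1)) * (complex_of_real (wa x) * P z x) = phi1 z x"
      unfolding phi1_def mult.assoc[symmetric] by simp
  qed (use a in \<open>auto simp: phi_def\<close>)
  show "ac_on (phi1 z) (\<lambda>x. (complex_of_real (V x) - z) * phi z x) a 1"
  proof (rule ac_on_cong[OF ac_on_add[OF ac_on_mult[OF ac_on_cmult[OF ac_on_powr] w] ac_on_mult[OF ac_on_powr P]]])
    fix x assume x: "x \<in> {a..1}"
    hence x0: "x > 0" "x \<le> 1" using a by auto
    define y where "y = x powr l"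
    have p: "x powr (l + 1) = y * x" "x powr (l - 1) = y / x"
      unfolding y_def using x0 by (simp_all add: powr_add powr_diff)
    have 1: "x powr (- l - 1) = inverse (x powr (l + 1))" "x powr (- l - 1 - 1) = inverse (x powr (l + 1 + 1))"
      "wa x = inverse (x powr (l + l + 1 + 1))" "wb x = x powr (l + l + 1 + 1)"
      unfolding powr_minus[symmetric] wa_def wb_def by (rule arg_cong[where f = "(powr) x"], simp)+
    have p': "x powr (- l - 1) = inverse (y * x)" "x powr (- l - 1 - 1) = inverse (y * x * x)"
      "wa x = inverse (y * y * x * x)" "wb x = y * y * x * x"
      unfolding 1 y_def powr_add using x0 by simp_all
    have y0: "y \<noteq> 0" unfolding y_def using x0 by simp
    have q: "q01 x = q x" using x0 unfolding q01_def by simp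
    show "complex_of_real (l + 1) * complex_of_real (l * x powr (l - 1)) * w z x +
         complex_of_real (l + 1) * complex_of_real (x powr l) * (complex_of_real (wa x) * P z x) +
         (complex_of_real ((- l - 1) * x powr (- l - 1 - 1)) * P z x +
          complex_of_real (x powr (- l - 1)) * fwd.integrand z (w z) x) =
         (complex_of_real (V x) - z) * phi z x"
      unfolding p p' y_def[symmetric] phi_def fwd.integrand_def V_def q
      using phi_ode_identity[of "complex_of_real x" "complex_of_real y" "complex_of_real l"] y0 x0 by simp
  qed (use a in \<open>auto simp: phi1_def\<close>)
qed

lemma w_locally_bounded: "\<exists>B\<ge>0. \<forall>z x. norm z \<le> R \<longrightarrow> x \<in> {0..1} \<longrightarrow>
    norm (w z x) \<le> B \<and> norm (complex_of_real (wa x) * P z x) \<le> B"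
proof -
  obtain B where B: "\<And>z y. norm z \<le> R \<Longrightarrow> y \<in> {0..1} \<Longrightarrow> norm (w z y) \<le> B"
    using fwd.U_locally_bounded[of 1 R] unfolding w_def by auto
  have 2: "norm (complex_of_real (wa x) * P z x) \<le> B * fwd.K 1 R" if "norm z \<le> R" "x \<in> {0..1}" for z x
    unfolding P_def using that B unfolding w_def
    by (intro fwd.inner_bound) (auto intro!: fwd.U_cont)
  show ?thesis
  proof (intro exI conjI allI impI)
    show "0 \<le> max 0 (max B (B * fwd.K 1 R))" by simp
    show "norm (w z x) \<le> max 0 (max B (B * fwd.K 1 R))"
      "norm (complex_of_real (wa x) * P z x) \<le> max 0 (max B (B * fwd.K 1 R))"
      if "norm z \<le> R" "x \<in> {0..1}" for z x
      using B[OF that] 2[OF that] by (simp_all add: le_max_iff_disj)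
  qed
qed

lemma phi_bounds: "\<exists>C\<ge>0. \<forall>z x. norm z \<le> R \<longrightarrow> x \<in> {0<..1} \<longrightarrow>
    norm (phi z x) \<le> C * x powr (l + 1) \<and> norm (phi1 z x) \<le> C * x powr l"
proof -
  obtain B where B0: "B \<ge> 0" and B: "\<And>z x. norm z \<le> R \<Longrightarrow> x \<in> {0..1} \<Longrightarrow> norm (w z x) \<le> B"
    "\<And>z x. norm z \<le> R \<Longrightarrow> x \<in> {0..1} \<Longrightarrow> norm (complex_of_real (wa x) * P z x) \<le> B"
    using w_locally_bounded[of R] by blast
  show ?thesis
  proof (intro exI conjI allI impI)
    \<comment> \<open>l + 1 comes from differentiating x^(l+1), the remaining 1 from the term with
      w', where x^(l+1) <= x^l.\<close>
    show "0 \<le> (l + 2) * B" using B0 l by simp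
    fix z :: complex and x :: real assume zx: "norm z \<le> R" "x \<in> {0<..1}"
    have "norm (phi z x) \<le> x powr (l + 1) * B"
      unfolding phi_def norm_mult using B(1)[of z x] zx by (intro mult_mono) auto
    also have "\<dots> \<le> (l + 2) * B * x powr (l + 1)"
      using mult_right_mono[of 1 "l + 2" "B * x powr (l + 1)"] B0 l by (simp add: mult_ac)
    finally show "norm (phi z x) \<le> (l + 2) * B * x powr (l + 1)" .
    have "x powr (- l - 1) = x powr (l + 1) * wa x" by (simp add: wa_def powr_add [symmetric])
    hence eq: "complex_of_real (x powr (- l - 1)) * P z x =
        complex_of_real (x powr (l + 1)) * (complex_of_real (wa x) * P z x)" by simp
    have "norm (complex_of_real (x powr (- l - 1)) * P z x) = x powr (l + 1) * norm (complex_of_real (wa x) * P z x)"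
      unfolding eq norm_mult[of "complex_of_real (x powr (l + 1))"] by simp
    also have "\<dots> \<le> x powr (l + 1) * B"
      using B(2)[of z x] zx by (intro mult_left_mono) auto
    also have "\<dots> \<le> x powr l * B" using zx B0 by (intro mult_right_mono) (auto intro!: powr_mono')
    finally have 1: "norm (complex_of_real (x powr (- l - 1)) * P z x) \<le> x powr l * B" .
    have "norm (complex_of_real ((l + 1) * x powr l) * w z x) \<le> ((l + 1) * x powr l) * B"
      unfolding norm_mult using B(1)[of z x] zx l by (intro mult_mono) (auto simp: abs_mult simp del: of_real_mult of_real_add)
    hence "norm (phi1 z x) \<le> ((l + 1) * x powr l) * B + x powr l * B"
      unfolding phi1_def using 1 by (intro order_trans[OF norm_triangle_ineq] add_mono)
    thus "norm (phi1 z x) \<le> (l + 2) * B * x powr l" by (simp add: algebra_simps)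
  qed
qed

text \<open>One \<open>d\<close> serves all |z| <= R. It keeps phi away from zero on (0, d], with
  |phi| >= x^(l+1) / 2.\<close>

lemma w_near_0: "\<exists>d\<in>{0<..1}. \<forall>z x. norm z \<le> R \<longrightarrow> x \<in> {0..d} \<longrightarrow> norm (w z x - 1) \<le> 1 / 2"
proof -
  have "isCont (\<lambda>x. exp (fwd.K 1 R * x) - 1) 0" by (intro continuous_intros)
  hence "((\<lambda>x. exp (fwd.K 1 R * x) - 1) \<longlongrightarrow> exp (fwd.K 1 R * 0) - 1) (at 0)"
    unfolding isCont_def .
  hence "\<forall>\<^sub>F x in at (0::real). dist (exp (fwd.K 1 R * x) - 1) (exp (fwd.K 1 R * 0) - 1) < 1 / 2"
    by (rule tendstoD) simp
  then obtain d where d: "d > 0" "\<And>x. x \<noteq> 0 \<Longrightarrow> dist x 0 < d \<Longrightarrow> dist (exp (fwd.K 1 R * x) - 1) 0 < 1 / 2"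
    unfolding eventually_at by auto
  show ?thesis
  proof (intro bexI allI impI)
    show "min 1 (d / 2) \<in> {0<..1}" using d by auto
    fix z :: complex and x :: real assume zx: "norm z \<le> R" "x \<in> {0..min 1 (d / 2)}"
    have "norm (w z x - 1) \<le> 1 * (exp (fwd.K 1 R * x) - 1)"
      unfolding w_def by (rule fwd.U_bound(2)[of 1 1 z R x]) (use zx in auto)
    also have "\<dots> \<le> 1 / 2"
    proof (cases "x = 0")
      case False
      hence "dist (exp (fwd.K 1 R * x) - 1) 0 < 1 / 2" using d zx by (intro d(2)) (auto simp: dist_real_def)
      hence "exp (fwd.K 1 R * x) - 1 < 1 / 2" unfolding dist_real_def diff_0_right abs_less_iff by blast
      thus ?thesis by simp
    qed simp
    finally show "norm (w z x - 1) \<le> 1 / 2" .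
  qed
qed

lemma w_0: "w z 0 = 1"
  unfolding w_def using fwd.U_eq[of 0 z] by (simp add: fwd.outer_def)

lemma w_continuous: "continuous_on {0..1} (w z)"
  unfolding w_def by (rule fwd.U_cont) simp

lemma phi_asymp: "((\<lambda>x. phi z x / complex_of_real (x powr (l + 1))) \<longlongrightarrow> 1) (at_right 0)"
proof -
  have "(w z \<longlongrightarrow> w z 0) (at 0 within {0..1})"
    using w_continuous unfolding continuous_on_def by auto
  hence "(w z \<longlongrightarrow> 1) (at_right 0)" by (simp add: w_0 at_within_Icc_at_right)
  moreover have "\<forall>\<^sub>F x in at_right 0. w z x = phi z x / complex_of_real (x powr (l + 1))"
    using eventually_at_right_real[OF zero_less_one] by eventually_elim (auto simp: phi_def)
  ultimately show ?thesis by (rule Lim_transform_eventually)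
qed

lemma phi_holomorphic:
  assumes "x \<in> {0..1}"
  shows "(\<lambda>z. phi z x) holomorphic_on UNIV" "(\<lambda>z. phi1 z x) holomorphic_on UNIV"
proof -
  have "(\<lambda>z. w z x) holomorphic_on UNIV" "(\<lambda>z. P z x) holomorphic_on UNIV"
    unfolding w_def P_def using assms by (auto intro!: fwd.U_holomorphic fwd.inner_U_holomorphic)
  thus "(\<lambda>z. phi z x) holomorphic_on UNIV" "(\<lambda>z. phi1 z x) holomorphic_on UNIV"
    unfolding phi_def phi1_def by (auto intro!: holomorphic_intros)
qed

lemma phi_cnj:
  assumes "x \<in> {0..1}"
  shows "phi (cnj z) x = cnj (phi z x)" "phi1 (cnj z) x = cnj (phi1 z x)"
  using fwd.U_cnj[of x z] fwd.inner_U_cnj[of x z] assms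
  unfolding phi_def phi1_def w_def P_def by auto

text \<open>Reflection \<open>x \<mapsto> 1 - x\<close> turns the initial value problem at \<open>1\<close> into a Volterra equation at \<open>0\<close>.\<close>

definition Vr :: "real \<Rightarrow> real" where "Vr y = V (1 - y)"

lemma V_integrable:
  assumes "0 < a"
  shows "V absolutely_integrable_on {a..1}"
proof -
  have "(\<lambda>x. l * (l + 1) / x\<^sup>2) absolutely_integrable_on {a..1}"
    using assms by (intro absolutely_integrable_continuous_real continuous_intros) auto
  moreover have "q absolutely_integrable_on {a..1}"
    by (rule absolutely_integrable_on_subinterval[OF q]) (use assms in auto)
  ultimately show ?thesis unfolding V_def[abs_def] by (rule set_integral_add(1))
qed

text \<open>In y = 1 - x the inhomogeneity c0 - c1 y is the straight line with value c0 and
  x-derivative c1 at x = 1. The half-open interval [0, 1) leaves out y = 1, where the potential is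
  singular.\<close>

lemma bwd: "volterra 1 (\<lambda>_. 1) (\<lambda>_. 1) Vr (\<lambda>y. c0 - c1 * complex_of_real y)"
proof
  show "Vr absolutely_integrable_on {0..c}" if "c < 1" for c
    using absolutely_integrable_reflect01[OF V_integrable[of "1 - c"]] that unfolding Vr_def[abs_def] by simp
qed (auto intro!: continuous_intros)

text \<open>The solution with u(1) = c0 and u'(1) = c1; \<open>chi 1 0\<close> and
  \<open>chi 0 1\<close> form the fundamental system c, s.\<close>

definition chi :: "complex \<Rightarrow> complex \<Rightarrow> complex \<Rightarrow> real \<Rightarrow> complex" where
  "chi c0 c1 z x = volterra.U (\<lambda>_. 1) (\<lambda>_. 1) Vr (\<lambda>y. c0 - c1 * complex_of_real y) z (1 - x)"

definition chi1 :: "complex \<Rightarrow> complex \<Rightarrow> complex \<Rightarrow> real \<Rightarrow> complex" where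
  "chi1 c0 c1 z x = c1 - volterra.inner (\<lambda>_. 1) Vr z
     (volterra.U (\<lambda>_. 1) (\<lambda>_. 1) Vr (\<lambda>y. c0 - c1 * complex_of_real y) z) (1 - x)"

lemma chi_solves: "solves z (chi c0 c1 z) (chi1 c0 c1 z)"
  unfolding solves_def has_loc_ac_deriv_iff
proof (intro conjI ballI)
  interpret B: volterra 1 "\<lambda>_. 1" "\<lambda>_. 1" Vr "\<lambda>y. c0 - c1 * complex_of_real y" by (rule bwd)
  fix a :: real assume a: "a \<in> {0<..<1}"
  have e1: "1 - (1 - a) = a" "1 - 0 = (1::real)" by auto
  have h: "ac_on (\<lambda>y. c0 - c1 * complex_of_real y) (\<lambda>y. - c1) 0 (1 - a)"
    by (rule ac_on_C1) (auto intro!: derivative_eq_intros)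
  have "ac_on (\<lambda>x. B.U z (1 - x)) (\<lambda>x. - (- c1 + complex_of_real 1 * B.inner z (B.U z) (1 - x))) (1 - (1 - a)) (1 - 0)"
    by (intro ac_on_reflect01 B.U_ac_on h) (use a in auto)
  thus "ac_on (chi c0 c1 z) (chi1 c0 c1 z) a 1"
    unfolding e1 by (rule ac_on_cong[of _ _ _ _ "chi c0 c1 z"]) (auto simp: chi_def chi1_def)
  have "ac_on (\<lambda>x. c1 - B.inner z (B.U z) (1 - x)) (\<lambda>x. 0 - (- B.integrand z (B.U z) (1 - x))) (1 - (1 - a)) (1 - 0)"
    by (intro ac_on_diff ac_on_const ac_on_reflect01 B.inner_ac_on B.U_cont) (use a in auto)
  thus "ac_on (chi1 c0 c1 z) (\<lambda>x. (complex_of_real (V x) - z) * chi c0 c1 z x) a 1"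
    unfolding e1 by (rule ac_on_cong[of _ _ _ _ "chi1 c0 c1 z"])
      (auto simp: chi_def chi1_def B.integrand_def Vr_def)
qed

lemma chi_at_1 [simp]: "chi c0 c1 z 1 = c0" "chi1 c0 c1 z 1 = c1"
proof -
  interpret B: volterra 1 "\<lambda>_. 1" "\<lambda>_. 1" Vr "\<lambda>y. c0 - c1 * complex_of_real y" by (rule bwd)
  show "chi c0 c1 z 1 = c0" using B.U_eq[of 0 z] by (simp add: chi_def B.outer_def)
  show "chi1 c0 c1 z 1 = c1" by (simp add: chi1_def)
qed

lemma chi_holomorphic:
  assumes "x \<in> {0<..1}"
  shows "(\<lambda>z. chi c0 c1 z x) holomorphic_on UNIV" "(\<lambda>z. chi1 c0 c1 z x) holomorphic_on UNIV"
proof -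
  interpret B: volterra 1 "\<lambda>_. 1" "\<lambda>_. 1" Vr "\<lambda>y. c0 - c1 * complex_of_real y" by (rule bwd)
  show "(\<lambda>z. chi c0 c1 z x) holomorphic_on UNIV" "(\<lambda>z. chi1 c0 c1 z x) holomorphic_on UNIV"
    unfolding chi_def chi1_def using assms
    by (auto intro!: holomorphic_intros B.U_holomorphic B.inner_U_holomorphic)
qed

lemma solvesD: "solves z u u1 \<Longrightarrow> has_loc_ac_deriv u u1"
    "solves z u u1 \<Longrightarrow> has_loc_ac_deriv u1 (\<lambda>x. (complex_of_real (V x) - z) * u x)"
  unfolding solves_def by auto

lemma solves_wronskian_const:
  assumes "solves z u u1" "solves z v v1" "x \<in> {0<..1}"
  shows "u1 x * v x - u x * v1 x = u1 1 * v 1 - u 1 * v1 1"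
  using has_loc_ac_deriv_zero_const[OF has_loc_ac_deriv_wronskian[OF solvesD[OF assms(1)] solvesD[OF assms(2)]] _ assms(3)]
  by (simp add: mult_ac)

lemma solves_quotient_has_integral:
  assumes u: "solves z u u1" and v: "solves z v v1" and ab: "0 < a" "a \<le> b" "b \<le> 1"
    and nz: "\<And>x. x \<in> {a..b} \<Longrightarrow> v x \<noteq> 0"
  shows "((\<lambda>x. (u1 1 * v 1 - u 1 * v1 1) / (v x)\<^sup>2) has_integral (u b / v b - u a / v a)) {a..b}"
proof (rule has_integral_eq[OF _ has_loc_ac_deriv_quotient_has_integral[OF solvesD[OF u] solvesD[OF v] ab nz]])
  show "(u1 x * v x - u x * v1 x) / (v x)\<^sup>2 = (u1 1 * v 1 - u 1 * v1 1) / (v x)\<^sup>2" if "x \<in> {a..b}" for x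
    using solves_wronskian_const[OF u v, of x] that ab by simp
qed

text \<open>Near 0, reduction of order against phi applies: u / phi is a constant plus a multiple of
  the integral of phi^-2, which is O(x^(-2l-1)) since |phi| >= x^(l+1) / 2. Multiplying by phi =
  O(x^(l+1)) leaves O(x^(-l)). Away from 0 compactness is enough.\<close>

lemma chi_bound: "\<exists>C\<ge>0. \<forall>x\<in>{0<..1}. norm (chi c0 c1 z x) \<le> C * x powr (- l)"
proof -
  define u where "u = chi c0 c1 z"
  obtain d where d: "d \<in> {0<..1}" and dw: "\<And>x. x \<in> {0..d} \<Longrightarrow> norm (w z x - 1) \<le> 1 / 2"
    using w_near_0[of "norm z"] by auto
  obtain C where C0: "C \<ge> 0" and C: "\<And>x. x \<in> {0<..1} \<Longrightarrow> norm (phi z x) \<le> C * x powr (l + 1)"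
    using phi_bounds[of "norm z"] by blast
  define W where "W = chi1 c0 c1 z 1 * phi z 1 - chi c0 c1 z 1 * phi1 z 1"
  have low: "norm (phi z x) \<ge> x powr (l + 1) / 2" if "x \<in> {0<..d}" for x
  proof -
    have "1 - norm (w z x) \<le> 1 / 2"
      using dw[of x] that norm_triangle_ineq2[of 1 "w z x"] by (auto simp: norm_minus_commute)
    hence "x powr (l + 1) * (1 / 2) \<le> x powr (l + 1) * norm (w z x)" by (intro mult_left_mono) auto
    thus ?thesis by (simp add: phi_def norm_mult)
  qed
  have ud: "continuous_on {d..1} u" unfolding u_def
    by (rule continuous_on_subset[OF has_loc_ac_deriv_continuous[OF solvesD(1)[OF chi_solves]]]) (use d in auto)
  hence "bounded (u ` {d..1})" by (intro compact_imp_bounded compact_continuous_image) auto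
  then obtain D where D: "\<And>x. x \<in> {d..1} \<Longrightarrow> norm (u x) \<le> D" unfolding bounded_iff by blast
  have D0: "D \<ge> 0" using order_trans[OF norm_ge_zero D[of 1]] d by auto
  define A where "A = norm (u d / phi z d)"
  \<comment> \<open>4 is the square of the 2 in 1 / |phi| <= 2 x^(-l-1), and 2 l + 1 comes from
    integrating y^(-2l-2).\<close>
  define B where "B = 4 * norm W / (2 * l + 1)"
  have B0: "B \<ge> 0" unfolding B_def using l by simp
  have small: "norm (u x) \<le> C * (A + B) * x powr (- l)" if x: "x \<in> {0<..d}" for x
  proof -
    have nz: "phi z y \<noteq> 0" if "y \<in> {x..d}" for y using low[of y] that x by auto
    have int: "((\<lambda>y. W / (phi z y)\<^sup>2) has_integral (u d / phi z d - u x / phi z x)) {x..d}"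
      unfolding W_def u_def
      by (rule solves_quotient_has_integral[OF chi_solves phi_solves]) (use x d nz in auto)
    have int2: "((\<lambda>y. 4 * norm W * y powr (- (2 * l + 2))) has_integral
       (4 * norm W * (d powr (- (2 * l + 1)) / (- (2 * l + 1))) - 4 * norm W * (x powr (- (2 * l + 1)) / (- (2 * l + 1))))) {x..d}"
    proof (rule fundamental_theorem_of_calculus)
      show "((\<lambda>y. 4 * norm W * (y powr (- (2 * l + 1)) / (- (2 * l + 1)))) has_vector_derivative
          4 * norm W * y powr (- (2 * l + 2))) (at y within {x..d})" if "y \<in> {x..d}" for y
      proof -
        have "((\<lambda>y. y powr (- (2 * l + 1))) has_real_derivative (- (2 * l + 1)) * y powr (- (2 * l + 1) - 1)) (at y within {x..d})"
          using that x by (intro has_field_derivative_at_within[OF has_real_derivative_powr]) auto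
        from DERIV_cmult[OF DERIV_cdivide[OF this, of "- (2 * l + 1)"], of "4 * norm W"]
        have "((\<lambda>y. 4 * norm W * (y powr (- (2 * l + 1)) / (- (2 * l + 1)))) has_real_derivative
          4 * norm W * ((- (2 * l + 1)) * y powr (- (2 * l + 1) - 1) / (- (2 * l + 1)))) (at y within {x..d})" .
        moreover have "(- (2 * l + 1)) * y powr (- (2 * l + 1) - 1) / (- (2 * l + 1)) = y powr (- (2 * l + 1) - 1)"
          using l by simp
        moreover have "- (2 * l + 1) - 1 = - (2 * l + 2)" by simp
        ultimately show ?thesis
          by (simp only: has_real_derivative_iff_has_vector_derivative)
      qed
    qed (use x in auto)
    have "norm (integral {x..d} (\<lambda>y. W / (phi z y)\<^sup>2)) \<le> integral {x..d} (\<lambda>y. 4 * norm W * y powr (- (2 * l + 2)))"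
    proof (rule integral_norm_bound_integral)
      fix y assume y: "y \<in> {x..d}"
      have y0: "y > 0" using y x by auto
      have "(y powr (l + 1) / 2)\<^sup>2 \<le> (norm (phi z y))\<^sup>2" using low[of y] y x by (intro power_mono) auto
      hence "norm W / (norm (phi z y))\<^sup>2 \<le> norm W / (y powr (l + 1) / 2)\<^sup>2"
        using y0 nz[OF y] by (intro divide_left_mono mult_pos_pos) auto
      also have "\<dots> = 4 * norm W / (y powr (l + 1) * y powr (l + 1))" by (simp add: power2_eq_square)
      also have "y powr (l + 1) * y powr (l + 1) = y powr (2 * l + 2)" by (simp add: powr_add [symmetric])
      also have "4 * norm W / y powr (2 * l + 2) = 4 * norm W * y powr (- (2 * l + 2))"
        by (simp only: powr_minus divide_inverse)
      finally show "norm (W / (phi z y)\<^sup>2) \<le> 4 * norm W * y powr (- (2 * l + 2))"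
        by (simp add: norm_divide norm_power)
    qed (rule has_integral_integrable[OF int] has_integral_integrable[OF int2])+
    hence "norm (u d / phi z d - u x / phi z x) \<le>
      4 * norm W * (d powr (- (2 * l + 1)) / (- (2 * l + 1))) - 4 * norm W * (x powr (- (2 * l + 1)) / (- (2 * l + 1)))"
      unfolding integral_unique[OF int] integral_unique[OF int2] .
    also have "\<dots> \<le> B * x powr (- (2 * l + 1))"
    proof -
      have "4 * norm W * (d powr (- (2 * l + 1)) / (- (2 * l + 1))) \<le> 0"
        using l by (intro mult_nonneg_nonpos divide_nonneg_nonpos) auto
      moreover have "- (4 * norm W * (x powr (- (2 * l + 1)) / (- (2 * l + 1)))) = B * x powr (- (2 * l + 1))"
        unfolding B_def using l by (simp add: field_simps)
      ultimately show ?thesis by linarith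
    qed
    finally have "norm (u x / phi z x) \<le> A + B * x powr (- (2 * l + 1))"
      unfolding A_def using norm_triangle_sub[of "u x / phi z x" "u d / phi z d"]
      unfolding norm_minus_commute[of "u x / phi z x"] by linarith
    also have "\<dots> \<le> (A + B) * x powr (- (2 * l + 1))"
    proof -
      have "x powr 0 \<le> x powr (- (2 * l + 1))" using x d l by (intro powr_mono') auto
      hence "A * 1 \<le> A * x powr (- (2 * l + 1))" using x by (intro mult_left_mono) (auto simp: A_def)
      thus ?thesis by (simp add: distrib_right)
    qed
    finally have *: "norm (u x / phi z x) \<le> (A + B) * x powr (- (2 * l + 1))" .
    have "norm (u x) = norm (u x / phi z x) * norm (phi z x)" using nz[of x] x by (simp add: norm_divide)
    also have "\<dots> \<le> ((A + B) * x powr (- (2 * l + 1))) * (C * x powr (l + 1))"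
      using * C[of x] x d B0 by (intro mult_mono) (auto simp: A_def)
    also have "\<dots> = C * (A + B) * (x powr (- (2 * l + 1)) * x powr (l + 1))" by simp
    also have "x powr (- (2 * l + 1)) * x powr (l + 1) = x powr (- l)" by (simp add: powr_add [symmetric])
    finally show ?thesis .
  qed
  \<comment> \<open>A lower bound for x^(-l) on [d, 1]. This power is decreasing for l >= 0 and
    increasing for l < 0, so the minimum is attained at an end.\<close>
  define m where "m = min 1 (d powr (- l))"
  have m0: "m > 0" unfolding m_def using d by simp
  have AB: "0 \<le> C * (A + B)" using C0 B0 unfolding A_def by simp
  have m: "m \<le> x powr (- l)" if x: "x \<in> {d..1}" for x
  proof (cases "l \<ge> 0")
    case True
    have "x powr 0 \<le> x powr (- l)" using x d True by (intro powr_mono') auto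
    thus ?thesis using x d unfolding m_def by auto
  next
    case False
    have "d powr (- l) \<le> x powr (- l)" using x d False by (intro powr_mono2) auto
    thus ?thesis unfolding m_def by simp
  qed
  show ?thesis
  proof (intro exI conjI ballI)
    show "0 \<le> C * (A + B) + D / m" using AB D0 m0 by simp
    show "norm (chi c0 c1 z x) \<le> (C * (A + B) + D / m) * x powr (- l)" if x: "x \<in> {0<..1}" for x
    proof (cases "x \<le> d")
      case True
      have "norm (u x) \<le> C * (A + B) * x powr (- l)" using small x True by auto
      moreover have "0 \<le> D / m * x powr (- l)" using D0 m0 by simp
      ultimately show ?thesis unfolding u_def by (simp add: distrib_right)
    next
      case False
      have "norm (u x) \<le> D / m * m" using D[of x] x False m0 by simp
      also have "\<dots> \<le> D / m * x powr (- l)" using m[of x] x False D0 m0 by (intro mult_left_mono) auto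
      moreover have "0 \<le> C * (A + B) * x powr (- l)" using AB by simp
      ultimately show ?thesis unfolding u_def by (simp add: distrib_right)
    qed
  qed
qed

end

subsection \<open>The space \<open>L\<^sup>2(0,1)\<close>\<close>

definition L2 :: "(real \<Rightarrow> complex) set" where "L2 = Lp 2"

lemma L2_iff: "f \<in> L2 \<longleftrightarrow> f \<in> borel_measurable M01 \<and> integrable M01 (\<lambda>x. (norm (f x))\<^sup>2)"
proof -
  have "norm y powr real_of_ereal 2 = (norm y)\<^sup>2" for y :: complex
    by simp
  thus ?thesis unfolding L2_def Lp_def by simp
qed

text \<open>Estimates are made for squared norms with |f + g|^2 <= 2 |f|^2 + 2 |g|^2, which takes
  the place of Minkowski's inequality.\<close>

definition sq_norm :: "(real \<Rightarrow> complex) \<Rightarrow> real" where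
  "sq_norm f = (\<integral>x. (norm (f x))\<^sup>2 \<partial>M01)"

lemma sq_norm_nonneg: "0 \<le> sq_norm f" unfolding sq_norm_def by simp

lemma norm_L2_eq: "norm_L2 f = sqrt (sq_norm f)"
  unfolding norm_L2_def sq_norm_def ..

lemma norm_L2_power2: "(norm_L2 f)\<^sup>2 = sq_norm f"
  unfolding norm_L2_eq using sq_norm_nonneg by simp

lemma norm_L2_nonneg: "0 \<le> norm_L2 f"
  unfolding norm_L2_eq using sq_norm_nonneg by simp

lemma integrable_M01_iff:
  fixes f :: "real \<Rightarrow> 'a::euclidean_space"
  shows "integrable M01 f \<longleftrightarrow> f absolutely_integrable_on {0..1}"
  unfolding absolutely_integrable_on_Icc_iff_Ioo by (simp add: set_integrable_def integrable_restrict_space)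

lemma integral_M01_eq:
  fixes f :: "real \<Rightarrow> 'a::euclidean_space"
  assumes "integrable M01 f"
  shows "(\<integral>x. f x \<partial>M01) = integral {0..1} f"
  using lebesgue_integral_eq_integral[OF assms] integral_open_interval_real[of 0 1 f] by simp

lemma AE_M01_negligible:
  assumes "AE x in M01. P x"
  obtains N where "negligible N" "\<And>x. 0 < x \<Longrightarrow> x < 1 \<Longrightarrow> x \<notin> N \<Longrightarrow> P x"
proof -
  have "AE x in lebesgue. x \<in> {0<..<1} \<longrightarrow> P x"
    using assms by (subst (asm) AE_restrict_space_iff) auto
  then obtain N where "negligible N" "{x. \<not> (x \<in> {0<..<1} \<longrightarrow> P x)} \<subseteq> N"
    unfolding eventually_ae_filter_negligible by blast
  thus ?thesis using that[of N] by auto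
qed

lemma measure_M01 [simp]: "emeasure M01 {0<..<1} = 1" "measure M01 {0<..<1} = 1"
  by (simp_all add: emeasure_restrict_space measure_restrict_space)

lemma integrable_const_M01 [simp]: "integrable M01 (\<lambda>_. c :: 'a::{banach,second_countable_topology})"
  by (intro finite_measure.integrable_const finite_measureI) simp

lemma L2_imp_integrable:
  assumes "f \<in> L2"
  shows "integrable M01 (f :: real \<Rightarrow> complex)"
proof (rule Bochner_Integration.integrable_bound[where f = "\<lambda>x. 1 + (norm (f x))\<^sup>2"])
  show "integrable M01 (\<lambda>x. 1 + (norm (f x))\<^sup>2)"
    using assms unfolding L2_iff by (intro Bochner_Integration.integrable_add) auto
  show "f \<in> borel_measurable M01" using assms unfolding L2_iff by auto
  have "norm (f x) \<le> norm (1 + (norm (f x))\<^sup>2)" for x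
  proof -
    have "0 \<le> (norm (f x) - 1)\<^sup>2" by simp
    hence "2 * norm (f x) \<le> 1 + (norm (f x))\<^sup>2" by (simp add: power2_eq_square algebra_simps)
    thus ?thesis using norm_ge_zero[of "f x"] by (simp only: real_norm_def; linarith)
  qed
  thus "AE x in M01. norm (f x) \<le> norm (1 + (norm (f x))\<^sup>2)" by simp
qed

text \<open>Cauchy-Schwarz on a space of mass 1: integrate |f| <= t/2 + |f|^2 / (2t) and choose t
  equal to the norm. For norm 0 arbitrarily small t are taken instead.\<close>

lemma L1_le_norm_L2:
  assumes f: "f \<in> L2"
  shows "(\<integral>x. norm (f x) \<partial>M01) \<le> norm_L2 f"
proof -
  have *: "(\<integral>x. norm (f x) \<partial>M01) \<le> t / 2 + sq_norm f / (2 * t)" if t: "t > 0" for t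
  proof -
    have int: "integrable M01 (\<lambda>x. (norm (f x))\<^sup>2 / (2 * t))"
      using f unfolding L2_iff by auto
    have "(\<integral>x. norm (f x) \<partial>M01) \<le> (\<integral>x. t / 2 + (norm (f x))\<^sup>2 / (2 * t) \<partial>M01)"
    proof (rule integral_mono)
      show "norm (f x) \<le> t / 2 + (norm (f x))\<^sup>2 / (2 * t)" for x
      proof -
        have "0 \<le> (norm (f x) - t)\<^sup>2" by simp
        hence "2 * t * norm (f x) \<le> t * t + (norm (f x))\<^sup>2" by (simp add: power2_eq_square algebra_simps)
        thus ?thesis using t by (simp add: field_simps)
      qed
    qed (use L2_imp_integrable[OF f] int in auto)
    also have "\<dots> = t / 2 + sq_norm f / (2 * t)"
      unfolding sq_norm_def using int by (subst Bochner_Integration.integral_add) auto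
    finally show ?thesis .
  qed
  show ?thesis
  proof (cases "sq_norm f = 0")
    case True
    have "(\<integral>x. norm (f x) \<partial>M01) \<le> 0 + e" if "e > 0" for e using *[of "2 * e"] that True by simp
    hence "(\<integral>x. norm (f x) \<partial>M01) \<le> 0" by (rule field_le_epsilon)
    thus ?thesis by (rule order_trans[OF _ norm_L2_nonneg])
  next
    case False
    hence p: "sq_norm f > 0" using sq_norm_nonneg[of f] by simp
    define N where "N = sqrt (sq_norm f)"
    have N: "N > 0" "sq_norm f = N * N" using p unfolding N_def by auto
    have "N / 2 + N * N / (2 * N) = N" using N(1) by simp
    moreover have "norm_L2 f = N" unfolding norm_L2_eq N_def ..
    ultimately show ?thesis using *[OF N(1)] unfolding N(2) by simp
  qed
qed

lemma L2_add:
  assumes f: "f \<in> L2" and g: "g \<in> L2"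
  shows "(\<lambda>x. f x + g x :: complex) \<in> L2" and "sq_norm (\<lambda>x. f x + g x) \<le> 2 * sq_norm f + 2 * sq_norm g"
proof -
  have le: "(norm (f x + g x))\<^sup>2 \<le> 2 * (norm (f x))\<^sup>2 + 2 * (norm (g x))\<^sup>2" for x
  proof -
    have "(norm (f x + g x))\<^sup>2 \<le> (norm (f x) + norm (g x))\<^sup>2"
      by (intro power_mono norm_triangle_ineq) auto
    moreover have "0 \<le> (norm (f x) - norm (g x))\<^sup>2" by simp
    ultimately show ?thesis by (simp add: power2_eq_square algebra_simps)
  qed
  have i: "integrable M01 (\<lambda>x. 2 * (norm (f x))\<^sup>2)" "integrable M01 (\<lambda>x. 2 * (norm (g x))\<^sup>2)"
    using f g unfolding L2_iff by auto
  have m: "(\<lambda>x. f x + g x) \<in> borel_measurable M01" using f g unfolding L2_iff by auto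
  have int: "integrable M01 (\<lambda>x. (norm (f x + g x))\<^sup>2)"
    by (rule Bochner_Integration.integrable_bound[OF Bochner_Integration.integrable_add[OF i]])
      (use m le in auto)
  show "(\<lambda>x. f x + g x) \<in> L2" unfolding L2_iff using m int by simp
  have "sq_norm (\<lambda>x. f x + g x) \<le> (\<integral>x. 2 * (norm (f x))\<^sup>2 + 2 * (norm (g x))\<^sup>2 \<partial>M01)"
    unfolding sq_norm_def by (intro integral_mono int Bochner_Integration.integrable_add i le)
  also have "\<dots> = 2 * sq_norm f + 2 * sq_norm g"
    unfolding sq_norm_def using i by simp
  finally show "sq_norm (\<lambda>x. f x + g x) \<le> 2 * sq_norm f + 2 * sq_norm g" .
qed

lemma L2_cmult:
  assumes f: "f \<in> L2"
  shows "(\<lambda>x. c * f x :: complex) \<in> L2" and "sq_norm (\<lambda>x. c * f x) = (norm c)\<^sup>2 * sq_norm f"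
  using f unfolding L2_iff sq_norm_def by (auto simp: norm_mult power_mult_distrib)

lemma L2_diff:
  assumes f: "f \<in> L2" and g: "g \<in> L2"
  shows "(\<lambda>x. f x - g x :: complex) \<in> L2" and "sq_norm (\<lambda>x. f x - g x) \<le> 2 * sq_norm f + 2 * sq_norm g"
  using L2_add[OF f L2_cmult(1)[OF g, of "-1"]] L2_cmult(2)[OF g, of "-1"] by simp_all

lemma L2_bounded:
  fixes u :: "real \<Rightarrow> complex"
  assumes m: "u \<in> borel_measurable M01" and B: "\<And>x. x \<in> {0<..<1} \<Longrightarrow> norm (u x) \<le> B"
  shows "u \<in> L2" and "norm_L2 u \<le> B"
proof -
  have B0: "0 \<le> B" using order_trans[OF norm_ge_zero B[of "1/2"]] by simp
  have le: "(norm (u x))\<^sup>2 \<le> B\<^sup>2" if "x \<in> {0<..<1}" for x using B[OF that] by (intro power_mono) auto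
  have sp: "space M01 = {0<..<1}" by (simp add: space_restrict_space)
  have int: "integrable M01 (\<lambda>x. (norm (u x))\<^sup>2)"
    by (rule Bochner_Integration.integrable_bound[of _ "\<lambda>_. B\<^sup>2"]) (use m le sp in \<open>auto intro!: AE_I2\<close>)
  thus "u \<in> L2" unfolding L2_iff using m by simp
  have "sq_norm u \<le> (\<integral>x. B\<^sup>2 \<partial>M01)"
    unfolding sq_norm_def by (rule integral_mono[OF int]) (use le sp in auto)
  hence "sq_norm u \<le> B\<^sup>2" by simp
  thus "norm_L2 u \<le> B" unfolding norm_L2_eq by (rule real_le_lsqrt[OF B0])
qed

lemma continuous_imp_measurable_M01:
  fixes u :: "real \<Rightarrow> complex"
  assumes "continuous_on {0<..1} u"
  shows "u \<in> borel_measurable M01"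
  by (intro continuous_imp_measurable_on_sets_lebesgue continuous_on_subset[OF assms]) auto

lemma has_loc_ac_deriv_AE:
  assumes f: "has_loc_ac_deriv f g" and ae: "AE x in M01. g x = g' x"
  shows "has_loc_ac_deriv f g'"
proof -
  obtain N where N: "negligible N" "\<And>x. 0 < x \<Longrightarrow> x < 1 \<Longrightarrow> x \<notin> N \<Longrightarrow> g x = g' x"
    using AE_M01_negligible[OF ae] by blast
  \<comment> \<open>\<open>M01\<close> lives on the open interval and says nothing about the point
    1, so 1 joins the exceptional set.\<close>
  have N1: "negligible (insert 1 N)" using N(1) by simp
  have eq: "g' x = g x" if "x \<in> {a..1} - insert 1 N" "0 < a" for x a using N(2)[of x] that by auto
  show ?thesis
    unfolding has_loc_ac_deriv_iff ac_on_def
  proof (intro ballI conjI)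
    fix a :: real assume a: "a \<in> {0<..<1}"
    have f': "ac_on f g a 1" using f a unfolding has_loc_ac_deriv_iff by blast
    show "g' absolutely_integrable_on {a..1}"
      by (rule absolutely_integrable_spike[OF ac_on_abs_int[OF f'] N1]) (use eq a in auto)
    show "(g' has_integral (f x - f a)) {a..x}" if "x \<in> {a..1}" for x
      by (rule has_integral_spike[OF N1 _ ac_on_has_integral[OF f']]) (use eq[of _ a] a that in auto)
  qed
qed

lemma has_loc_ac_deriv_add:
  "has_loc_ac_deriv f g \<Longrightarrow> has_loc_ac_deriv f' g' \<Longrightarrow> has_loc_ac_deriv (\<lambda>x. f x + f' x) (\<lambda>x. g x + g' x)"
  unfolding has_loc_ac_deriv_iff by (auto intro: ac_on_add)

lemma has_loc_ac_deriv_diff: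
  "has_loc_ac_deriv f g \<Longrightarrow> has_loc_ac_deriv f' g' \<Longrightarrow> has_loc_ac_deriv (\<lambda>x. f x - f' x) (\<lambda>x. g x - g' x)"
  unfolding has_loc_ac_deriv_iff by (auto intro: ac_on_diff)

lemma has_loc_ac_deriv_cmult:
  "has_loc_ac_deriv f g \<Longrightarrow> has_loc_ac_deriv (\<lambda>x. c * f x) (\<lambda>x. c * g x)"
  unfolding has_loc_ac_deriv_iff by (auto intro: ac_on_cmult)

lemma has_loc_ac_deriv_mult:
  "has_loc_ac_deriv f f1 \<Longrightarrow> has_loc_ac_deriv g g1 \<Longrightarrow>
    has_loc_ac_deriv (\<lambda>x. f x * g x) (\<lambda>x. f1 x * g x + f x * g1 x)"
  unfolding has_loc_ac_deriv_iff by (auto intro: ac_on_mult)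

lemma has_loc_ac_deriv_cong:
  assumes "has_loc_ac_deriv f g" "\<And>x. x \<in> {0<..1} \<Longrightarrow> f x = f' x" "\<And>x. x \<in> {0<..1} \<Longrightarrow> g x = g' x"
  shows "has_loc_ac_deriv f' g'"
  unfolding has_loc_ac_deriv_iff
proof
  fix a :: real assume a: "a \<in> {0<..<1}"
  have "ac_on f g a 1" using assms(1) a unfolding has_loc_ac_deriv_iff by blast
  thus "ac_on f' g' a 1"
    by (rule ac_on_cong) (rule assms(2,3), use a in simp)+
qed

lemma has_integral_powr_Icc:
  assumes "0 < a" "a \<le> b" "r + 1 \<noteq> 0"
  shows "((\<lambda>y::real. y powr r) has_integral (b powr (r + 1) - a powr (r + 1)) / (r + 1)) {a..b}"
proof -
  have "((\<lambda>y. y powr r) has_integral (b powr (r + 1) / (r + 1) - a powr (r + 1) / (r + 1))) {a..b}"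
  proof (rule fundamental_theorem_of_calculus[OF assms(2)])
    fix y assume y: "y \<in> {a..b}"
    have "((\<lambda>y. y powr (r + 1)) has_real_derivative (r + 1) * y powr (r + 1 - 1)) (at y within {a..b})"
      using y assms by (intro has_field_derivative_at_within[OF has_real_derivative_powr]) auto
    from DERIV_cdivide[OF this, of "r + 1"]
    show "((\<lambda>y. y powr (r + 1) / (r + 1)) has_vector_derivative y powr r) (at y within {a..b})"
      using assms(3) by (simp add: has_real_derivative_iff_has_vector_derivative)
  qed
  thus ?thesis by (simp only: diff_divide_distrib)
qed

subsection \<open>The spectrum as the zero set of the boundary form\<close>

context radial
begin

text \<open>The graph condition with u' exposed, as Wronskians require, and with u'' eliminated
  through the equation.\<close>

definition graph0_deriv where
  "graph0_deriv \<beta> u u1 f \<longleftrightarrow> u \<in> L2 \<and> f \<in> L2 \<and> has_loc_ac_deriv u u1 \<and>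
     has_loc_ac_deriv u1 (\<lambda>x. complex_of_real (V x) * u x - f x) \<and>
     (\<exists>c. ((\<lambda>x. u x / complex_of_real (x powr (l + 1))) \<longlongrightarrow> c) (at_right 0)) \<and> bc_right \<beta> (u 1) (u1 1)"

lemma radial_graph0_iff: "(u, f) \<in> radial_graph0 l q \<beta> \<longleftrightarrow> (\<exists>u1. graph0_deriv \<beta> u u1 f)"
proof
  assume "(u, f) \<in> radial_graph0 l q \<beta>"
  then obtain u1 u2 where *: "u \<in> L2" "f \<in> L2" "has_loc_ac_deriv u u1" "has_loc_ac_deriv u1 u2"
    "AE x in M01. f x = - u2 x + complex_of_real (l * (l + 1) / x\<^sup>2) * u x + complex_of_real (q x) * u x"
    "\<exists>c. ((\<lambda>x. u x / complex_of_real (x powr (l + 1))) \<longlongrightarrow> c) (at_right 0)" "bc_right \<beta> (u 1) (u1 1)"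
    unfolding radial_graph0_def L2_def[symmetric] by blast
  have "AE x in M01. u2 x = complex_of_real (V x) * u x - f x"
    using *(5) by eventually_elim (simp add: V_def algebra_simps)
  from has_loc_ac_deriv_AE[OF *(4) this] show "\<exists>u1. graph0_deriv \<beta> u u1 f"
    unfolding graph0_deriv_def using * by blast
next
  assume "\<exists>u1. graph0_deriv \<beta> u u1 f"
  then obtain u1 where u: "graph0_deriv \<beta> u u1 f" by blast
  have "AE x in M01. f x = - (complex_of_real (V x) * u x - f x) +
        complex_of_real (l * (l + 1) / x\<^sup>2) * u x + complex_of_real (q x) * u x"
    by (rule AE_I2) (simp add: V_def algebra_simps add_divide_distrib)
  thus "(u, f) \<in> radial_graph0 l q \<beta>"
    unfolding radial_graph0_def L2_def[symmetric] mem_Collect_eq split_conv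
    using u unfolding graph0_deriv_def by blast
qed

lemma radial_graph0_diff:
  assumes "(u, f) \<in> radial_graph0 l q \<beta>" "(v, g) \<in> radial_graph0 l q \<beta>"
  shows "(\<lambda>x. u x - v x, \<lambda>x. f x - g x) \<in> radial_graph0 l q \<beta>"
proof -
  obtain u1 v1 where u: "graph0_deriv \<beta> u u1 f" and v: "graph0_deriv \<beta> v v1 g"
    using assms unfolding radial_graph0_iff by blast
  obtain c d where cd: "((\<lambda>x. u x / complex_of_real (x powr (l + 1))) \<longlongrightarrow> c) (at_right 0)"
     "((\<lambda>x. v x / complex_of_real (x powr (l + 1))) \<longlongrightarrow> d) (at_right 0)"
    using u v unfolding graph0_deriv_def by blast
  have "graph0_deriv \<beta> (\<lambda>x. u x - v x) (\<lambda>x. u1 x - v1 x) (\<lambda>x. f x - g x)"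
    unfolding graph0_deriv_def
  proof (intro conjI)
    have "has_loc_ac_deriv (\<lambda>x. u1 x - v1 x) (\<lambda>x. (complex_of_real (V x) * u x - f x) - (complex_of_real (V x) * v x - g x))"
      using u v unfolding graph0_deriv_def by (intro has_loc_ac_deriv_diff) auto
    thus "has_loc_ac_deriv (\<lambda>x. u1 x - v1 x) (\<lambda>x. complex_of_real (V x) * (u x - v x) - (f x - g x))"
      by (simp add: algebra_simps)
    show "\<exists>c. ((\<lambda>x. (u x - v x) / complex_of_real (x powr (l + 1))) \<longlongrightarrow> c) (at_right 0)"
      using tendsto_diff[OF cd] by (auto simp: diff_divide_distrib)
    show "bc_right \<beta> (u 1 - v 1) (u1 1 - v1 1)"
    proof (cases "\<bar>\<beta>\<bar> = \<infinity>")
      case False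
      have "u1 1 - v1 1 + complex_of_real (real_of_ereal \<beta>) * (u 1 - v 1) =
          (u1 1 + complex_of_real (real_of_ereal \<beta>) * u 1) - (v1 1 + complex_of_real (real_of_ereal \<beta>) * v 1)"
        by (simp add: algebra_simps)
      thus ?thesis using u v False unfolding graph0_deriv_def bc_right_def by simp
    qed (use u v in \<open>auto simp: graph0_deriv_def bc_right_def\<close>)
  qed (use u v in \<open>auto simp: graph0_deriv_def intro: L2_diff has_loc_ac_deriv_diff\<close>)
  thus ?thesis unfolding radial_graph0_iff by blast
qed

lemma sq_norm_lt: "e > 0 \<Longrightarrow> norm_L2 f < e \<longleftrightarrow> sq_norm f < e\<^sup>2"
  unfolding norm_L2_eq using real_sqrt_less_iff[of "sq_norm f" "e\<^sup>2"] by simp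

text \<open>A nonzero limit of the Wronskian with \<open>phi\<close> at \<open>0\<close> would force \<open>(u/phi)'\<close> to behave like
  \<open>x\<^bsup>-2l-2\<^esup>\<close>, which is not integrable at \<open>0\<close>.\<close>

lemma wronskian_limit_zero:
  assumes u: "has_loc_ac_deriv u u1" "has_loc_ac_deriv u1 u2"
    and c: "((\<lambda>x. u x / complex_of_real (x powr (l + 1))) \<longlongrightarrow> c) (at_right 0)"
    and W: "((\<lambda>x. u1 x * phi z x - u x * phi1 z x) \<longlongrightarrow> W0) (at_right 0)"
  shows "W0 = 0"
proof (rule ccontr)
  assume W0: "W0 \<noteq> 0"
  \<comment> \<open>With half of |W0| as tolerance, the main term of size 2 e J outweighs an error
    of size e J.\<close>
  define e where "e = norm W0 / 2"
  have e0: "e > 0" unfolding e_def using W0 by simp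
  define f where "f x = (u1 x * phi z x - u x * phi1 z x) / (phi z x)\<^sup>2" for x
  have "((\<lambda>x. (u1 x * phi z x - u x * phi1 z x) / (phi z x / complex_of_real (x powr (l + 1)))\<^sup>2) \<longlongrightarrow> W0 / 1\<^sup>2) (at_right 0)"
    by (intro tendsto_intros W phi_asymp) auto
  from tendstoD[OF this[unfolded power_one div_by_1] e0]
  have "\<forall>\<^sub>F x in at_right 0. dist ((u1 x * phi z x - u x * phi1 z x) / (phi z x / complex_of_real (x powr (l + 1)))\<^sup>2) W0 < e" .
  moreover have "\<forall>\<^sub>F x in at_right 0. dist (phi z x / complex_of_real (x powr (l + 1))) 1 < 1"
    by (rule tendstoD[OF phi_asymp zero_less_one])
  moreover
  have "((\<lambda>x. (u x / complex_of_real (x powr (l + 1))) / (phi z x / complex_of_real (x powr (l + 1)))) \<longlongrightarrow> c / 1) (at_right 0)"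
    by (intro tendsto_intros c phi_asymp) auto
  from tendstoD[OF this[unfolded div_by_1] zero_less_one]
  have "\<forall>\<^sub>F x in at_right 0. dist ((u x / complex_of_real (x powr (l + 1))) / (phi z x / complex_of_real (x powr (l + 1)))) c < 1" .
  ultimately have "\<forall>\<^sub>F x in at_right 0. phi z x \<noteq> 0 \<and> norm (u x / phi z x) \<le> norm c + 1 \<and>
      norm (f x - W0 * complex_of_real (x powr (- (2 * l + 2)))) \<le> e * x powr (- (2 * l + 2))"
    using eventually_at_right_real[OF zero_less_one]
  proof eventually_elim
    case (elim x)
    define y where "y = complex_of_real (x powr (l + 1))"
    have y: "y \<noteq> 0" unfolding y_def using elim by simp
    have p: "phi z x \<noteq> 0" using elim(2) by auto
    have e2: "u x / y / (phi z x / y) = u x / phi z x" using y by simp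
    have "norm (u x / phi z x) \<le> norm c + 1"
      using elim(3) norm_triangle_sub[of "u x / phi z x" c] unfolding y_def[symmetric] e2 dist_norm by linarith
    moreover have "norm (f x - W0 * complex_of_real (x powr (- (2 * l + 2)))) \<le> e * x powr (- (2 * l + 2))"
    proof -
      have "x powr (2 * l + 2) = x powr (l + 1) * x powr (l + 1)" by (simp add: powr_add [symmetric])
      hence yy: "complex_of_real (x powr (- (2 * l + 2))) = inverse (y * y)"
        unfolding y_def powr_minus by simp
      have "f x - W0 * complex_of_real (x powr (- (2 * l + 2))) =
        ((u1 x * phi z x - u x * phi1 z x) / (phi z x / y)\<^sup>2 - W0) * complex_of_real (x powr (- (2 * l + 2)))"
      proof -
        have "(u1 x * phi z x - u x * phi1 z x) / (phi z x / y)\<^sup>2 * inverse (y * y) = f x"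
        proof -
          have "N / (p / y)\<^sup>2 * inverse (y * y) = N / p\<^sup>2" for N p :: complex
            using y by (simp add: field_simps power2_eq_square)
          thus ?thesis unfolding f_def .
        qed
        thus ?thesis unfolding yy left_diff_distrib by simp
      qed
      also have "norm \<dots> \<le> e * x powr (- (2 * l + 2))"
      proof -
        have "norm ((u1 x * phi z x - u x * phi1 z x) / (phi z x / y)\<^sup>2 - W0) \<le> e"
          using elim(1) unfolding y_def[symmetric] dist_norm by (rule order.strict_implies_order)
        thus ?thesis
          unfolding norm_mult norm_of_real abs_of_nonneg[OF powr_ge_zero] by (rule mult_right_mono) simp
      qed
      finally show ?thesis .
    qed
    ultimately show ?case using p by blast
  qed
  then obtain d0 where d0: "d0 > 0" and d0': "\<And>x. 0 < x \<Longrightarrow> x < d0 \<Longrightarrow> phi z x \<noteq> 0 \<and> norm (u x / phi z x) \<le> norm c + 1 \<and>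
      norm (f x - W0 * complex_of_real (x powr (- (2 * l + 2)))) \<le> e * x powr (- (2 * l + 2))"
    unfolding eventually_at_right_field by blast
  define d where "d = min 1 (d0 / 2)"
  have d: "0 < d" "d \<le> 1" "d < d0" unfolding d_def using d0 by auto
  \<comment> \<open>The left side is e times the integral \<open>J\<close> of y^(-2l-2) over [x, d].
    It is bounded uniformly in x because the integral of (u/phi)' is a difference of bounded
    quotients, whereas J tends to infinity as x tends to 0; that is the contradiction.\<close>
  have bound: "e * ((x powr (- (2 * l + 1)) - d powr (- (2 * l + 1))) / (2 * l + 1)) \<le> 2 * (norm c + 1)" if x: "0 < x" "x < d" for x
  proof -
    define J where "J = (x powr (- (2 * l + 1)) - d powr (- (2 * l + 1))) / (2 * l + 1)"
    have "((\<lambda>y. y powr (- (2 * l + 2))) has_integral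
        (d powr (- (2 * l + 2) + 1) - x powr (- (2 * l + 2) + 1)) / (- (2 * l + 2) + 1)) {x..d}"
      using x l by (intro has_integral_powr_Icc) auto
    also have "- (2 * l + 2) + 1 = - (2 * l + 1)" by simp
    also have "(d powr (- (2 * l + 1)) - x powr (- (2 * l + 1))) / - (2 * l + 1) = J"
      unfolding J_def minus_divide_right[symmetric] minus_divide_left by simp
    finally have J: "((\<lambda>y. y powr (- (2 * l + 2))) has_integral J) {x..d}" .
    have F: "(f has_integral (u d / phi z d - u x / phi z x)) {x..d}"
      unfolding f_def
      by (rule has_loc_ac_deriv_quotient_has_integral[OF u solvesD[OF phi_solves]]) (use x d d0' in auto)
    have J2: "((\<lambda>y. W0 * complex_of_real (y powr (- (2 * l + 2)))) has_integral (W0 * complex_of_real J)) {x..d}"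
      using has_integral_mult_right[OF has_integral_of_real[OF J]] .
    have fi: "((\<lambda>y. f y - W0 * complex_of_real (y powr (- (2 * l + 2)))) has_integral
       (u d / phi z d - u x / phi z x - W0 * complex_of_real J)) {x..d}"
      by (rule has_integral_diff[OF F J2])
    have J3: "((\<lambda>y. e * y powr (- (2 * l + 2))) has_integral (e * J)) {x..d}"
      by (rule has_integral_mult_right[OF J])
    have "norm (integral {x..d} (\<lambda>y. f y - W0 * complex_of_real (y powr (- (2 * l + 2))))) \<le>
        integral {x..d} (\<lambda>y. e * y powr (- (2 * l + 2)))"
      by (rule integral_norm_bound_integral[OF has_integral_integrable[OF fi] has_integral_integrable[OF J3]])
        (use d0' x d in auto)
    hence n: "norm (u d / phi z d - u x / phi z x - W0 * complex_of_real J) \<le> e * J"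
      unfolding integral_unique[OF fi] integral_unique[OF J3] .
    have J0: "J \<ge> 0" using has_integral_nonneg[OF J] by simp
    have "2 * e * J = norm (W0 * complex_of_real J)" unfolding e_def using J0 by (simp add: norm_mult)
    also have "\<dots> \<le> norm (u d / phi z d - u x / phi z x) + e * J"
      using n norm_triangle_sub[of "W0 * complex_of_real J" "u d / phi z d - u x / phi z x"]
      unfolding norm_minus_commute[of "W0 * complex_of_real J"] by linarith
    also have "norm (u d / phi z d - u x / phi z x) \<le> norm (u d / phi z d) + norm (u x / phi z x)"
      by (rule norm_triangle_ineq4)
    also have "norm (u d / phi z d) \<le> norm c + 1" using d0' d by auto
    also have "norm (u x / phi z x) \<le> norm c + 1" using d0' d x by auto
    finally have "e * J \<le> 2 * (norm c + 1)" by (simp add: algebra_simps)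
    thus ?thesis unfolding J_def .
  qed
  have "filterlim (\<lambda>x. x powr (- (2 * l + 1))) at_top (at_right 0)"
    unfolding powr_minus
  proof (rule filterlim_inverse_at_top)
    show "((\<lambda>x. x powr (2 * l + 1)) \<longlongrightarrow> 0) (at_right 0)"
      using l by (intro tendsto_zero_powrI[where b = "2 * l + 1"] tendsto_intros) (auto simp: eventually_at_filter)
    show "\<forall>\<^sub>F x in at_right 0. 0 < x powr (2 * l + 1)"
      using eventually_at_right_real[OF zero_less_one] by eventually_elim auto
  qed
  hence "\<forall>\<^sub>F x in at_right 0. x powr (- (2 * l + 1)) > (2 * (norm c + 1) / e) * (2 * l + 1) + d powr (- (2 * l + 1))"
    by (rule filterlim_at_top_dense[THEN iffD1, rule_format])
  from eventually_happens'[OF trivial_limit_at_right_real eventually_conj[OF this eventually_at_right_real[OF d(1)]]]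
  obtain x where x: "x powr (- (2 * l + 1)) > (2 * (norm c + 1) / e) * (2 * l + 1) + d powr (- (2 * l + 1))" "x \<in> {0<..<d}"
    by auto
  have "(2 * (norm c + 1) / e) * (2 * l + 1) < x powr (- (2 * l + 1)) - d powr (- (2 * l + 1))"
    using x(1) by linarith
  hence "2 * (norm c + 1) / e < (x powr (- (2 * l + 1)) - d powr (- (2 * l + 1))) / (2 * l + 1)"
    using l by (simp only: pos_less_divide_eq)
  hence "2 * (norm c + 1) < e * ((x powr (- (2 * l + 1)) - d powr (- (2 * l + 1))) / (2 * l + 1))"
    using e0 by (simp only: pos_divide_less_eq mult.commute)
  thus False using bound[of x] x(2) by simp
qed

end

section \<open>The Green function and the boundary form\<close>

context radial
begin

text \<open>The Wronskian of phi with \<open>chi c0 c1\<close>. A condition at 1 is encoded by data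
  (c0, c1) that satisfy it, which treats u(1) = 0 and u'(1) = 0 alike; \<open>bform\<close> vanishes
  exactly when phi satisfies u'(1) c0 = u(1) c1.\<close>

definition bform :: "complex \<Rightarrow> complex \<Rightarrow> complex \<Rightarrow> complex" where
  "bform c0 c1 z = phi z 1 * c1 - phi1 z 1 * c0"

text \<open>\<open>intA\<close> and \<open>intB\<close> are the two halves of the Green integral,
  split at x because the kernel is phi at the smaller and chi at the larger argument.\<close>

definition intA :: "complex \<Rightarrow> (real \<Rightarrow> complex) \<Rightarrow> real \<Rightarrow> complex" where
  "intA z f x = integral {0..x} (\<lambda>y. f y * phi z y)"

definition intB :: "complex \<Rightarrow> complex \<Rightarrow> complex \<Rightarrow> (real \<Rightarrow> complex) \<Rightarrow> real \<Rightarrow> complex" where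
  "intB c0 c1 z f x = integral {x..1} (\<lambda>y. f y * chi c0 c1 z y)"

lemma phi_continuous: "continuous_on {0..1} (phi z)"
  unfolding phi_def using l
  by (intro continuous_intros w_continuous continuous_on_powr') auto

lemma L2_abs_int: "f \<in> L2 \<Longrightarrow> f absolutely_integrable_on {0..1}"
  by (rule iffD1[OF integrable_M01_iff L2_imp_integrable])

lemma L2_phi_integrable:
  assumes "f \<in> L2"
  shows "(\<lambda>y. f y * phi z y) absolutely_integrable_on {0..1}"
  using absolutely_integrable_continuous_mult[OF phi_continuous L2_abs_int[OF assms], of z]
  by (simp add: mult.commute)

lemma chi_continuous: "continuous_on {0<..1} (chi c0 c1 z)"
  by (rule has_loc_ac_deriv_continuous[OF solvesD(1)[OF chi_solves]])

lemma L2_chi_integrable: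
  assumes "f \<in> L2" "0 < a"
  shows "(\<lambda>y. f y * chi c0 c1 z y) absolutely_integrable_on {a..1}"
proof -
  have "continuous_on {a..1} (chi c0 c1 z)"
    by (rule continuous_on_subset[OF chi_continuous]) (use assms in auto)
  moreover have "f absolutely_integrable_on {a..1}"
    by (rule absolutely_integrable_on_subinterval[OF L2_abs_int[OF assms(1)]]) (use assms in auto)
  ultimately show ?thesis
    by (subst mult.commute) (rule absolutely_integrable_continuous_mult)
qed

lemma intA_deriv:
  assumes "f \<in> L2"
  shows "has_loc_ac_deriv (intA z f) (\<lambda>y. f y * phi z y)"
  unfolding has_loc_ac_deriv_iff
proof
  fix a :: real assume a: "a \<in> {0<..<1}"
  have "ac_on (\<lambda>x. 0 + integral {0..x} (\<lambda>y. f y * phi z y)) (\<lambda>y. f y * phi z y) 0 1"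
    by (rule ac_on_indefinite_integral[OF L2_phi_integrable[OF assms]])
  thus "ac_on (intA z f) (\<lambda>y. f y * phi z y) a 1"
    unfolding intA_def[abs_def] add_0_left by (rule ac_on_subinterval) (use a in auto)
qed

lemma intB_deriv:
  assumes "f \<in> L2"
  shows "has_loc_ac_deriv (intB c0 c1 z f) (\<lambda>y. - (f y * chi c0 c1 z y))"
  unfolding has_loc_ac_deriv_iff
proof
  fix a :: real assume a: "a \<in> {0<..<1}"
  let ?g = "\<lambda>y. f y * chi c0 c1 z y"
  have gi: "?g absolutely_integrable_on {a..1}" using L2_chi_integrable[OF assms] a by auto
  hence gi': "?g integrable_on {a..1}" unfolding absolutely_integrable_on_def by blast
  have "ac_on (\<lambda>x. - 1 * (- integral {a..1} ?g + integral {a..x} ?g)) (\<lambda>x. - 1 * ?g x) a 1"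
    by (rule ac_on_cmult[OF ac_on_indefinite_integral[OF gi]])
  thus "ac_on (intB c0 c1 z f) (\<lambda>y. - (?g y)) a 1"
  proof (rule ac_on_cong)
    fix x assume x: "x \<in> {a..1}"
    have "integral {a..x} ?g + integral {x..1} ?g = integral {a..1} ?g"
      using x by (intro Henstock_Kurzweil_Integration.integral_combine gi') auto
    thus "- 1 * (- integral {a..1} ?g + integral {a..x} ?g) = intB c0 c1 z f x"
      unfolding intB_def by (simp add: algebra_simps)
  qed simp
qed

text \<open>For y <= x <= 1 the kernel is at most a constant times x^(-l) y^(l+1) <= x <= 1: the
  singularity of chi is absorbed by the decay of phi. A bounded kernel gives a pointwise bound by
  the L1 norm of f, hence by its L2 norm.\<close>

lemma green_bound:
  obtains C where "C \<ge> 0"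
    "\<And>f x. f \<in> L2 \<Longrightarrow> x \<in> {0<..1} \<Longrightarrow>
      norm (chi c0 c1 z x * intA z f x + phi z x * intB c0 c1 z f x) \<le> C * norm_L2 f"
proof -
  obtain C where C0: "C \<ge> 0" and C: "\<And>x. x \<in> {0<..1} \<Longrightarrow> norm (phi z x) \<le> C * x powr (l + 1)"
    using phi_bounds[of "norm z"] by blast
  obtain D where D0: "D \<ge> 0" and D: "\<And>x. x \<in> {0<..1} \<Longrightarrow> norm (chi c0 c1 z x) \<le> D * x powr (- l)"
    using chi_bound by blast
  have pw: "x powr (- l) * y powr (l + 1) \<le> 1" "y powr (l + 1) * x powr (- l) \<le> 1"
    if "0 \<le> y" "y \<le> x" "0 < x" "x \<le> 1" for x y
  proof -
    have "x powr (- l) * y powr (l + 1) \<le> x powr (- l) * x powr (l + 1)"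
      using that l by (intro mult_left_mono powr_mono2) auto
    also have "\<dots> = x" using that by (simp add: powr_add [symmetric])
    finally show "x powr (- l) * y powr (l + 1) \<le> 1" using that by simp
    thus "y powr (l + 1) * x powr (- l) \<le> 1" by (simp add: mult.commute)
  qed
  have phi0: "norm (phi z y) \<le> C * y powr (l + 1)" if "y \<in> {0..1}" for y
    using C[of y] that l by (cases "y = 0") (auto simp: phi_def)
  show ?thesis
  proof
    show "0 \<le> 2 * (C * D)" using C0 D0 by simp
    fix f :: "real \<Rightarrow> complex" and x :: real
    assume f: "f \<in> L2" and x: "x \<in> {0<..1}"
    have nf: "(\<lambda>y. norm (f y)) integrable_on {a..b}" if "0 \<le> a" "b \<le> 1" for a b
      by (rule integrable_on_subinterval[of _ "{0..1}"])
        (use L2_abs_int[OF f] that in \<open>auto simp: absolutely_integrable_on_def\<close>)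
    have nfle: "integral {a..b} (\<lambda>y. norm (f y)) \<le> norm_L2 f" if "0 \<le> a" "b \<le> 1" for a b
    proof -
      have "integral {a..b} (\<lambda>y. norm (f y)) \<le> integral {0..1} (\<lambda>y. norm (f y))"
        using that by (intro integral_subset_le nf) auto
      also have "\<dots> = (\<integral>x. norm (f x) \<partial>M01)"
        using L2_imp_integrable[OF f] by (intro integral_M01_eq[symmetric]) auto
      also have "\<dots> \<le> norm_L2 f" by (rule L1_le_norm_L2[OF f])
      finally show ?thesis .
    qed
    have fp: "(\<lambda>y. f y * phi z y) integrable_on {0..x}"
      by (rule integrable_on_subinterval[of _ "{0..1}"])
        (use L2_phi_integrable[OF f] x in \<open>auto simp: absolutely_integrable_on_def\<close>)
    have fc: "(\<lambda>y. f y * chi c0 c1 z y) integrable_on {x..1}"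
      using L2_chi_integrable[OF f, of x] x by (auto simp: absolutely_integrable_on_def)
    have "chi c0 c1 z x * intA z f x = integral {0..x} (\<lambda>y. chi c0 c1 z x * (f y * phi z y))"
      unfolding intA_def by simp
    also have "norm \<dots> \<le> (C * D) * integral {0..x} (\<lambda>y. norm (f y))"
    proof (rule integral_abs_le_const[OF integrable_on_mult_right[OF fp] nf])
      fix y assume y: "y \<in> {0..x}"
      have "norm (chi c0 c1 z x * (f y * phi z y)) = norm (chi c0 c1 z x) * norm (phi z y) * norm (f y)"
        by (simp add: norm_mult)
      also have "\<dots> \<le> (D * x powr (- l)) * (C * y powr (l + 1)) * norm (f y)"
        using D[OF x] phi0[of y] y x D0 by (intro mult_right_mono mult_mono) auto
      also have "\<dots> = C * D * (x powr (- l) * y powr (l + 1)) * norm (f y)" by simp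
      also have "\<dots> \<le> C * D * 1 * norm (f y)"
        using pw(1)[of y x] y x C0 D0 by (intro mult_right_mono mult_left_mono) auto
      finally show "norm (chi c0 c1 z x * (f y * phi z y)) \<le> C * D * norm (f y)" by simp
    qed (use x in auto)
    also have "\<dots> \<le> (C * D) * norm_L2 f" using x C0 D0 by (intro mult_left_mono nfle) auto
    finally have 1: "norm (chi c0 c1 z x * intA z f x) \<le> (C * D) * norm_L2 f" .
    have "phi z x * intB c0 c1 z f x = integral {x..1} (\<lambda>y. phi z x * (f y * chi c0 c1 z y))"
      unfolding intB_def by simp
    also have "norm \<dots> \<le> (C * D) * integral {x..1} (\<lambda>y. norm (f y))"
    proof (rule integral_abs_le_const[OF integrable_on_mult_right[OF fc] nf])
      fix y assume y: "y \<in> {x..1}"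
      have "norm (phi z x * (f y * chi c0 c1 z y)) = norm (phi z x) * norm (chi c0 c1 z y) * norm (f y)"
        by (simp add: norm_mult)
      also have "\<dots> \<le> (C * x powr (l + 1)) * (D * y powr (- l)) * norm (f y)"
        using C[OF x] D[of y] y x C0 by (intro mult_right_mono mult_mono) auto
      also have "\<dots> = C * D * (x powr (l + 1) * y powr (- l)) * norm (f y)" by simp
      also have "\<dots> \<le> C * D * 1 * norm (f y)"
        using pw(2)[of x y] y x C0 D0 by (intro mult_right_mono mult_left_mono) auto
      finally show "norm (phi z x * (f y * chi c0 c1 z y)) \<le> C * D * norm (f y)" by simp
    qed (use x in auto)
    also have "\<dots> \<le> (C * D) * norm_L2 f" using x C0 D0 by (intro mult_left_mono nfle) auto
    finally have 2: "norm (phi z x * intB c0 c1 z f x) \<le> (C * D) * norm_L2 f" .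
    show "norm (chi c0 c1 z x * intA z f x + phi z x * intB c0 c1 z f x) \<le> 2 * (C * D) * norm_L2 f"
      using 1 2 norm_triangle_ineq[of "chi c0 c1 z x * intA z f x" "phi z x * intB c0 c1 z f x"] by linarith
  qed
qed

lemma phi_chi_wronskian:
  assumes "x \<in> {0<..1}"
  shows "phi z x * chi1 c0 c1 z x - phi1 z x * chi c0 c1 z x = bform c0 c1 z"
  using solves_wronskian_const[OF phi_solves chi_solves assms, of z c0 c1]
  unfolding bform_def by (simp add: algebra_simps)

text \<open>The Wronskian of u with phi has derivative -f phi and vanishes at 0; the one with chi
  has derivative -f chi and vanishes at 1. Both are therefore known integrals, and u is recovered
  from them by Cramer's rule with determinant \<open>bform\<close>.\<close>

lemma graph0_green:
  fixes z c0 c1 :: complex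
  assumes bc: "\<And>u du. bc_right \<beta> u du \<longleftrightarrow> du * c0 = u * c1"
    and u: "graph0_deriv \<beta> u u1 g" and x: "x \<in> {0<..1}"
  defines "f \<equiv> \<lambda>x. g x - z * u x"
  shows "u x * bform c0 c1 z = - (chi c0 c1 z x * intA z f x + phi z x * intB c0 c1 z f x)"
proof -
  have L: "u \<in> L2" "g \<in> L2" using u unfolding graph0_deriv_def by auto
  have f: "f \<in> L2" unfolding f_def by (intro L2_diff L2_cmult L)
  have u1: "has_loc_ac_deriv u u1" "has_loc_ac_deriv u1 (\<lambda>x. complex_of_real (V x) * u x - g x)"
    using u unfolding graph0_deriv_def by auto
  obtain c where c: "((\<lambda>x. u x / complex_of_real (x powr (l + 1))) \<longlongrightarrow> c) (at_right 0)"
    using u unfolding graph0_deriv_def by blast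
  define W where "W x = u1 x * phi z x - u x * phi1 z x" for x
  have "has_loc_ac_deriv W (\<lambda>x. (complex_of_real (V x) * u x - g x) * phi z x - u x * ((complex_of_real (V x) - z) * phi z x))"
    unfolding W_def by (rule has_loc_ac_deriv_wronskian[OF u1 solvesD[OF phi_solves]])
  hence dW: "has_loc_ac_deriv W (\<lambda>x. - 1 * (f x * phi z x))"
    by (rule has_loc_ac_deriv_cong) (auto simp: f_def algebra_simps)
  have "has_loc_ac_deriv (\<lambda>x. W x - - 1 * intA z f x) (\<lambda>x. - 1 * (f x * phi z x) - - 1 * (f x * phi z x))"
    by (intro has_loc_ac_deriv_diff dW has_loc_ac_deriv_cmult intA_deriv f)
  hence Wc: "W x - - 1 * intA z f x = W 1 - - 1 * intA z f 1" if "x \<in> {0<..1}" for x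
    by (rule has_loc_ac_deriv_zero_const) (use that in auto)
  define W0 where "W0 = W 1 + intA z f 1"
  have Wx: "W x = W0 - intA z f x" if "x \<in> {0<..1}" for x
    using Wc[OF that] unfolding W0_def by (simp add: algebra_simps)
  have "(W \<longlongrightarrow> W0 - 0) (at_right 0)"
  proof (rule Lim_transform_eventually)
    have "continuous_on {0..1} (intA z f)"
      unfolding intA_def using L2_phi_integrable[OF f, of z] absolutely_integrable_on_def
      by (intro indefinite_integral_continuous_1) auto
    hence "(intA z f \<longlongrightarrow> intA z f 0) (at 0 within {0..1})" unfolding continuous_on_def by auto
    hence "(intA z f \<longlongrightarrow> 0) (at_right 0)" by (simp add: at_within_Icc_at_right intA_def)
    thus "((\<lambda>x. W0 - intA z f x) \<longlongrightarrow> W0 - 0) (at_right 0)" by (intro tendsto_intros)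
    show "\<forall>\<^sub>F x in at_right 0. W0 - intA z f x = W x"
      using eventually_at_right_real[OF zero_less_one] by eventually_elim (use Wx in auto)
  qed
  \<comment> \<open>\<open>W0\<close> is the limit of the Wronskian at 0. The condition at 0
    controls u but not u', so its vanishing is not immediate and rests on
    \<open>wronskian_limit_zero\<close>.\<close>
  hence "W0 = 0" using wronskian_limit_zero[OF u1 c, of z W0] unfolding W_def by simp
  hence W: "W x = - intA z f x" using Wx[OF x] by simp
  define Y where "Y x = u1 x * chi c0 c1 z x - u x * chi1 c0 c1 z x" for x
  have "has_loc_ac_deriv Y (\<lambda>x. (complex_of_real (V x) * u x - g x) * chi c0 c1 z x - u x * ((complex_of_real (V x) - z) * chi c0 c1 z x))"
    unfolding Y_def by (rule has_loc_ac_deriv_wronskian[OF u1 solvesD[OF chi_solves]])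
  hence dY: "has_loc_ac_deriv Y (\<lambda>x. - (f x * chi c0 c1 z x))"
    by (rule has_loc_ac_deriv_cong) (auto simp: f_def algebra_simps)
  have "has_loc_ac_deriv (\<lambda>x. Y x - intB c0 c1 z f x) (\<lambda>x. - (f x * chi c0 c1 z x) - - (f x * chi c0 c1 z x))"
    by (intro has_loc_ac_deriv_diff dY intB_deriv f)
  hence "Y x - intB c0 c1 z f x = Y 1 - intB c0 c1 z f 1"
    by (rule has_loc_ac_deriv_zero_const) (use x in auto)
  moreover have "Y 1 = 0" using u bc unfolding graph0_deriv_def Y_def by simp
  moreover have "intB c0 c1 z f 1 = 0" unfolding intB_def by simp
  ultimately have Y: "Y x = intB c0 c1 z f x" by simp
  have "u x * bform c0 c1 z = chi c0 c1 z x * W x - phi z x * Y x"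
    unfolding phi_chi_wronskian[OF x, of z c0 c1, symmetric] W_def Y_def by (simp add: algebra_simps)
  thus ?thesis unfolding W Y by simp
qed

definition green :: "complex \<Rightarrow> complex \<Rightarrow> complex \<Rightarrow> (real \<Rightarrow> complex) \<Rightarrow> real \<Rightarrow> complex" where
  "green c0 c1 z f x = - 1 / bform c0 c1 z * (chi c0 c1 z x * intA z f x + phi z x * intB c0 c1 z f x)"

definition green1 :: "complex \<Rightarrow> complex \<Rightarrow> complex \<Rightarrow> (real \<Rightarrow> complex) \<Rightarrow> real \<Rightarrow> complex" where
  "green1 c0 c1 z f x = - 1 / bform c0 c1 z * (chi1 c0 c1 z x * intA z f x + phi1 z x * intB c0 c1 z f x)"

lemma green_deriv:
  assumes f: "f \<in> L2" and om: "bform c0 c1 z \<noteq> 0"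
  shows "has_loc_ac_deriv (green c0 c1 z f) (green1 c0 c1 z f)"
    and "has_loc_ac_deriv (green1 c0 c1 z f) (\<lambda>x. complex_of_real (V x) * green c0 c1 z f x - (z * green c0 c1 z f x + f x))"
proof -
  note d = solvesD[OF phi_solves[of z]] solvesD[OF chi_solves[of z c0 c1]] intA_deriv[OF f, of z] intB_deriv[OF f, of c0 c1 z]
  have "has_loc_ac_deriv (green c0 c1 z f)
    (\<lambda>x. - 1 / bform c0 c1 z * ((chi1 c0 c1 z x * intA z f x + chi c0 c1 z x * (f x * phi z x)) +
       (phi1 z x * intB c0 c1 z f x + phi z x * (- (f x * chi c0 c1 z x)))))"
    unfolding green_def[abs_def] by (intro has_loc_ac_deriv_cmult has_loc_ac_deriv_add has_loc_ac_deriv_mult d)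
  thus "has_loc_ac_deriv (green c0 c1 z f) (green1 c0 c1 z f)"
    by (rule has_loc_ac_deriv_cong) (auto simp: green1_def algebra_simps)
  have "has_loc_ac_deriv (green1 c0 c1 z f)
    (\<lambda>x. - 1 / bform c0 c1 z * (((complex_of_real (V x) - z) * chi c0 c1 z x * intA z f x + chi1 c0 c1 z x * (f x * phi z x)) +
       ((complex_of_real (V x) - z) * phi z x * intB c0 c1 z f x + phi1 z x * (- (f x * chi c0 c1 z x)))))"
    unfolding green1_def[abs_def] by (intro has_loc_ac_deriv_cmult has_loc_ac_deriv_add has_loc_ac_deriv_mult d)
  thus "has_loc_ac_deriv (green1 c0 c1 z f) (\<lambda>x. complex_of_real (V x) * green c0 c1 z f x - (z * green c0 c1 z f x + f x))"
  proof (rule has_loc_ac_deriv_cong)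
    fix x :: real assume x: "x \<in> {0<..1}"
    define V' G where "V' = complex_of_real (V x) - z" and "G = chi c0 c1 z x * intA z f x + phi z x * intB c0 c1 z f x"
    have "- 1 / bform c0 c1 z * ((V' * chi c0 c1 z x * intA z f x + chi1 c0 c1 z x * (f x * phi z x)) +
       (V' * phi z x * intB c0 c1 z f x + phi1 z x * (- (f x * chi c0 c1 z x))))
       = V' * (- 1 / bform c0 c1 z * G) - 1 / bform c0 c1 z * (f x * (phi z x * chi1 c0 c1 z x - phi1 z x * chi c0 c1 z x))"
      unfolding G_def by (simp add: algebra_simps)
    also have "\<dots> = V' * green c0 c1 z f x - f x"
      unfolding phi_chi_wronskian[OF x] green_def G_def using om by simp
    finally show "- 1 / bform c0 c1 z * (((complex_of_real (V x) - z) * chi c0 c1 z x * intA z f x + chi1 c0 c1 z x * (f x * phi z x)) +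
       ((complex_of_real (V x) - z) * phi z x * intB c0 c1 z f x + phi1 z x * (- (f x * chi c0 c1 z x)))) =
       complex_of_real (V x) * green c0 c1 z f x - (z * green c0 c1 z f x + f x)"
      unfolding V'_def by (simp add: algebra_simps)
  qed simp
qed

lemma green_L2:
  assumes f: "f \<in> L2" and om: "bform c0 c1 z \<noteq> 0"
    and C: "\<And>f x. f \<in> L2 \<Longrightarrow> x \<in> {0<..1} \<Longrightarrow>
      norm (chi c0 c1 z x * intA z f x + phi z x * intB c0 c1 z f x) \<le> C * norm_L2 f"
  shows "green c0 c1 z f \<in> L2" and "norm_L2 (green c0 c1 z f) \<le> C / norm (bform c0 c1 z) * norm_L2 f"
proof -
  have m: "green c0 c1 z f \<in> borel_measurable M01"
    by (intro continuous_imp_measurable_M01 has_loc_ac_deriv_continuous[OF green_deriv(1)[OF f om]])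
  have b: "norm (green c0 c1 z f x) \<le> C / norm (bform c0 c1 z) * norm_L2 f" if "x \<in> {0<..<1}" for x
  proof -
    have "norm (green c0 c1 z f x) = norm (chi c0 c1 z x * intA z f x + phi z x * intB c0 c1 z f x) / norm (bform c0 c1 z)"
      unfolding green_def by (simp add: norm_mult norm_divide)
    also have "\<dots> \<le> C * norm_L2 f / norm (bform c0 c1 z)"
      using that by (intro divide_right_mono C f) auto
    finally show ?thesis by simp
  qed
  show "green c0 c1 z f \<in> L2" "norm_L2 (green c0 c1 z f) \<le> C / norm (bform c0 c1 z) * norm_L2 f"
    using L2_bounded[OF m b] by auto
qed

lemma green_diff:
  assumes "f \<in> L2" "g \<in> L2" "x \<in> {0<..1}"
  shows "green c0 c1 z (\<lambda>x. f x - g x) x = green c0 c1 z f x - green c0 c1 z g x"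
proof -
  have i: "(\<lambda>y. h y * phi z y) integrable_on {0..x}" if "h \<in> L2" for h
    by (rule integrable_on_subinterval[of _ "{0..1}"])
      (use L2_phi_integrable[OF that] assms in \<open>auto simp: absolutely_integrable_on_def\<close>)
  have j: "(\<lambda>y. h y * chi c0 c1 z y) integrable_on {x..1}" if "h \<in> L2" for h
    using L2_chi_integrable[OF that, of x] assms by (auto simp: absolutely_integrable_on_def)
  have A: "intA z (\<lambda>x. f x - g x) x = intA z f x - intA z g x"
    unfolding intA_def left_diff_distrib by (intro Henstock_Kurzweil_Integration.integral_diff i assms)
  have B: "intB c0 c1 z (\<lambda>x. f x - g x) x = intB c0 c1 z f x - intB c0 c1 z g x"
    unfolding intB_def left_diff_distrib by (intro Henstock_Kurzweil_Integration.integral_diff j assms)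
  show ?thesis unfolding green_def A B by (simp add: algebra_simps)
qed

text \<open>If f vanishes near 0, then the Green integral is a multiple of phi there, and u /
  x^(l+1) has a limit. For general f and l >= 1/2 this can fail, so such f are reached only through
  the closure, in \<open>green_graph\<close>.\<close>

lemma green_graph0:
  assumes bc: "\<And>u du. bc_right \<beta> u du \<longleftrightarrow> du * c0 = u * c1"
    and f: "f \<in> L2" and om: "bform c0 c1 z \<noteq> 0" and a: "a \<in> {0<..<1}" and supp: "\<And>x. x < a \<Longrightarrow> f x = 0"
  shows "(green c0 c1 z f, \<lambda>x. z * green c0 c1 z f x + f x) \<in> radial_graph0 l q \<beta>"
  unfolding radial_graph0_iff
proof
  obtain C where C: "\<And>f x. f \<in> L2 \<Longrightarrow> x \<in> {0<..1} \<Longrightarrow>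
      norm (chi c0 c1 z x * intA z f x + phi z x * intB c0 c1 z f x) \<le> C * norm_L2 f"
    using green_bound by blast
  note gL = green_L2(1)[OF f om C]
  show "graph0_deriv \<beta> (green c0 c1 z f) (green1 c0 c1 z f) (\<lambda>x. z * green c0 c1 z f x + f x)"
    unfolding graph0_deriv_def
  proof (intro conjI gL green_deriv[OF f om] L2_add L2_cmult f)
    define k where "k = - 1 / bform c0 c1 z * intB c0 c1 z f a"
    have "((\<lambda>x. k * (phi z x / complex_of_real (x powr (l + 1)))) \<longlongrightarrow> k * 1) (at_right 0)"
      by (intro tendsto_intros phi_asymp)
    moreover have "\<forall>\<^sub>F x in at_right 0. k * (phi z x / complex_of_real (x powr (l + 1))) = green c0 c1 z f x / complex_of_real (x powr (l + 1))"
      using eventually_at_right_real[of 0 a, simplified, OF conjunct1[OF a[unfolded greaterThanLessThan_iff]]]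
    proof eventually_elim
      case (elim x)
      have "intA z f x = integral {0..x} (\<lambda>_. 0)"
        unfolding intA_def by (rule Henstock_Kurzweil_Integration.integral_cong) (use elim supp in auto)
      moreover have "intB c0 c1 z f x = intB c0 c1 z f a"
      proof -
        have j: "(\<lambda>y. f y * chi c0 c1 z y) integrable_on {x..1}"
          using L2_chi_integrable[OF f, of x] elim by (auto simp: absolutely_integrable_on_def)
        have "integral {x..a} (\<lambda>y. f y * chi c0 c1 z y) + intB c0 c1 z f a = intB c0 c1 z f x"
          unfolding intB_def by (rule Henstock_Kurzweil_Integration.integral_combine[OF _ _ j]) (use elim a in auto)
        moreover have "integral {x..a} (\<lambda>y. f y * chi c0 c1 z y) = integral {x..a} (\<lambda>_. 0)"
          \<comment> \<open>The support condition is strict, so f(a) itself may be nonzero.\<close>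
          by (rule integral_spike[of "{a}"]) (use supp in auto)
        ultimately show ?thesis by simp
      qed
      ultimately show ?case unfolding green_def k_def by simp
    qed
    ultimately show "\<exists>c. ((\<lambda>x. green c0 c1 z f x / complex_of_real (x powr (l + 1))) \<longlongrightarrow> c) (at_right 0)"
      by (intro exI[of _ "k * 1"]) (rule Lim_transform_eventually)
    have "intB c0 c1 z f 1 = 0" unfolding intB_def by simp
    thus "bc_right \<beta> (green c0 c1 z f 1) (green1 c0 c1 z f 1)"
      unfolding bc green_def green1_def by simp
  qed
qed

end

lemma sq_norm_cong: "(\<And>x. x \<in> {0<..<1} \<Longrightarrow> f x = g x) \<Longrightarrow> sq_norm f = sq_norm g"
  unfolding sq_norm_def by (intro Bochner_Integration.integral_cong) (auto simp: space_restrict_space)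

lemma norm_L2_zero_AE:
  assumes "f \<in> L2" "sq_norm f = 0"
  shows "AE x in M01. f x = 0"
proof -
  have "AE x in M01. (norm (f x))\<^sup>2 = 0"
    using assms integral_nonneg_eq_0_iff_AE[of M01 "\<lambda>x. (norm (f x))\<^sup>2"] unfolding L2_iff sq_norm_def by auto
  thus ?thesis by eventually_elim simp
qed

lemma L2_truncate:
  assumes f: "f \<in> L2" and e: "e > 0"
  obtains a g where "a \<in> {0<..<1}" "g \<in> L2" "\<And>x. x < a \<Longrightarrow> g x = 0" "sq_norm (\<lambda>x. g x - f x) < e"
proof -
  \<comment> \<open>The offset 2 keeps every cut point strictly between 0 and 1.\<close>
  define g where "g n x = (if x < 1 / (real n + 2) then 0 else f x)" for n x
  have m: "(\<lambda>x. g n x) \<in> borel_measurable M01" for n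
  proof -
    have "f \<in> borel_measurable M01" using f unfolding L2_iff by blast
    moreover have "(\<lambda>x. x) \<in> borel_measurable M01"
      by (intro measurable_restrict_space1 measurable_completion) simp
    ultimately show ?thesis unfolding g_def by measurable
  qed
  have i2: "integrable M01 (\<lambda>x. (norm (f x))\<^sup>2)" using f unfolding L2_iff by blast
  have le: "norm ((norm (g n x))\<^sup>2) \<le> (norm (f x))\<^sup>2" "norm ((norm (g n x - f x))\<^sup>2) \<le> (norm (f x))\<^sup>2" for n x
    unfolding g_def by auto
  have gL: "g n \<in> L2" for n
    unfolding L2_iff
    by (intro conjI m Bochner_Integration.integrable_bound[OF i2]) (use m le in auto)
  have lim: "(\<lambda>n. \<integral>x. (norm (g n x - f x))\<^sup>2 \<partial>M01) \<longlonglongrightarrow> (\<integral>x. 0 \<partial>M01)"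
  proof (rule integral_dominated_convergence[OF _ _ i2])
    show "(\<lambda>x. (norm (g n x - f x))\<^sup>2) \<in> borel_measurable M01" for n
      using L2_diff(1)[OF gL f, of n] unfolding L2_iff by auto
    show "AE x in M01. (\<lambda>n. (norm (g n x - f x))\<^sup>2) \<longlonglongrightarrow> 0"
    proof (rule AE_I2)
      fix x assume "x \<in> space M01"
      hence x: "0 < x" by (simp add: space_restrict_space)
      obtain N :: nat where N: "1 / x < real N" using reals_Archimedean2 by blast
      have "(norm (g n x - f x))\<^sup>2 = 0" if "n \<ge> N" for n
      proof -
        have "1 / x < real n + 2" using N that by linarith
        hence "1 / (real n + 2) < x" using x by (simp add: field_simps)
        thus ?thesis unfolding g_def by simp
      qed
      thus "(\<lambda>n. (norm (g n x - f x))\<^sup>2) \<longlonglongrightarrow> 0"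
        by (intro tendsto_eventually) (auto simp: eventually_sequentially)
    qed
    show "AE x in M01. norm ((norm (g n x - f x))\<^sup>2) \<le> (norm (f x))\<^sup>2" for n using le by auto
  qed simp
  hence "(\<lambda>n. sq_norm (\<lambda>x. g n x - f x)) \<longlonglongrightarrow> 0" unfolding sq_norm_def by simp
  from order_tendstoD(2)[OF this e] obtain n where n: "sq_norm (\<lambda>x. g n x - f x) < e"
    unfolding eventually_sequentially by auto
  show ?thesis
    by (rule that[of "1 / (real n + 2)", OF _ gL _ n]) (auto simp: g_def divide_simps)
qed

section \<open>Closure of the graph and the resolvent set\<close>

context radial
begin

lemma graph0_L2: "(u, g) \<in> radial_graph0 l q \<beta> \<Longrightarrow> u \<in> L2 \<and> g \<in> L2"
  unfolding radial_graph0_iff graph0_deriv_def by blast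

lemma radial_graph_iff: "(u, f) \<in> radial_graph l q \<beta> \<longleftrightarrow> u \<in> L2 \<and> f \<in> L2 \<and>
     (\<forall>e>0. \<exists>v g. (v, g) \<in> radial_graph0 l q \<beta> \<and>
        sq_norm (\<lambda>x. v x - u x) < e \<and> sq_norm (\<lambda>x. g x - f x) < e)"
proof -
  have "(\<forall>\<epsilon>>0. \<exists>(v, g)\<in>radial_graph0 l q \<beta>. norm_L2 (\<lambda>x. v x - u x) < \<epsilon> \<and> norm_L2 (\<lambda>x. g x - f x) < \<epsilon>) \<longleftrightarrow>
     (\<forall>e>0. \<exists>v g. (v, g) \<in> radial_graph0 l q \<beta> \<and> sq_norm (\<lambda>x. v x - u x) < e \<and> sq_norm (\<lambda>x. g x - f x) < e)"
    (is "?L \<longleftrightarrow> ?R")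
  proof
    assume L: ?L
    show ?R
    proof (intro allI impI)
      fix e :: real assume e: "e > 0"
      hence "sqrt e > 0" by simp
      with L obtain v g where *: "(v, g) \<in> radial_graph0 l q \<beta>" "norm_L2 (\<lambda>x. v x - u x) < sqrt e"
        "norm_L2 (\<lambda>x. g x - f x) < sqrt e" by blast
      thus "\<exists>v g. (v, g) \<in> radial_graph0 l q \<beta> \<and> sq_norm (\<lambda>x. v x - u x) < e \<and> sq_norm (\<lambda>x. g x - f x) < e"
        unfolding norm_L2_eq real_sqrt_less_iff by blast
    qed
  next
    assume R: ?R
    show ?L
    proof (intro allI impI)
      fix e :: real assume e: "e > 0"
      hence "e\<^sup>2 > 0" by simp
      with R obtain v g where *: "(v, g) \<in> radial_graph0 l q \<beta>" "sq_norm (\<lambda>x. v x - u x) < e\<^sup>2"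
        "sq_norm (\<lambda>x. g x - f x) < e\<^sup>2" by blast
      thus "\<exists>(v, g)\<in>radial_graph0 l q \<beta>. norm_L2 (\<lambda>x. v x - u x) < e \<and> norm_L2 (\<lambda>x. g x - f x) < e"
        using sq_norm_lt[OF e] by blast
    qed
  qed
  thus ?thesis unfolding radial_graph_def L2_def[symmetric] by simp
qed

lemma radial_graph_diff:
  assumes "(u, f) \<in> radial_graph l q \<beta>" "(v, g) \<in> radial_graph l q \<beta>"
  shows "(\<lambda>x. u x - v x, \<lambda>x. f x - g x) \<in> radial_graph l q \<beta>"
  unfolding radial_graph_iff
proof (intro conjI allI impI)
  have L: "u \<in> L2" "f \<in> L2" "v \<in> L2" "g \<in> L2" using assms unfolding radial_graph_iff by blast+
  show "(\<lambda>x. u x - v x) \<in> L2" "(\<lambda>x. f x - g x) \<in> L2" using L by (auto intro: L2_diff)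
  fix e :: real assume "e > 0"
  hence e: "e / 4 > 0" by simp
  obtain u0 f0 where u0: "(u0, f0) \<in> radial_graph0 l q \<beta>" "sq_norm (\<lambda>x. u0 x - u x) < e / 4" "sq_norm (\<lambda>x. f0 x - f x) < e / 4"
    using assms(1) e unfolding radial_graph_iff by blast
  obtain v0 g0 where v0: "(v0, g0) \<in> radial_graph0 l q \<beta>" "sq_norm (\<lambda>x. v0 x - v x) < e / 4" "sq_norm (\<lambda>x. g0 x - g x) < e / 4"
    using assms(2) e unfolding radial_graph_iff by blast
  have L0: "u0 \<in> L2" "f0 \<in> L2" "v0 \<in> L2" "g0 \<in> L2" using graph0_L2 u0(1) v0(1) by blast+
  have 1: "sq_norm (\<lambda>x. (u0 x - u x) - (v0 x - v x)) < e"
    using L2_diff(2)[OF L2_diff(1)[OF L0(1) L(1)] L2_diff(1)[OF L0(3) L(3)]] u0 v0 by linarith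
  have 2: "sq_norm (\<lambda>x. (f0 x - f x) - (g0 x - g x)) < e"
    using L2_diff(2)[OF L2_diff(1)[OF L0(2) L(2)] L2_diff(1)[OF L0(4) L(4)]] u0 v0 by linarith
  have "sq_norm (\<lambda>x. (u0 x - v0 x) - (u x - v x)) < e" "sq_norm (\<lambda>x. (f0 x - g0 x) - (f x - g x)) < e"
    using 1 2 by (simp_all add: diff_diff_eq2 diff_add_eq algebra_simps)
  thus "\<exists>v' g'. (v', g') \<in> radial_graph0 l q \<beta> \<and>
        sq_norm (\<lambda>x. v' x - (u x - v x)) < e \<and> sq_norm (\<lambda>x. g' x - (f x - g x)) < e"
    using radial_graph0_diff[OF u0(1) v0(1)] by blast
qed

lemma graph0_apriori:
  assumes bc: "\<And>u du. bc_right \<beta> u du \<longleftrightarrow> du * c0 = u * c1" and om: "bform c0 c1 z \<noteq> 0"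
  obtains C where "C \<ge> 0" "\<And>u g. (u, g) \<in> radial_graph0 l q \<beta> \<Longrightarrow> norm_L2 u \<le> C * norm_L2 (\<lambda>x. g x - z * u x)"
proof -
  obtain C where C0: "C \<ge> 0" and C: "\<And>f x. f \<in> L2 \<Longrightarrow> x \<in> {0<..1} \<Longrightarrow>
      norm (chi c0 c1 z x * intA z f x + phi z x * intB c0 c1 z f x) \<le> C * norm_L2 f"
    using green_bound by blast
  show ?thesis
  proof
    show "0 \<le> C / norm (bform c0 c1 z)" using C0 by simp
    fix u g assume ug: "(u, g) \<in> radial_graph0 l q \<beta>"
    then obtain u1 where u1: "graph0_deriv \<beta> u u1 g" unfolding radial_graph0_iff by blast
    have L: "u \<in> L2" "g \<in> L2" using graph0_L2[OF ug] by auto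
    have fL: "(\<lambda>x. g x - z * u x) \<in> L2" by (intro L2_diff L2_cmult L)
    show "norm_L2 u \<le> C / norm (bform c0 c1 z) * norm_L2 (\<lambda>x. g x - z * u x)"
    proof (rule L2_bounded(2))
      show "u \<in> borel_measurable M01" using L unfolding L2_iff by blast
      fix x :: real assume "x \<in> {0<..<1}"
      hence x: "x \<in> {0<..1}" by auto
      have "norm (u x) * norm (bform c0 c1 z) = norm (u x * bform c0 c1 z)" by (simp add: norm_mult)
      also have "\<dots> \<le> C * norm_L2 (\<lambda>x. g x - z * u x)"
        unfolding graph0_green[OF bc u1 x, of z] norm_minus_cancel by (rule C[OF fL x])
      finally show "norm (u x) \<le> C / norm (bform c0 c1 z) * norm_L2 (\<lambda>x. g x - z * u x)"
        using om by (simp add: field_simps)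
    qed
  qed
qed

text \<open>The bound for \<open>radial_graph0\<close> survives the closure because both sides
  depend continuously on (u, g) in the L2 norm. The factor 4 comes from using the inequality |f +
  g|^2 <= 2 |f|^2 + 2 |g|^2 twice.\<close>

lemma graph_apriori:
  assumes bc: "\<And>u du. bc_right \<beta> u du \<longleftrightarrow> du * c0 = u * c1" and om: "bform c0 c1 z \<noteq> 0"
  obtains C where "C \<ge> 0" "\<And>u g. (u, g) \<in> radial_graph l q \<beta> \<Longrightarrow> sq_norm u \<le> C * sq_norm (\<lambda>x. g x - z * u x)"
proof -
  obtain C where C0: "C \<ge> 0" and C: "\<And>u g. (u, g) \<in> radial_graph0 l q \<beta> \<Longrightarrow> norm_L2 u \<le> C * norm_L2 (\<lambda>x. g x - z * u x)"
    using graph0_apriori[OF bc om] by blast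
  show ?thesis
  proof
    show "0 \<le> 4 * C\<^sup>2" by simp
    fix u f assume uf: "(u, f) \<in> radial_graph l q \<beta>"
    hence L: "u \<in> L2" "f \<in> L2" unfolding radial_graph_iff by blast+
    \<comment> \<open>Collects everything that multiplies the approximation error: 2 from v - u, and
      8 C^2 (1 + |z|^2) from g - z v.\<close>
    define M where "M = 2 + 8 * C\<^sup>2 * (1 + (norm z)\<^sup>2)"
    have M0: "M > 0" unfolding M_def by (intro add_pos_nonneg mult_nonneg_nonneg) auto
    show "sq_norm u \<le> 4 * C\<^sup>2 * sq_norm (\<lambda>x. f x - z * u x)"
    proof (rule field_le_epsilon)
      fix e :: real assume e: "e > 0"
      hence "e / M > 0" using M0 by simp
      then obtain v g where v: "(v, g) \<in> radial_graph0 l q \<beta>" "sq_norm (\<lambda>x. v x - u x) < e / M" "sq_norm (\<lambda>x. g x - f x) < e / M"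
        using uf unfolding radial_graph_iff by blast
      have L0: "v \<in> L2" "g \<in> L2" using graph0_L2[OF v(1)] by auto
      note Ld = L2_diff(1)[OF L0(1) L(1)] L2_diff(1)[OF L0(2) L(2)]
      have fz: "(\<lambda>x. f x - z * u x) \<in> L2" by (intro L2_diff L2_cmult L)
      have "(norm_L2 v)\<^sup>2 \<le> (C * norm_L2 (\<lambda>x. g x - z * v x))\<^sup>2"
        by (rule power_mono[OF C[OF v(1)] norm_L2_nonneg])
      hence 1: "sq_norm v \<le> C\<^sup>2 * sq_norm (\<lambda>x. g x - z * v x)"
        unfolding power_mult_distrib norm_L2_power2 .
      have "(\<lambda>x. g x - z * v x) = (\<lambda>x. (f x - z * u x) + ((g x - f x) - z * (v x - u x)))"
        by (auto simp: algebra_simps)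
      hence "sq_norm (\<lambda>x. g x - z * v x) \<le> 2 * sq_norm (\<lambda>x. f x - z * u x) + 2 * sq_norm (\<lambda>x. (g x - f x) - z * (v x - u x))"
        using L2_add(2)[OF fz L2_diff(1)[OF Ld(2) L2_cmult(1)[OF Ld(1), of z]]] by simp
      moreover have "sq_norm (\<lambda>x. (g x - f x) - z * (v x - u x)) \<le> 2 * sq_norm (\<lambda>x. g x - f x) + 2 * ((norm z)\<^sup>2 * sq_norm (\<lambda>x. v x - u x))"
        using L2_diff(2)[OF Ld(2) L2_cmult(1)[OF Ld(1), of z]] L2_cmult(2)[OF Ld(1), of z] by simp
      moreover have "(norm z)\<^sup>2 * sq_norm (\<lambda>x. v x - u x) \<le> (norm z)\<^sup>2 * (e / M)"
        using v(2) by (intro mult_left_mono) auto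
      ultimately have 2: "sq_norm (\<lambda>x. g x - z * v x) \<le> 2 * sq_norm (\<lambda>x. f x - z * u x) + 4 * (e / M) + 4 * ((norm z)\<^sup>2 * (e / M))"
        using v(3) by linarith
      have "u = (\<lambda>x. v x - (v x - u x))" by auto
      hence "sq_norm u \<le> 2 * sq_norm v + 2 * sq_norm (\<lambda>x. v x - u x)"
        using L2_diff(2)[OF L0(1) Ld(1)] by simp
      also have "\<dots> \<le> 2 * sq_norm v + 2 * (e / M)" using v(2) by linarith
      also have "sq_norm v \<le> C\<^sup>2 * (2 * sq_norm (\<lambda>x. f x - z * u x) + 4 * (e / M) + 4 * ((norm z)\<^sup>2 * (e / M)))"
        using 1 mult_left_mono[OF 2, of "C\<^sup>2"] by simp
      also have "2 * (C\<^sup>2 * (2 * sq_norm (\<lambda>x. f x - z * u x) + 4 * (e / M) + 4 * ((norm z)\<^sup>2 * (e / M)))) + 2 * (e / M)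
          = 4 * C\<^sup>2 * sq_norm (\<lambda>x. f x - z * u x) + M * (e / M)"
      proof -
        have "2 * (C\<^sup>2 * (2 * s + 4 * k + 4 * ((norm z)\<^sup>2 * k))) + 2 * k = 4 * C\<^sup>2 * s + M * k" for s k
          unfolding M_def by (simp add: algebra_simps)
        thus ?thesis .
      qed
      finally have "sq_norm u \<le> 4 * C\<^sup>2 * sq_norm (\<lambda>x. f x - z * u x) + M * (e / M)" by simp
      thus "sq_norm u \<le> 4 * C\<^sup>2 * sq_norm (\<lambda>x. f x - z * u x) + e" using M0 by simp
    qed
  qed
qed

text \<open>Cutting f off near 0 leads to \<open>green_graph0\<close>; since \<open>green\<close> is
  bounded in the L2 norm, the pair obtained from the truncated function is close to the one for
  f.\<close>

lemma green_graph:
  assumes bc: "\<And>u du. bc_right \<beta> u du \<longleftrightarrow> du * c0 = u * c1" and om: "bform c0 c1 z \<noteq> 0"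
    and f: "f \<in> L2"
  shows "(green c0 c1 z f, \<lambda>x. z * green c0 c1 z f x + f x) \<in> radial_graph l q \<beta>"
  unfolding radial_graph_iff
proof (intro conjI allI impI)
  obtain C where C0: "C \<ge> 0" and C: "\<And>f x. f \<in> L2 \<Longrightarrow> x \<in> {0<..1} \<Longrightarrow>
      norm (chi c0 c1 z x * intA z f x + phi z x * intB c0 c1 z f x) \<le> C * norm_L2 f"
    using green_bound by blast
  note gL = green_L2(1)[OF _ om C]
  show "green c0 c1 z f \<in> L2" by (rule gL[OF f])
  show "(\<lambda>x. z * green c0 c1 z f x + f x) \<in> L2" by (intro L2_add L2_cmult gL f)
  define D where "D = (C / norm (bform c0 c1 z))\<^sup>2"
  \<comment> \<open>Chosen to exceed D, for the error in the function, and to dominate 2 + 2 |z|^2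
    D, for the error in its image.\<close>
  define M where "M = 2 + D + 2 * (norm z)\<^sup>2 * D"
  have D0: "D \<ge> 0" unfolding D_def by simp
  have M0: "M > 0" unfolding M_def using D0 by (intro add_pos_nonneg mult_nonneg_nonneg) auto
  fix e :: real assume e: "e > 0"
  hence "e / M > 0" using M0 by simp
  then obtain a g where a: "a \<in> {0<..<1}" and g: "g \<in> L2" and supp: "\<And>x. x < a \<Longrightarrow> g x = 0"
    and gf: "sq_norm (\<lambda>x. g x - f x) < e / M" using L2_truncate[OF f] by blast
  have gd: "(\<lambda>x. g x - f x) \<in> L2" by (intro L2_diff g f)
  have "(norm_L2 (green c0 c1 z (\<lambda>x. g x - f x)))\<^sup>2 \<le> (C / norm (bform c0 c1 z) * norm_L2 (\<lambda>x. g x - f x))\<^sup>2"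
    by (intro power_mono green_L2(2)[OF gd om C] norm_L2_nonneg)
  hence "sq_norm (green c0 c1 z (\<lambda>x. g x - f x)) \<le> D * sq_norm (\<lambda>x. g x - f x)"
    unfolding power_mult_distrib norm_L2_power2 D_def .
  also have "\<dots> \<le> D * (e / M)" using gf D0 by (intro mult_left_mono) auto
  also have "sq_norm (green c0 c1 z (\<lambda>x. g x - f x)) = sq_norm (\<lambda>x. green c0 c1 z g x - green c0 c1 z f x)"
    by (rule sq_norm_cong) (use green_diff[OF g f] in auto)
  finally have 1: "sq_norm (\<lambda>x. green c0 c1 z g x - green c0 c1 z f x) \<le> D * (e / M)" .
  have Gd: "(\<lambda>x. green c0 c1 z g x - green c0 c1 z f x) \<in> L2" by (intro L2_diff gL g f)
  have "(\<lambda>x. (z * green c0 c1 z g x + g x) - (z * green c0 c1 z f x + f x)) =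
     (\<lambda>x. z * (green c0 c1 z g x - green c0 c1 z f x) + (g x - f x))" by (auto simp: algebra_simps)
  hence "sq_norm (\<lambda>x. (z * green c0 c1 z g x + g x) - (z * green c0 c1 z f x + f x)) \<le>
      2 * ((norm z)\<^sup>2 * sq_norm (\<lambda>x. green c0 c1 z g x - green c0 c1 z f x)) + 2 * sq_norm (\<lambda>x. g x - f x)"
    using L2_add(2)[OF L2_cmult(1)[OF Gd, of z] gd] L2_cmult(2)[OF Gd, of z] by simp
  also have "\<dots> < 2 * ((norm z)\<^sup>2 * (D * (e / M))) + 2 * (e / M)"
    using 1 gf by (intro add_le_less_mono mult_left_mono) auto
  also have "\<dots> \<le> M * (e / M)"
  proof -
    have *: "2 * ((norm z)\<^sup>2 * (D * k)) + 2 * k \<le> M * k" if "k \<ge> 0" for k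
      using mult_nonneg_nonneg[OF D0 that] unfolding M_def by (simp add: algebra_simps)
    show ?thesis by (rule *) (use e M0 in simp)
  qed
  finally have 2: "sq_norm (\<lambda>x. (z * green c0 c1 z g x + g x) - (z * green c0 c1 z f x + f x)) < e" using M0 by simp
  have "D * (e / M) < M * (e / M)"
    using D0 e M0 by (intro mult_strict_right_mono) (auto simp: M_def intro!: add_pos_nonneg)
  hence 3: "sq_norm (\<lambda>x. green c0 c1 z g x - green c0 c1 z f x) < e" using 1 M0 by simp
  show "\<exists>v g. (v, g) \<in> radial_graph0 l q \<beta> \<and> sq_norm (\<lambda>x. v x - green c0 c1 z f x) < e \<and>
          sq_norm (\<lambda>x. g x - (z * green c0 c1 z f x + f x)) < e"
    using green_graph0[OF bc g om a supp] 2 3 by blast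
qed

text \<open>Existence comes from \<open>green_graph\<close>; the a priori bound gives uniqueness as
  well as the bounded inverse.\<close>

lemma resolvent_if_bform_nonzero:
  assumes bc: "\<And>u du. bc_right \<beta> u du \<longleftrightarrow> du * c0 = u * c1" and om: "bform c0 c1 z \<noteq> 0"
  shows "z \<in> resolvent_set (radial_graph l q \<beta>)"
  unfolding resolvent_set_def mem_Collect_eq L2_def[symmetric]
proof (intro conjI ballI)
  obtain C where C0: "C \<ge> 0" and C: "\<And>u g. (u, g) \<in> radial_graph l q \<beta> \<Longrightarrow> sq_norm u \<le> C * sq_norm (\<lambda>x. g x - z * u x)"
    using graph_apriori[OF bc om] by blast
  show "\<exists>C. \<forall>(u, f)\<in>radial_graph l q \<beta>. norm_L2 u \<le> C * norm_L2 (\<lambda>x. f x - z * u x)"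
  proof (intro exI ballI, clarify)
    fix u f assume "(u, f) \<in> radial_graph l q \<beta>"
    hence "sqrt (sq_norm u) \<le> sqrt (C * sq_norm (\<lambda>x. f x - z * u x))" using C by simp
    thus "norm_L2 u \<le> sqrt C * norm_L2 (\<lambda>x. f x - z * u x)" unfolding norm_L2_eq real_sqrt_mult .
  qed
  fix f :: "real \<Rightarrow> complex" assume f: "f \<in> L2"
  show "\<exists>u. (u, \<lambda>x. z * u x + f x) \<in> radial_graph l q \<beta> \<and>
       (\<forall>v. (v, \<lambda>x. z * v x + f x) \<in> radial_graph l q \<beta> \<longrightarrow> (AE x in M01. v x = u x))"
  proof (intro exI conjI allI impI)
    show g: "(green c0 c1 z f, \<lambda>x. z * green c0 c1 z f x + f x) \<in> radial_graph l q \<beta>"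
      by (rule green_graph[OF bc om f])
    fix v assume v: "(v, \<lambda>x. z * v x + f x) \<in> radial_graph l q \<beta>"
    define d where "d x = v x - green c0 c1 z f x" for x
    have dg: "(d, \<lambda>x. (z * v x + f x) - (z * green c0 c1 z f x + f x)) \<in> radial_graph l q \<beta>"
      unfolding d_def by (rule radial_graph_diff[OF v g])
    have "sq_norm d \<le> C * sq_norm (\<lambda>x. (z * v x + f x) - (z * green c0 c1 z f x + f x) - z * d x)"
      by (rule C[OF dg])
    also have "(\<lambda>x. (z * v x + f x) - (z * green c0 c1 z f x + f x) - z * d x) = (\<lambda>x. 0)"
      unfolding d_def by (auto simp: algebra_simps)
    also have "sq_norm (\<lambda>x. 0) = 0" unfolding sq_norm_def by simp
    finally have "sq_norm d = 0" using sq_norm_nonneg[of d] by simp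
    moreover have "d \<in> L2" using dg unfolding radial_graph_iff by blast
    ultimately have "AE x in M01. d x = 0" by (intro norm_L2_zero_AE)
    thus "AE x in M01. v x = green c0 c1 z f x" by eventually_elim (simp add: d_def)
  qed
qed

lemma phi_L2: "phi z \<in> L2"
proof -
  have "bounded (phi z ` {0..1})" by (intro compact_imp_bounded compact_continuous_image phi_continuous) auto
  then obtain B where "\<And>x. x \<in> {0..1} \<Longrightarrow> norm (phi z x) \<le> B" unfolding bounded_iff by blast
  thus ?thesis
    by (intro L2_bounded(1)[of _ B] continuous_imp_measurable_M01 continuous_on_subset[OF phi_continuous]) auto
qed

lemma graph0_subset_graph:
  assumes "(u, f) \<in> radial_graph0 l q \<beta>"
  shows "(u, f) \<in> radial_graph l q \<beta>"
  unfolding radial_graph_iff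
proof (intro conjI allI impI)
  show "u \<in> L2" "f \<in> L2" using graph0_L2[OF assms] by auto
  have "sq_norm (\<lambda>x. u x - u x) = 0" "sq_norm (\<lambda>x. f x - f x) = 0" unfolding sq_norm_def by simp_all
  thus "\<exists>v g. (v, g) \<in> radial_graph0 l q \<beta> \<and> sq_norm (\<lambda>x. v x - u x) < e \<and> sq_norm (\<lambda>x. g x - f x) < e" if "e > 0" for e
    using assms that by (intro exI[of _ u] exI[of _ f]) auto
qed

text \<open>Both phi and 0 solve (L - z) u = 0 within the graph, so the uniqueness clause at f = 0
  would force phi = 0 almost everywhere. This contradicts phi being comparable to x^(l+1) near
  0.\<close>

lemma not_resolvent_if_bform_zero:
  assumes bc: "\<And>u du. bc_right \<beta> u du \<longleftrightarrow> du * c0 = u * c1" and om: "bform c0 c1 z = 0"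
  shows "z \<notin> resolvent_set (radial_graph l q \<beta>)"
proof
  assume z: "z \<in> resolvent_set (radial_graph l q \<beta>)"
  have zero: "(\<lambda>x. 0) \<in> L2" unfolding L2_iff by simp
  have z': "\<exists>u. (u, \<lambda>x. z * u x + f x) \<in> radial_graph l q \<beta> \<and>
       (\<forall>v. (v, \<lambda>x. z * v x + f x) \<in> radial_graph l q \<beta> \<longrightarrow> (AE x in M01. v x = u x))" if "f \<in> L2" for f
    using z that unfolding resolvent_set_def L2_def[symmetric] by blast
  obtain u where u: "\<And>v. (v, \<lambda>x. z * v x + 0) \<in> radial_graph l q \<beta> \<Longrightarrow> (AE x in M01. v x = u x)"
    using z'[OF zero] by blast
  have "graph0_deriv \<beta> (phi z) (phi1 z) (\<lambda>x. z * phi z x + 0)"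
    unfolding graph0_deriv_def
  proof (intro conjI)
    show "has_loc_ac_deriv (phi1 z) (\<lambda>x. complex_of_real (V x) * phi z x - (z * phi z x + 0))"
      using solvesD(2)[OF phi_solves[of z]] by (simp add: left_diff_distrib)
    show "bc_right \<beta> (phi z 1) (phi1 z 1)" using om unfolding bc bform_def by simp
    show "\<exists>c. ((\<lambda>x. phi z x / complex_of_real (x powr (l + 1))) \<longlongrightarrow> c) (at_right 0)" using phi_asymp by blast
  qed (auto intro: phi_L2 L2_cmult solvesD(1)[OF phi_solves])
  hence "(phi z, \<lambda>x. z * phi z x + 0) \<in> radial_graph l q \<beta>"
    by (intro graph0_subset_graph) (auto simp: radial_graph0_iff)
  hence 1: "AE x in M01. phi z x = u x" by (rule u)
  have "has_loc_ac_deriv (\<lambda>x. 0) (\<lambda>x. 0)" unfolding has_loc_ac_deriv_iff using ac_on_const by blast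
  hence "graph0_deriv \<beta> (\<lambda>x. 0) (\<lambda>x. 0) (\<lambda>x. z * 0 + 0)"
    unfolding graph0_deriv_def using zero bc by auto
  hence "((\<lambda>x. 0), \<lambda>x. z * 0 + 0) \<in> radial_graph l q \<beta>"
    by (intro graph0_subset_graph) (auto simp: radial_graph0_iff)
  hence 2: "AE x in M01. 0 = u x" by (rule u)
  from 1 2 have "AE x in M01. phi z x = 0" by eventually_elim simp
  then obtain N where N: "negligible N" "\<And>x. 0 < x \<Longrightarrow> x < 1 \<Longrightarrow> x \<notin> N \<Longrightarrow> phi z x = 0"
    using AE_M01_negligible by blast
  obtain d where d: "d \<in> {0<..1}" "\<And>x. x \<in> {0..d} \<Longrightarrow> norm (w z x - 1) \<le> 1 / 2"
    using w_near_0[of "norm z"] by auto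
  have "{0<..<d} \<subseteq> N"
  proof
    fix x assume x: "x \<in> {0<..<d}"
    have "w z x \<noteq> 0" using d(2)[of x] x by auto
    hence "phi z x \<noteq> 0" using x unfolding phi_def by simp
    thus "x \<in> N" using N(2)[of x] x d(1) by auto
  qed
  hence "negligible {0<..<d}" using N(1) negligible_subset by blast
  thus False using open_not_negligible[of "{0<..<d}"] d(1) by auto
qed

theorem radial_spectrum_infinity: "radial_spectrum l q \<infinity> = {z. phi z 1 = 0}"
proof -
  have bc: "bc_right \<infinity> u du \<longleftrightarrow> du * 0 = u * 1" for u du unfolding bc_right_def by simp
  have "z \<in> resolvent_set (radial_graph l q \<infinity>) \<longleftrightarrow> phi z 1 \<noteq> 0" for z
    using resolvent_if_bform_nonzero[OF bc, of z] not_resolvent_if_bform_zero[OF bc, of z]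
    by (auto simp: bform_def)
  thus ?thesis unfolding radial_spectrum_def by auto
qed

theorem radial_spectrum_0: "radial_spectrum l q 0 = {z. phi1 z 1 = 0}"
proof -
  have bc: "bc_right 0 u du \<longleftrightarrow> du * 1 = u * 0" for u du unfolding bc_right_def by simp
  have "z \<in> resolvent_set (radial_graph l q 0) \<longleftrightarrow> phi1 z 1 \<noteq> 0" for z
    using resolvent_if_bform_nonzero[OF bc, of z] not_resolvent_if_bform_zero[OF bc, of z]
    by (auto simp: bform_def)
  thus ?thesis unfolding radial_spectrum_def by auto
qed

end

subsection \<open>Entire functions\<close>

lemma field_differentiable_transform_open:
  assumes "f field_differentiable (at z)" "open S" "z \<in> S" "\<And>w. w \<in> S \<Longrightarrow> f w = g w"
  shows "g field_differentiable (at z)"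
proof -
  obtain f' where "(f has_field_derivative f') (at z)" using assms(1) unfolding field_differentiable_def by blast
  hence "(g has_field_derivative f') (at z)"
    using assms(2-4) by (rule has_field_derivative_transform_within_open)
  thus ?thesis unfolding field_differentiable_def by blast
qed

text \<open>At a common zero, F / G is the quotient of the two slope functions, which are entire;
  the slope of G has the nonzero value G' there, so the singularity is removable, and the value F' /
  G' is not 0.\<close>

lemma entire_quotient_simple_zeros:
  fixes F G :: "complex \<Rightarrow> complex"
  assumes F: "F holomorphic_on UNIV" and G: "G holomorphic_on UNIV"
    and zeros: "\<And>z. F z = 0 \<longleftrightarrow> G z = 0"
    and simple: "\<And>z. F z = 0 \<Longrightarrow> deriv F z \<noteq> 0" "\<And>z. G z = 0 \<Longrightarrow> deriv G z \<noteq> 0"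
  obtains A where "A holomorphic_on UNIV" "\<And>z. A z \<noteq> 0" "\<And>z. F z = A z * G z"
proof -
  define A where "A z = (if G z = 0 then deriv F z / deriv G z else F z / G z)" for z
  have "A field_differentiable (at z0)" for z0
  proof (cases "G z0 = 0")
    case False
    have 1: "(\<lambda>z. F z / G z) field_differentiable (at z0)"
      using F G False holomorphic_on_imp_differentiable_at[OF F open_UNIV] holomorphic_on_imp_differentiable_at[OF G open_UNIV]
      by (intro field_differentiable_divide) auto
    have "open {z. G z \<noteq> 0}"
    proof -
      have "continuous_on UNIV G" by (rule holomorphic_on_imp_continuous_on[OF G])
      hence "open (G -` (- {0}))" by (intro open_vimage) auto
      thus ?thesis by (simp add: vimage_def Compl_eq)
    qed
    thus ?thesis
      by (rule field_differentiable_transform_open[OF 1]) (use False in \<open>auto simp: A_def\<close>)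
  next
    case True
    hence F0: "F z0 = 0" using zeros by blast
    define f1 where "f1 z = (if z = z0 then deriv F z0 else (F z - F z0) / (z - z0))" for z
    define g1 where "g1 z = (if z = z0 then deriv G z0 else (G z - G z0) / (z - z0))" for z
    have f1: "f1 holomorphic_on UNIV" and g1: "g1 holomorphic_on UNIV"
      unfolding f1_def g1_def using F G by (auto intro!: pole_lemma)
    have g10: "g1 z0 \<noteq> 0" unfolding g1_def using simple(2)[OF True] by simp
    have 1: "(\<lambda>z. f1 z / g1 z) field_differentiable (at z0)"
      using holomorphic_on_imp_differentiable_at[OF f1 open_UNIV] holomorphic_on_imp_differentiable_at[OF g1 open_UNIV] g10
      by (intro field_differentiable_divide) auto
    have op: "open {z. g1 z \<noteq> 0}"
    proof -
      have "continuous_on UNIV g1" by (rule holomorphic_on_imp_continuous_on[OF g1])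
      hence "open (g1 -` (- {0}))" by (intro open_vimage) auto
      thus ?thesis by (simp add: vimage_def Compl_eq)
    qed
    have eq: "f1 z / g1 z = A z" if "z \<in> {z. g1 z \<noteq> 0}" for z
    proof (cases "z = z0")
      case True
      thus ?thesis using \<open>G z0 = 0\<close> by (simp add: f1_def g1_def A_def)
    next
      case False
      hence "G z \<noteq> 0" using that \<open>G z0 = 0\<close> by (auto simp: g1_def)
      thus ?thesis using False \<open>G z0 = 0\<close> F0 by (simp add: f1_def g1_def A_def)
    qed
    show ?thesis
      by (rule field_differentiable_transform_open[OF 1 op _ eq]) (use g10 in auto)
  qed
  hence hol: "A holomorphic_on UNIV" by (simp add: holomorphic_on_def field_differentiable_at_within)
  show ?thesis
  proof
    show "A z \<noteq> 0" for z using simple zeros[of z] by (auto simp: A_def)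
    show "F z = A z * G z" for z using zeros[of z] by (auto simp: A_def)
  qed (rule hol)
qed

text \<open>An entire function omitting the ray \<open>(-\<infinity>, 0]\<close> has a square root with positive real part.\<close>

lemma entire_avoiding_nonpos_Reals_constant:
  assumes E: "E holomorphic_on UNIV" and av: "\<And>z. E z \<notin> \<real>\<^sub>\<le>\<^sub>0"
  shows "\<exists>c. \<forall>z. E z = c"
proof -
  \<comment> \<open>The square root has nonnegative real part, so the denominator has modulus at
    least 1 and Liouville's theorem applies to \<open>g\<close>.\<close>
  define g where "g z = 1 / (1 + csqrt (E z))" for z
  have ge1: "1 \<le> norm (1 + csqrt (E z))" for z
  proof -
    have "1 \<le> Re (1 + csqrt (E z))" using Re_csqrt[of "E z"] by simp
    also have "\<dots> \<le> norm (1 + csqrt (E z))" by (rule complex_Re_le_cmod)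
    finally show ?thesis .
  qed
  hence nz: "1 + csqrt (E z) \<noteq> 0" for z by (metis norm_zero not_one_le_zero)
  have "g holomorphic_on UNIV"
    unfolding g_def using E av nz by (intro holomorphic_intros) auto
  moreover have "norm (g z) \<le> 1" for z
    using ge1[of z] unfolding g_def by (simp add: norm_divide divide_simps)
  hence "bounded (range g)" unfolding bounded_iff by blast
  ultimately have "g constant_on UNIV" by (rule Liouville_theorem)
  then obtain k where k: "\<And>z. g z = k" unfolding constant_on_def by blast
  have "E z = E 0" for z
  proof -
    have "1 + csqrt (E z) = 1 + csqrt (E 0)" using k[of z] k[of 0] unfolding g_def
      by (metis inverse_eq_divide inverse_inverse_eq)
    hence "csqrt (E z) ^ 2 = csqrt (E 0) ^ 2" by simp
    thus ?thesis by simp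
  qed
  thus ?thesis by blast
qed

text \<open>A nonpositive real factor would reverse or annihilate the imaginary part. Taking s = Im
  z treats both half planes at once.\<close>

lemma herglotz_ratio_not_nonpos:
  fixes m n e :: complex
  assumes "m = e * n" "Im m * s < 0" "Im n * s < 0"
  shows "e \<notin> \<real>\<^sub>\<le>\<^sub>0"
proof
  assume "e \<in> \<real>\<^sub>\<le>\<^sub>0"
  then obtain t where t: "t \<le> 0" "e = complex_of_real t" by (auto elim!: nonpos_Reals_cases)
  hence "Im m = t * Im n" using assms(1) by simp
  hence "Im m * s = t * (Im n * s)" by simp
  also have "\<dots> \<ge> 0" using t(1) assms(3) by (intro mult_nonpos_nonpos) auto
  finally show False using assms(2) by simp
qed

text \<open>Off the real axis the quotient E of the two m functions avoids the nonpositive reals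
  because both lie in the same open half plane. On the axis E is real by symmetry and has no zero,
  hence has constant sign; the limit 1 along \<open>x\<close> makes it positive.\<close>

theorem herglotz_quotients_equal:
  fixes Fd Fn Gd Gn :: "complex \<Rightarrow> complex" and x :: "nat \<Rightarrow> real"
  assumes hol: "Fd holomorphic_on UNIV" "Fn holomorphic_on UNIV" "Gd holomorphic_on UNIV" "Gn holomorphic_on UNIV"
    and cnj: "\<And>z. Fd (cnj z) = cnj (Fd z)" "\<And>z. Fn (cnj z) = cnj (Fn z)" "\<And>z. Gd (cnj z) = cnj (Gd z)" "\<And>z. Gn (cnj z) = cnj (Gn z)"
    and herg: "\<And>z. Im z \<noteq> 0 \<Longrightarrow> Im (Fn z * cnj (Fd z)) * Im z < 0" "\<And>z. Im z \<noteq> 0 \<Longrightarrow> Im (Gn z * cnj (Gd z)) * Im z < 0"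
    and zeros: "\<And>z. Fd z = 0 \<longleftrightarrow> Gd z = 0" "\<And>z. Fn z = 0 \<longleftrightarrow> Gn z = 0"
    and simple: "\<And>z. Fd z = 0 \<Longrightarrow> deriv Fd z \<noteq> 0" "\<And>z. Gd z = 0 \<Longrightarrow> deriv Gd z \<noteq> 0"
      "\<And>z. Fn z = 0 \<Longrightarrow> deriv Fn z \<noteq> 0" "\<And>z. Gn z = 0 \<Longrightarrow> deriv Gn z \<noteq> 0"
    and nz: "\<And>n. Fd (complex_of_real (x n)) \<noteq> 0" "\<And>n. Fn (complex_of_real (x n)) \<noteq> 0"
    and lim: "(\<lambda>n. (Fn (x n) / Fd (x n)) / (Gn (x n) / Gd (x n))) \<longlonglongrightarrow> 1"
  shows "Fn z * Gd z = Gn z * Fd z"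
proof -
  obtain A where A: "A holomorphic_on UNIV" "\<And>z. A z \<noteq> 0" "\<And>z. Fd z = A z * Gd z"
    using entire_quotient_simple_zeros[OF hol(1,3) zeros(1) simple(1,2)] by blast
  obtain B where B: "B holomorphic_on UNIV" "\<And>z. B z \<noteq> 0" "\<And>z. Fn z = B z * Gn z"
    using entire_quotient_simple_zeros[OF hol(2,4) zeros(2) simple(3,4)] by blast
  define E where "E z = B z / A z" for z
  have E: "E holomorphic_on UNIV" unfolding E_def using A B by (intro holomorphic_intros) auto
  have Ec: "continuous_on UNIV E" by (rule holomorphic_on_imp_continuous_on[OF E])
  have E0: "E z \<noteq> 0" for z unfolding E_def using A(2) B(2) by simp
  have Eeq: "E z = (Fn z / Fd z) / (Gn z / Gd z)" if "Fd z \<noteq> 0" "Fn z \<noteq> 0" for z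
    using that A(3)[of z] B(3)[of z] unfolding E_def by (auto simp: field_simps)
  have off: "Fd z \<noteq> 0 \<and> Fn z \<noteq> 0" if "Im z \<noteq> 0" for z
    using herg(1)[OF that] by auto
  have offE: "E z \<notin> \<real>\<^sub>\<le>\<^sub>0" if im: "Im z \<noteq> 0" for z
  proof (rule herglotz_ratio_not_nonpos[of "Fn z / Fd z" _ "Gn z / Gd z" "Im z"])
    have nzz: "Fd z \<noteq> 0" "Fn z \<noteq> 0" "Gd z \<noteq> 0" "Gn z \<noteq> 0" using off[OF im] zeros by auto
    show "Fn z / Fd z = E z * (Gn z / Gd z)" using Eeq[of z] nzz by simp
    have d: "Im (a / b) * s < 0" if "Im (a * cnj b) * s < 0" "b \<noteq> 0" for a b :: complex and s :: real
    proof -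
      have "Im (a / b) = Im (a * cnj b) / (norm b)\<^sup>2"
        by (simp add: Im_divide cmod_power2)
      hence "Im (a / b) * s = (Im (a * cnj b) * s) / (norm b)\<^sup>2" by simp
      thus ?thesis using that by (simp add: divide_neg_pos)
    qed
    show "Im (Fn z / Fd z) * Im z < 0" by (rule d[OF herg(1)[OF im] nzz(1)])
    show "Im (Gn z / Gd z) * Im z < 0" by (rule d[OF herg(2)[OF im] nzz(3)])
  qed
  have Ecnj: "E (cnj z) = cnj (E z)" if im: "Im z \<noteq> 0" for z
    using Eeq[of z] Eeq[of "cnj z"] off[OF im] cnj by simp
  have Ereal: "Im (E (complex_of_real t)) = 0" for t
  proof -
    \<comment> \<open>The symmetry of E is known only off the axis, where \<open>Fd\<close> and
      \<open>Fn\<close> have no zeros; it is carried to t by continuity.\<close>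
    define y where "y n = Complex t (1 / real (Suc n))" for n
    have im: "Im (y n) \<noteq> 0" for n unfolding y_def by simp
    have l0: "(\<lambda>n. 1 / real (Suc n)) \<longlonglongrightarrow> 0" by (rule LIMSEQ_Suc[OF lim_1_over_n])
    have "y \<longlonglongrightarrow> Complex t 0"
      unfolding y_def by (intro tendsto_intros l0)
    hence yt: "y \<longlonglongrightarrow> complex_of_real t" by (simp add: complex_of_real_def)
    have yc: "(\<lambda>n. cnj (y n)) \<longlonglongrightarrow> complex_of_real t" using tendsto_cnj[OF yt] by simp
    have cont: "isCont E (complex_of_real t)" using Ec by (simp add: continuous_on_eq_continuous_at)
    have 1: "(\<lambda>n. E (cnj (y n))) \<longlonglongrightarrow> E (complex_of_real t)" by (rule isCont_tendsto_compose[OF cont yc])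
    have 2: "(\<lambda>n. cnj (E (y n))) \<longlonglongrightarrow> cnj (E (complex_of_real t))"
      by (intro tendsto_cnj isCont_tendsto_compose[OF cont yt])
    have eq: "(\<lambda>n. E (cnj (y n))) = (\<lambda>n. cnj (E (y n)))" using Ecnj[OF im] by auto
    have "E (complex_of_real t) = cnj (E (complex_of_real t))" by (rule LIMSEQ_unique[OF 1[unfolded eq] 2])
    hence "Im (E (complex_of_real t)) = Im (cnj (E (complex_of_real t)))" by (rule arg_cong)
    thus ?thesis by simp
  qed
  have limE: "(\<lambda>n. E (complex_of_real (x n))) \<longlonglongrightarrow> 1" using lim Eeq nz by simp
  have "(\<lambda>n. Re (E (complex_of_real (x n)))) \<longlonglongrightarrow> 1" using tendsto_Re[OF limE] by simp
  hence "\<forall>\<^sub>F n in sequentially. 0 < Re (E (complex_of_real (x n)))"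
    by (rule order_tendstoD(1)) simp
  from eventually_happens'[OF sequentially_bot this] obtain n0 where n0: "Re (E (complex_of_real (x n0))) > 0"
    by blast
  have Epos: "Re (E (complex_of_real t)) > 0" for t
  proof (rule ccontr)
    assume neg: "\<not> Re (E (complex_of_real t)) > 0"
    have c: "continuous_on UNIV (\<lambda>t. Re (E (complex_of_real t)))"
      by (intro continuous_on_Re continuous_on_compose2[OF Ec continuous_on_of_real_id]) auto
    have "connected ((\<lambda>t. Re (E (complex_of_real t))) ` UNIV)"
      by (intro connected_continuous_image c connected_UNIV)
    hence "is_interval (range (\<lambda>t. Re (E (complex_of_real t))))" by (simp add: is_interval_connected_1)
    hence "0 \<in> range (\<lambda>t. Re (E (complex_of_real t)))"
      unfolding is_interval_1 using neg n0
      by (metis (mono_tags, lifting) linorder_not_less order_less_imp_le rangeI)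
    then obtain s where "Re (E (complex_of_real s)) = 0" by auto
    hence "E (complex_of_real s) = 0" using Ereal[of s] by (simp add: complex_eq_iff)
    thus False using E0 by blast
  qed
  have "E z \<notin> \<real>\<^sub>\<le>\<^sub>0" for z
  proof (cases "Im z = 0")
    case True
    hence "z = complex_of_real (Re z)" by (simp add: complex_eq_iff)
    thus ?thesis using Epos[of "Re z"] by (metis complex_nonpos_Reals_iff linorder_not_less)
  qed (rule offE)
  from entire_avoiding_nonpos_Reals_constant[OF E this] obtain c where c: "\<And>z. E z = c" by blast
  have "c = 1" using limE unfolding c by (simp add: LIMSEQ_const_iff)
  hence "B z = A z" using c[of z] A(2)[of z] unfolding E_def by simp
  thus ?thesis using A(3)[of z] B(3)[of z] by simp
qed

text \<open>A multiple zero would make F(z + i e) = o(e) while G stays bounded, against the lower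
  bound c e. With the Herglotz identity this gives simplicity of zeros without differentiating
  solutions in z.\<close>

lemma deriv_nonzero_if_product_lower_bound:
  assumes F: "F holomorphic_on UNIV" and G: "G holomorphic_on UNIV" and F0: "F z = 0"
    and c: "c > 0" and lb: "\<And>e. 0 < e \<Longrightarrow> e \<le> 1 \<Longrightarrow> norm (F (z + \<i> * complex_of_real e)) * norm (G (z + \<i> * complex_of_real e)) \<ge> c * e"
  shows "deriv F z \<noteq> 0"
proof
  assume d0: "deriv F z = 0"
  have "(F has_field_derivative deriv F z) (at z)" by (rule holomorphic_derivI[OF F]) auto
  hence D: "((\<lambda>h. (F (z + h) - F z) / h) \<longlongrightarrow> 0) (at 0)" unfolding d0 DERIV_def .
  define h where "h n = \<i> * complex_of_real (1 / real (Suc n))" for n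
  have h0: "h n \<noteq> 0" for n unfolding h_def mult_eq_0_iff of_real_eq_0_iff by simp
  have l0: "(\<lambda>n. 1 / real (Suc n)) \<longlonglongrightarrow> 0" by (rule LIMSEQ_Suc[OF lim_1_over_n])
  have "(\<lambda>n. \<i> * complex_of_real (1 / real (Suc n))) \<longlonglongrightarrow> \<i> * complex_of_real 0"
    by (intro tendsto_intros l0)
  hence hl: "h \<longlonglongrightarrow> 0" unfolding h_def by simp
  have q: "(\<lambda>n. (F (z + h n) - F z) / h n) \<longlonglongrightarrow> 0"
    using D hl h0 unfolding tendsto_at_iff_sequentially o_def by auto
  have "isCont G z" using holomorphic_on_imp_continuous_on[OF G] by (simp add: continuous_on_eq_continuous_at)
  hence "(\<lambda>n. G (z + h n)) \<longlonglongrightarrow> G z"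
    using isCont_tendsto_compose[of z G "\<lambda>n. z + h n" sequentially] tendsto_add[OF tendsto_const hl, of z] by simp
  from tendsto_norm[OF tendsto_mult[OF q this]]
  have lim: "(\<lambda>n. norm ((F (z + h n) - F z) / h n * G (z + h n))) \<longlonglongrightarrow> 0" by simp
  have "c \<le> norm ((F (z + h n) - F z) / h n * G (z + h n))" for n
  proof -
    define e where "e = 1 / real (Suc n)"
    have e: "0 < e" "e \<le> 1" unfolding e_def by auto
    have hn: "h n = \<i> * complex_of_real e" unfolding h_def e_def ..
    have nh: "norm (h n) = e" unfolding hn norm_mult norm_of_real using e by simp
    have "c * e \<le> norm (F (z + h n)) * norm (G (z + h n))" unfolding hn by (rule lb[OF e])
    thus ?thesis using e(1) by (simp add: norm_mult norm_divide F0 nh field_simps)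
  qed
  hence "c \<le> 0" by (intro LIMSEQ_le_const[OF lim]) auto
  thus False using c by simp
qed

text \<open>Phragmen-Lindeloef in a half plane, with the comparison function \<open>exp (- e (1 - \<i> z)\<^bsup>3/4\<^esup>)\<close>.\<close>

lemma phragmen_lindelof_upper_half_plane:
  assumes f: "f holomorphic_on UNIV"
    and growth: "\<And>z. norm (f z) \<le> A * exp (B * sqrt (norm z))"
    and real: "\<And>x. norm (f (complex_of_real x)) \<le> M"
    and z: "Im z > 0"
  shows "norm (f z) \<le> M + 1"
proof -
  have M0: "M \<ge> 0" using order_trans[OF norm_ge_zero real[of 0]] .
  \<comment> \<open>For Im z >= 0 the argument of 1 - i z lies within pi/2 of 0, and three quarters
    of it within 3 pi/8; so Re W is at least c |z|^(3/4).\<close>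
  define c where "c = cos (3 * pi / 8)"
  have c0: "c > 0" unfolding c_def by (intro cos_gt_zero_pi) (auto simp: field_simps)
  \<comment> \<open>3/4 lies strictly between 1/2, the growth order of f, and 1, the critical order
    for a half plane. The shift by 1 makes W holomorphic across the real axis.\<close>
  define W where "W z = (1 - \<i> * z) powr (3 / 4 :: complex)" for z
  have ReW: "Re (W z) \<ge> c * norm z powr (3 / 4)" if "Im z \<ge> 0" for z
  proof -
    define w where "w = 1 - \<i> * z"
    have Rew: "Re w > 0" unfolding w_def using that by simp
    hence w0: "w \<noteq> 0" by auto
    have "\<bar>Im (Ln w)\<bar> < pi / 2" using Rew Re_Ln_pos_lt[OF w0] by simp
    hence ang: "\<bar>3 / 4 * Im (Ln w)\<bar> \<le> 3 * pi / 8" by (simp add: abs_mult)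
    have "norm z \<le> norm w"
    proof -
      have "(Im z)\<^sup>2 \<le> (1 + Im z)\<^sup>2" using that by (intro power_mono) auto
      hence "(Re z)\<^sup>2 + (Im z)\<^sup>2 \<le> (1 + Im z)\<^sup>2 + (Re z)\<^sup>2" by simp
      thus ?thesis unfolding cmod_def w_def by (intro real_sqrt_le_mono) simp
    qed
    hence n: "norm z powr (3 / 4) \<le> norm w powr (3 / 4)" by (intro powr_mono2) auto
    have "W z = exp (3 / 4 * Ln w)" unfolding W_def w_def[symmetric] powr_def using w0 by simp
    hence "Re (W z) = exp (3 / 4 * Re (Ln w)) * cos (3 / 4 * Im (Ln w))" by (simp add: Re_exp)
    also have "exp (3 / 4 * Re (Ln w)) = norm w powr (3 / 4)"
      using w0 by (simp add: powr_def Re_Ln)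
    also have "cos (3 / 4 * Im (Ln w)) = cos \<bar>3 / 4 * Im (Ln w)\<bar>" by (rule cos_abs_real[symmetric])
    finally have "Re (W z) = norm w powr (3 / 4) * cos \<bar>3 / 4 * Im (Ln w)\<bar>" .
    moreover have "c \<le> cos \<bar>3 / 4 * Im (Ln w)\<bar>" unfolding c_def using ang by (intro cos_monotone_0_pi_le) auto
    ultimately have "norm z powr (3 / 4) * c \<le> Re (W z)" using n c0 by (auto intro!: mult_mono)
    thus ?thesis by (simp add: mult.commute)
  qed
  have Whol: "W holomorphic_on {z. Im z > -1}"
    unfolding W_def by (intro holomorphic_intros) (auto simp: complex_nonpos_Reals_iff)
  have key: "norm (f z * exp (- complex_of_real e * W z)) \<le> M + 1" if e: "e > 0" for e
  proof -
    define g where "g z = f z * exp (- complex_of_real e * W z)" for z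
    have ng: "norm (g z) \<le> norm (f z) * exp (- e * c * norm z powr (3 / 4))" if "Im z \<ge> 0" for z
    proof -
      have "e * (c * norm z powr (3 / 4)) \<le> e * Re (W z)" using ReW[OF that] e by (intro mult_left_mono) auto
      thus ?thesis unfolding g_def norm_mult norm_exp_eq_Re by (intro mult_left_mono) auto
    qed
    have "((\<lambda>r. A * exp (B * sqrt r - e * c * r powr (3 / 4))) \<longlongrightarrow> 0) at_top"
    proof -
      define d where "d = e * c"
      have "d > 0" unfolding d_def using e c0 by simp
      hence "((\<lambda>r. A * exp (B * sqrt r - d * r powr (3 / 4))) \<longlongrightarrow> 0) at_top" by real_asymp
      thus ?thesis unfolding d_def .
    qed
    hence "\<forall>\<^sub>F r in at_top. A * exp (B * sqrt r - e * c * r powr (3 / 4)) < 1"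
      by (rule order_tendstoD(2)) simp
    hence "\<forall>\<^sub>F r in at_top. A * exp (B * sqrt r - e * c * r powr (3 / 4)) < 1 \<and> r > norm z"
      using eventually_gt_at_top[of "norm z"] by eventually_elim simp
    then obtain r where r: "A * exp (B * sqrt r - e * c * r powr (3 / 4)) < 1" "r > norm z"
      unfolding eventually_at_top_linorder by blast
    \<comment> \<open>On this half disc the damped function is at most M on the diameter and, r
      being large, below 1 on the arc. The bound M + 1 covers both and does not depend on
      \<open>e\<close>, which tends to 0 at the end.\<close>
    define S where "S = {z. Im z > 0} \<inter> ball 0 r"
    have opS: "open S" unfolding S_def by (intro open_Int open_halfspace_Im_gt open_ball)
    have clS: "closure S \<subseteq> {z. Im z \<ge> 0} \<inter> cball 0 r"
      unfolding S_def by (intro closure_minimal closed_Int closed_halfspace_Im_ge closed_cball) auto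
    have ghol: "g holomorphic_on {z. Im z > -1}"
      unfolding g_def by (intro holomorphic_intros Whol holomorphic_on_subset[OF f]) auto
    have "norm (g z) \<le> M + 1"
    proof (rule maximum_modulus_frontier[of g S])
      show "g holomorphic_on interior S"
        by (rule holomorphic_on_subset[OF ghol]) (use interior_subset[of S] in \<open>auto simp: S_def\<close>)
      show "continuous_on (closure S) g"
        by (rule continuous_on_subset[OF holomorphic_on_imp_continuous_on[OF ghol]]) (use clS in auto)
      show "bounded S" unfolding S_def by (simp add: bounded_Int)
      show "z \<in> S" unfolding S_def using z r by simp
      fix y assume "y \<in> frontier S"
      hence "y \<in> closure S" "y \<notin> S" unfolding frontier_def using opS by (auto simp: interior_open)
      hence y: "Im y \<ge> 0" "norm y \<le> r" "Im y = 0 \<or> norm y = r" using clS unfolding S_def by auto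
      show "norm (g y) \<le> M + 1"
        using y(3)
      proof
        assume "Im y = 0"
        hence "y = complex_of_real (Re y)" by (simp add: complex_eq_iff)
        hence fy: "norm (f y) \<le> M" using real[of "Re y"] by simp
        have "norm (g y) \<le> norm (f y) * exp (- e * c * norm y powr (3 / 4))" by (rule ng[OF y(1)])
        also have "\<dots> \<le> norm (f y) * 1"
          using e c0 by (intro mult_left_mono) auto
        finally show ?thesis using fy by simp
      next
        assume ny: "norm y = r"
        have "norm (g y) \<le> norm (f y) * exp (- e * c * norm y powr (3 / 4))" by (rule ng[OF y(1)])
        also have "\<dots> \<le> A * exp (B * sqrt (norm y)) * exp (- e * c * norm y powr (3 / 4))"
          by (intro mult_right_mono growth) auto
        also have "\<dots> = A * exp (B * sqrt r - e * c * r powr (3 / 4))"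
          unfolding ny by (simp add: exp_diff exp_minus field_simps)
        finally show ?thesis using r(1) M0 by simp
      qed
    qed
    thus ?thesis unfolding g_def .
  qed
  have "(\<lambda>n. norm (f z * exp (- complex_of_real (1 / real (Suc n)) * W z))) \<longlonglongrightarrow> norm (f z * exp (- complex_of_real 0 * W z))"
    by (intro tendsto_intros LIMSEQ_Suc[OF lim_1_over_n])
  hence "norm (f z * exp (- complex_of_real 0 * W z)) \<le> M + 1"
    by (rule LIMSEQ_le_const2) (intro exI[of _ 0] allI impI key, simp)
  thus ?thesis by simp
qed

text \<open>The bounds are assumed only far out, and compactness supplies the rest. The lower half
  plane is reached through f(-z); then f is bounded, hence constant, and the limit identifies the
  constant.\<close>

theorem phragmen_lindelof_zero:
  assumes f: "f holomorphic_on UNIV" and A: "A \<ge> 0" and B: "B \<ge> 0"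
    and growth: "\<And>z. norm z \<ge> R \<Longrightarrow> norm (f z) \<le> A * exp (B * sqrt (norm z))"
    and real: "\<And>x. \<bar>x\<bar> \<ge> R \<Longrightarrow> norm (f (complex_of_real x)) \<le> M"
    and lim: "((\<lambda>x. f (complex_of_real x)) \<longlongrightarrow> 0) at_top"
  shows "f z = 0"
proof -
  have fc: "continuous_on UNIV f" by (rule holomorphic_on_imp_continuous_on[OF f])
  have "bounded (f ` cball 0 R)"
    by (intro compact_imp_bounded compact_continuous_image continuous_on_subset[OF fc]) auto
  then obtain K where "\<forall>y\<in>f ` cball 0 R. norm y \<le> K" unfolding bounded_iff by blast
  hence K: "norm (f z) \<le> K" if "norm z \<le> R" for z using that by simp
  define A' where "A' = A + \<bar>K\<bar>"
  define M' where "M' = max M K"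
  have growth': "norm (f z) \<le> A' * exp (B * sqrt (norm z))" for z
  proof -
    have e1: "1 \<le> exp (B * sqrt (norm z))" using B by simp
    have "norm (f z) \<le> A * exp (B * sqrt (norm z)) \<or> norm (f z) \<le> \<bar>K\<bar> * 1"
      using growth[of z] K[of z] by (cases "norm z \<ge> R") auto
    moreover have "\<bar>K\<bar> * 1 \<le> \<bar>K\<bar> * exp (B * sqrt (norm z))" using e1 by (intro mult_left_mono) auto
    moreover have "0 \<le> A * exp (B * sqrt (norm z))" "0 \<le> \<bar>K\<bar> * exp (B * sqrt (norm z))" using A by auto
    ultimately show ?thesis unfolding A'_def distrib_right by linarith
  qed
  have real': "norm (f (complex_of_real x)) \<le> M'" for x
    using real[of x] K[of "complex_of_real x"] unfolding M'_def by (cases "\<bar>x\<bar> \<ge> R") (auto simp: le_max_iff_disj)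
  have f2: "(\<lambda>z. f (- z)) holomorphic_on UNIV"
  proof -
    have "(\<lambda>z::complex. - z) holomorphic_on UNIV" by (intro holomorphic_intros)
    from holomorphic_on_compose_gen[OF this f] show ?thesis by (simp add: o_def)
  qed
  have bd: "norm (f z) \<le> M' + 1" for z
  proof (cases "Im z" "0 :: real" rule: linorder_cases)
    case greater
    thus ?thesis by (rule phragmen_lindelof_upper_half_plane[OF f growth' real'])
  next
    case equal
    hence "z = complex_of_real (Re z)" by (simp add: complex_eq_iff)
    thus ?thesis using real'[of "Re z"] by simp
  next
    case less
    have "norm (f (- (- z))) \<le> M' + 1"
      by (rule phragmen_lindelof_upper_half_plane[OF f2, of A' B M' "- z"])
        (use growth'[of "- _"] real'[of "- _"] less in auto)
    thus ?thesis by simp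
  qed
  hence "bounded (range f)" unfolding bounded_iff by blast
  from Liouville_theorem[OF f this] obtain k where k: "\<And>z. f z = k" unfolding constant_on_def by blast
  have "k = 0" using lim unfolding k by (simp add: tendsto_const_iff)
  thus ?thesis using k by simp
qed

lemma has_loc_ac_deriv_cnj:
  "has_loc_ac_deriv f g \<Longrightarrow> has_loc_ac_deriv (\<lambda>x. cnj (f x)) (\<lambda>x. cnj (g x))"
  unfolding has_loc_ac_deriv_iff by (blast intro: ac_on_cnj)

subsection \<open>Herglotz property and simplicity of the zeros\<close>

context radial
begin

definition phi_sq :: "complex \<Rightarrow> real" where
  "phi_sq z = integral {0..1} (\<lambda>x. (norm (phi z x))\<^sup>2)"

lemma phi_norm_integrable: "(\<lambda>x. (norm (phi z x))\<^sup>2) integrable_on {0..1}"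
  by (intro integrable_continuous_real continuous_intros phi_continuous)

text \<open>Lagrange's identity: the Wronskian of phi with its complex conjugate has derivative (cnj
  z - z) |phi|^2 and vanishes at 0.\<close>

lemma phi_herglotz: "Im (phi1 z 1 * cnj (phi z 1)) = - Im z * phi_sq z"
proof -
  define g where "g x = (cnj z - z) * complex_of_real ((norm (phi z x))\<^sup>2)" for x
  define W where "W x = phi1 z x * cnj (phi z x) - phi z x * cnj (phi1 z x)" for x
  have c: "has_loc_ac_deriv (\<lambda>x. cnj (phi z x)) (\<lambda>x. cnj (phi1 z x))"
    "has_loc_ac_deriv (\<lambda>x. cnj (phi1 z x)) (\<lambda>x. cnj ((complex_of_real (V x) - z) * phi z x))"
    by (rule has_loc_ac_deriv_cnj[OF solvesD(1)[OF phi_solves]] has_loc_ac_deriv_cnj[OF solvesD(2)[OF phi_solves]])+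
  have "has_loc_ac_deriv W (\<lambda>x. ((complex_of_real (V x) - z) * phi z x) * cnj (phi z x) - phi z x * cnj ((complex_of_real (V x) - z) * phi z x))"
    unfolding W_def by (rule has_loc_ac_deriv_wronskian[OF solvesD[OF phi_solves] c])
  hence W: "has_loc_ac_deriv W g"
  proof (rule has_loc_ac_deriv_cong)
    fix x :: real
    have "phi z x * cnj (phi z x) = complex_of_real ((norm (phi z x))\<^sup>2)" by (rule complex_norm_square[symmetric])
    thus "((complex_of_real (V x) - z) * phi z x) * cnj (phi z x) - phi z x * cnj ((complex_of_real (V x) - z) * phi z x) = g x"
      unfolding g_def by (simp add: algebra_simps)
  qed simp
  have gi: "g absolutely_integrable_on {0..1}"
    unfolding g_def by (intro absolutely_integrable_continuous_real continuous_intros phi_continuous)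
  obtain C where C: "\<And>x. x \<in> {0<..1} \<Longrightarrow> norm (phi z x) \<le> C * x powr (l + 1)" "\<And>x. x \<in> {0<..1} \<Longrightarrow> norm (phi1 z x) \<le> C * x powr l"
    using phi_bounds[of "norm z"] by blast
  have "(W \<longlongrightarrow> 0) (at_right 0)"
    unfolding W_def by (rule wronskian_tendsto_0[OF l, of _ C _ _ C]) (use C in auto)
  from has_loc_ac_deriv_from_0[OF W gi this, of 1]
  have "W 1 = integral {0..1} g" by simp
  also have "\<dots> = (cnj z - z) * complex_of_real (phi_sq z)"
  proof -
    have "integral {0..1} (\<lambda>x. complex_of_real ((norm (phi z x))\<^sup>2)) = complex_of_real (phi_sq z)"
      unfolding phi_sq_def
      by (rule integral_unique[OF has_integral_of_real[OF integrable_integral[OF phi_norm_integrable]]])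
    thus ?thesis unfolding g_def by (simp only: integral_mult_right)
  qed
  finally have "Im (W 1) = Im ((cnj z - z) * complex_of_real (phi_sq z))" by (rule arg_cong)
  thus ?thesis unfolding W_def by (simp add: algebra_simps)
qed

text \<open>On [d/2, d] phi is bounded below uniformly in |z| <= R. Uniformity is essential for the
  simplicity of zeros, where z moves off the real axis.\<close>

lemma phi_sq_lower: "\<exists>c>0. \<forall>z. norm z \<le> R \<longrightarrow> c \<le> phi_sq z"
proof -
  obtain d where d: "d \<in> {0<..1}" "\<And>z x. norm z \<le> R \<Longrightarrow> x \<in> {0..d} \<Longrightarrow> norm (w z x - 1) \<le> 1 / 2"
    using w_near_0[of R] by blast
  define c where "c = d / 2 * ((d / 2) powr (l + 1) / 2)\<^sup>2"
  show ?thesis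
  proof (intro exI conjI allI impI)
    show "c > 0" unfolding c_def using d(1) by simp
    fix z :: complex assume z: "norm z \<le> R"
    have "c = integral {d / 2..d} (\<lambda>x. ((d / 2) powr (l + 1) / 2)\<^sup>2)" unfolding c_def using d(1) by simp
    also have "\<dots> \<le> integral {d / 2..d} (\<lambda>x. (norm (phi z x))\<^sup>2)"
    proof (rule integral_le)
      show "(\<lambda>x. (norm (phi z x))\<^sup>2) integrable_on {d / 2..d}"
        by (rule integrable_on_subinterval[OF phi_norm_integrable]) (use d(1) in auto)
      fix x assume x: "x \<in> {d / 2..d}"
      have "norm (w z x - 1) \<le> 1 / 2" using d x z by (intro d(2)) auto
      hence "1 / 2 \<le> norm (w z x)" using norm_triangle_ineq2[of 1 "w z x"] by (simp add: norm_minus_commute)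
      hence "(d / 2) powr (l + 1) * (1 / 2) \<le> x powr (l + 1) * norm (w z x)"
        using x d(1) l by (intro mult_mono powr_mono2) auto
      also have "\<dots> = norm (phi z x)" unfolding phi_def by (simp add: norm_mult)
      finally show "((d / 2) powr (l + 1) / 2)\<^sup>2 \<le> (norm (phi z x))\<^sup>2" by (intro power_mono) auto
    qed auto
    also have "\<dots> \<le> phi_sq z"
      unfolding phi_sq_def
      by (intro integral_subset_le phi_norm_integrable integrable_on_subinterval[OF phi_norm_integrable]) (use d(1) in auto)
    finally show "c \<le> phi_sq z" .
  qed
qed

lemma phi_sq_pos: "phi_sq z > 0"
  using phi_sq_lower[of "norm z"] by force

lemma phi_herglotz_neg: "Im z \<noteq> 0 \<Longrightarrow> Im (phi1 z 1 * cnj (phi z 1)) * Im z < 0"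
proof -
  assume "Im z \<noteq> 0"
  hence "0 < Im z * Im z" by (metis not_real_square_gt_zero)
  from mult_pos_pos[OF this phi_sq_pos[of z]] show ?thesis unfolding phi_herglotz by (simp add: mult_ac)
qed

text \<open>Zeros are real by \<open>phi_herglotz\<close>. At distance e above a zero the same
  identity gives |phi1 phi| >= |Im (phi1 * cnj phi)| >= c e, which excludes a multiple zero of
  either factor.\<close>

lemma phi_simple_zeros:
  shows "phi z 1 = 0 \<Longrightarrow> deriv (\<lambda>z. phi z 1) z \<noteq> 0" and "phi1 z 1 = 0 \<Longrightarrow> deriv (\<lambda>z. phi1 z 1) z \<noteq> 0"
proof -
  obtain c where c: "c > 0" "\<And>y. norm y \<le> norm z + 1 \<Longrightarrow> c \<le> phi_sq y" using phi_sq_lower[of "norm z + 1"] by blast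
  have lb: "c * e \<le> norm (phi (z + \<i> * complex_of_real e) 1) * norm (phi1 (z + \<i> * complex_of_real e) 1)"
    if "Im z = 0" "0 < e" "e \<le> 1" for e
  proof -
    define y where "y = z + \<i> * complex_of_real e"
    have "norm y \<le> norm z + norm (\<i> * complex_of_real e)" unfolding y_def by (rule norm_triangle_ineq)
    also have "\<dots> \<le> norm z + 1" using that by (simp add: norm_mult)
    finally have "c \<le> phi_sq y" by (rule c(2))
    hence "c * e \<le> \<bar>Im (phi1 y 1 * cnj (phi y 1))\<bar>"
      unfolding phi_herglotz using that c(1) by (simp add: y_def abs_mult mult.commute)
    also have "\<dots> \<le> norm (phi1 y 1 * cnj (phi y 1))" by (rule abs_Im_le_cmod)
    finally show ?thesis unfolding y_def by (simp add: norm_mult mult.commute)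
  qed
  have hol: "(\<lambda>z. phi z 1) holomorphic_on UNIV" "(\<lambda>z. phi1 z 1) holomorphic_on UNIV"
    using phi_holomorphic[of 1] by auto
  have im: "Im z = 0" if "phi z 1 = 0 \<or> phi1 z 1 = 0"
    using phi_herglotz[of z] phi_sq_pos[of z] that by auto
  show "deriv (\<lambda>z. phi z 1) z \<noteq> 0" if "phi z 1 = 0"
    by (rule deriv_nonzero_if_product_lower_bound[OF hol that c(1)]) (use lb im that in auto)
  show "deriv (\<lambda>z. phi1 z 1) z \<noteq> 0" if "phi1 z 1 = 0"
    by (rule deriv_nonzero_if_product_lower_bound[OF hol(2,1) that c(1)]) (use lb im that in \<open>auto simp: mult.commute\<close>)
qed

end

subsection \<open>The free solution on the negative axis\<close>

text \<open>At z = -k^2 the regular free solution is sqrt x times a modified Bessel function, up to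
  a constant factor. Only positivity, monotonicity in x and growth in k are extracted, all from the
  Volterra equation.\<close>

locale radial_free =
  fixes l :: real
  assumes l': "l > - 1 / 2"

sublocale radial_free \<subseteq> radial l "\<lambda>_. 0"
  by unfold_locales (use l' in auto)

context radial_free
begin

definition nz :: "real \<Rightarrow> complex" where "nz k = complex_of_real (- k\<^sup>2)"
definition w0 :: "real \<Rightarrow> real \<Rightarrow> real" where "w0 k x = Re (w (nz k) x)"
definition P0 :: "real \<Rightarrow> real \<Rightarrow> real" where "P0 k x = Re (P (nz k) x)"

lemma q01_0: "q01 = (\<lambda>_. 0)" unfolding q01_def by auto

lemma w_P_nonneg:
  assumes "x \<in> {0..1}"
  shows "w (nz k) x \<in> \<real>\<^sub>\<ge>\<^sub>0" "P (nz k) x \<in> \<real>\<^sub>\<ge>\<^sub>0"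
proof -
  have U: "w (nz k) y \<in> \<real>\<^sub>\<ge>\<^sub>0" if "y \<in> {0..1}" for y
    unfolding w_def nz_def
    by (rule fwd.U_nonneg[of 1]) (use that in \<open>auto simp: wa_def wb_def q01_0\<close>)
  thus "w (nz k) x \<in> \<real>\<^sub>\<ge>\<^sub>0" using assms by blast
  show "P (nz k) x \<in> \<real>\<^sub>\<ge>\<^sub>0"
    unfolding P_def nz_def
  proof (rule fwd.inner_nonneg[of 1])
    show "continuous_on {0..1} (fwd.U (complex_of_real (- k\<^sup>2)))" by (rule fwd.U_cont) simp
    show "fwd.U (complex_of_real (- k\<^sup>2)) y \<in> \<real>\<^sub>\<ge>\<^sub>0" if "y \<in> {0..1}" for y
      using U[OF that] unfolding w_def nz_def .
  qed (use assms in \<open>auto simp: wb_def q01_0\<close>)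
qed

lemma w_P_of_real:
  assumes "x \<in> {0..1}"
  shows "w (nz k) x = complex_of_real (w0 k x)" "P (nz k) x = complex_of_real (P0 k x)" "w0 k x \<ge> 0" "P0 k x \<ge> 0"
  using w_P_nonneg[OF assms, of k] unfolding w0_def P0_def complex_nonneg_Reals_iff by (auto simp: complex_eq_iff)

lemma w_ac: "ac_on (w z) (\<lambda>t. complex_of_real (wa t) * P z t) 0 1"
  using fwd.U_ac_on[OF _ ac_on_const, of 1 z] unfolding w_def P_def by simp

lemma P_ac: "ac_on (P z) (fwd.integrand z (w z)) 0 1"
  using fwd.inner_ac_on[OF _ fwd.U_cont, of 1 z z] unfolding w_def P_def by simp

lemma has_integral_Re: "(f has_integral I) S \<Longrightarrow> ((\<lambda>x. Re (f x)) has_integral Re I) S" for f :: "real \<Rightarrow> complex"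
  using has_integral_linear[OF _ bounded_linear_Re] by (simp add: o_def)

lemma w0_has_integral:
  assumes "0 \<le> x" "x \<le> y" "y \<le> 1"
  shows "((\<lambda>t. wa t * P0 k t) has_integral (w0 k y - w0 k x)) {x..y}"
proof -
  have "((\<lambda>t. Re (complex_of_real (wa t) * P (nz k) t)) has_integral Re (w (nz k) y - w (nz k) x)) {x..y}"
    by (intro has_integral_Re ac_on_has_integral[OF w_ac] assms)
  thus ?thesis by (simp add: w0_def P0_def)
qed

lemma P0_has_integral:
  assumes "0 \<le> x" "x \<le> y" "y \<le> 1"
  shows "((\<lambda>t. wb t * k\<^sup>2 * w0 k t) has_integral (P0 k y - P0 k x)) {x..y}"
proof -
  have "((\<lambda>t. Re (fwd.integrand (nz k) (w (nz k)) t)) has_integral Re (P (nz k) y - P (nz k) x)) {x..y}"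
    by (intro has_integral_Re ac_on_has_integral[OF P_ac] assms)
  moreover have "Re (fwd.integrand (nz k) (w (nz k)) t) = wb t * k\<^sup>2 * w0 k t" for t
    unfolding fwd.integrand_def w0_def by (simp add: q01_0 nz_def mult.assoc)
  ultimately show ?thesis by (simp only: P0_def minus_complex.sel)
qed

lemma w0_mono: "0 \<le> x \<Longrightarrow> x \<le> y \<Longrightarrow> y \<le> 1 \<Longrightarrow> w0 k x \<le> w0 k y"
  using has_integral_nonneg[OF w0_has_integral[of x y k]] w_P_of_real(4)[of _ k] by (force simp: wa_def)

lemma P0_mono: "0 \<le> x \<Longrightarrow> x \<le> y \<Longrightarrow> y \<le> 1 \<Longrightarrow> P0 k x \<le> P0 k y"
  using has_integral_nonneg[OF P0_has_integral[of x y k]] w_P_of_real(3)[of _ k] by (force simp: wb_def)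

lemma w0_ge_1: "x \<in> {0..1} \<Longrightarrow> w0 k x \<ge> 1"
  using w0_mono[of 0 x k] by (simp add: w0_def w_0)

text \<open>Integrate (x^(2l+2) w')' = k^2 x^(2l+2) w twice from x, with w and the weight bounded
  below by their values at x and with \<open>wa\<close> >= 1 on (0, 1]. Polynomial growth in k is
  far from the true exponential rate, but it already forces the ratios w0(x) / w0(t) to 0.\<close>

lemma w0_growth:
  assumes "0 < x" "x \<le> t" "t \<le> 1"
  shows "w0 k t \<ge> w0 k x * (1 + k\<^sup>2 * wb x * (t - x)\<^sup>2 / 2)"
proof -
  have P: "P0 k s \<ge> k\<^sup>2 * w0 k x * wb x * (s - x)" if s: "x \<le> s" "s \<le> 1" for s
  proof -
    have 1: "((\<lambda>_. wb x * k\<^sup>2 * w0 k x) has_integral (wb x * k\<^sup>2 * w0 k x * (s - x))) {x..s}"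
      using has_integral_const_real[of "wb x * k\<^sup>2 * w0 k x" x s] s by (simp add: mult.commute)
    have "wb x * k\<^sup>2 * w0 k x * (s - x) \<le> P0 k s - P0 k x"
    proof (rule has_integral_le[OF 1 P0_has_integral])
      fix y assume y: "y \<in> {x..s}"
      have "wb x \<le> wb y" unfolding wb_def using y assms l by (intro powr_mono2) auto
      moreover have "w0 k x \<le> w0 k y" using y s assms by (intro w0_mono) auto
      moreover have "0 \<le> wb x" "0 \<le> w0 k x" unfolding wb_def using w0_ge_1[of x k] assms by auto
      ultimately show "wb x * k\<^sup>2 * w0 k x \<le> wb y * k\<^sup>2 * w0 k y"
        by (intro mult_mono) auto
    qed (use assms s in auto)
    thus ?thesis using w_P_of_real(4)[of x k] assms by (simp add: mult_ac)
  qed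
  define c where "c = k\<^sup>2 * w0 k x * wb x"
  have "((\<lambda>s. c * (s - x)) has_integral (c * (t - x)\<^sup>2 / 2 - c * (x - x)\<^sup>2 / 2)) {x..t}"
    by (rule fundamental_theorem_of_calculus)
      (use assms in \<open>auto intro!: derivative_eq_intros simp flip: has_real_derivative_iff_has_vector_derivative\<close>)
  hence 1: "((\<lambda>s. c * (s - x)) has_integral (c * (t - x)\<^sup>2 / 2)) {x..t}" by simp
  have "c * (t - x)\<^sup>2 / 2 \<le> w0 k t - w0 k x"
  proof (rule has_integral_le[OF 1 w0_has_integral])
    fix s assume s: "s \<in> {x..t}"
    have "1 powr (- (2 * l + 2)) \<le> wa s" unfolding wa_def using s assms l by (intro powr_mono2') auto
    hence "1 * (c * (s - x)) \<le> wa s * P0 k s"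
      using P[of s] s assms w_P_of_real(3)[of x k]
      by (intro mult_mono) (auto simp: c_def wb_def intro!: mult_nonneg_nonneg)
    thus "c * (s - x) \<le> wa s * P0 k s" by simp
  qed (use assms in auto)
  thus ?thesis unfolding c_def by (simp add: algebra_simps)
qed

lemma w0_ratio_tendsto:
  assumes "0 < x" "x < t" "t \<le> 1" and X: "filterlim X at_top F"
  shows "((\<lambda>n. w0 (X n) x / w0 (X n) t) \<longlongrightarrow> 0) F"
proof (rule tendsto_sandwich)
  define c where "c = wb x * (t - x)\<^sup>2 / 2"
  have c0: "c > 0" unfolding c_def wb_def using assms by simp
  have le: "w0 k x / w0 k t \<le> 1 / (1 + k\<^sup>2 * c)" for k
  proof -
    have p: "w0 k x \<ge> 1" "w0 k t \<ge> 1" using assms by (auto intro: w0_ge_1)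
    have "w0 k x * (1 + k\<^sup>2 * c) \<le> w0 k t" using w0_growth[of x t k] assms unfolding c_def by (simp add: mult_ac)
    thus ?thesis using p c0 by (simp add: field_simps add_pos_nonneg)
  qed
  show "\<forall>\<^sub>F n in F. w0 (X n) x / w0 (X n) t \<le> 1 / (1 + (X n)\<^sup>2 * c)" using le by simp
  show "\<forall>\<^sub>F n in F. 0 \<le> w0 (X n) x / w0 (X n) t" using w_P_of_real(3) assms by simp
  have "((\<lambda>k. 1 / (1 + k\<^sup>2 * c)) \<longlongrightarrow> 0) at_top" using c0 by real_asymp
  from filterlim_compose[OF this X] show "((\<lambda>n. 1 / (1 + (X n)\<^sup>2 * c)) \<longlongrightarrow> 0) F" .
qed simp

definition phi0 :: "real \<Rightarrow> real \<Rightarrow> real" where "phi0 k x = x powr (l + 1) * w0 k x"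

lemma phi_eq_phi0: "x \<in> {0..1} \<Longrightarrow> phi (nz k) x = complex_of_real (phi0 k x)"
  unfolding phi_def phi0_def by (simp add: w_P_of_real)

lemma phi0_pos: "x \<in> {0<..1} \<Longrightarrow> phi0 k x > 0"
  unfolding phi0_def using w0_ge_1[of x k] by simp

lemma phi0_mono: "0 \<le> x \<Longrightarrow> x \<le> y \<Longrightarrow> y \<le> 1 \<Longrightarrow> phi0 k x \<le> phi0 k y"
  unfolding phi0_def using w_P_of_real(3)[of x k] l
  by (intro mult_mono w0_mono powr_mono2) auto

lemma phi0_ratio_le: 
  assumes "0 < x" "x \<le> t" "t \<le> 1"
  shows "phi0 k x / phi0 k t \<le> w0 k x / w0 k t"
proof -
  have p: "w0 k x \<ge> 1" "w0 k t \<ge> 1" using assms by (auto intro: w0_ge_1)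
  have "x powr (l + 1) \<le> t powr (l + 1)" using assms l by (intro powr_mono2) auto
  hence "x powr (l + 1) / t powr (l + 1) * (w0 k x / w0 k t) \<le> 1 * (w0 k x / w0 k t)"
    using p assms by (intro mult_right_mono) auto
  thus ?thesis unfolding phi0_def by simp
qed

lemma phi0_ratio_tendsto:
  assumes "0 < x" "x < t" "t \<le> 1" and X: "filterlim X at_top F"
  shows "((\<lambda>n. phi0 (X n) x / phi0 (X n) t) \<longlongrightarrow> 0) F"
proof (rule tendsto_sandwich[OF _ _ tendsto_const w0_ratio_tendsto[OF assms]])
  show "\<forall>\<^sub>F n in F. phi0 (X n) x / phi0 (X n) t \<le> w0 (X n) x / w0 (X n) t" using phi0_ratio_le assms by simp
  show "\<forall>\<^sub>F n in F. 0 \<le> phi0 (X n) x / phi0 (X n) t"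
    using phi0_pos[of x] phi0_pos[of t] assms by (intro always_eventually allI divide_nonneg_pos) (auto intro: less_imp_le)
qed

definition m0 :: "real \<Rightarrow> real" where "m0 k = l + 1 + P0 k 1 / w0 k 1"

lemma phi1_at_1: "phi1 (nz k) 1 = complex_of_real (m0 k * phi0 k 1)"
proof -
  have "w0 k 1 \<ge> 1" using w0_ge_1 by simp
  thus ?thesis unfolding phi1_def m0_def phi0_def by (simp add: w_P_of_real distrib_right)
qed

text \<open>For large k the function w0 at least doubles between x and 1, whereas its increment is
  at most D P0(1) (1 - x). Hence P0(1) / w0(1) >= 1 / (2 D (1 - x)), which is large for x close to
  1.\<close>

lemma m0_at_top: "filterlim m0 at_top at_top"
  unfolding filterlim_at_top
proof
  fix Z :: real
  define D where "D = max 1 (wa (1/2))"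
  \<comment> \<open>Chosen so that 1 / (2 D (1 - x)) = |Z| + 1. Since D >= 1, this x is at least
    1/2, where D bounds \<open>wa\<close>.\<close>
  define x where "x = 1 - 1 / (2 * (\<bar>Z\<bar> + 1) * D)"
  have D1: "D \<ge> 1" unfolding D_def by simp
  have "1 * 1 \<le> (\<bar>Z\<bar> + 1) * D" using D1 by (intro mult_mono) auto
  hence ZD: "(\<bar>Z\<bar> + 1) * D \<ge> 1" by simp
  hence x: "1 / 2 \<le> x" "x < 1" unfolding x_def by (auto simp: field_simps)
  have "((\<lambda>k. w0 k x / w0 k 1) \<longlongrightarrow> 0) at_top"
    by (rule w0_ratio_tendsto) (use x in \<open>auto intro: filterlim_ident\<close>)
  hence "\<forall>\<^sub>F k in at_top. w0 k x / w0 k 1 < 1 / 2" by (rule order_tendstoD(2)) simp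
  thus "\<forall>\<^sub>F k in at_top. Z \<le> m0 k"
  proof eventually_elim
    case (elim k)
    have w1: "w0 k 1 \<ge> 1" using w0_ge_1 by simp
    have 1: "((\<lambda>_. D * P0 k 1) has_integral (D * P0 k 1 * (1 - x))) {x..1}"
      using has_integral_const_real[of "D * P0 k 1" x 1] x by (simp add: mult.commute)
    have "w0 k 1 - w0 k x \<le> D * P0 k 1 * (1 - x)"
    proof (rule has_integral_le[OF w0_has_integral 1])
      fix t assume t: "t \<in> {x..1}"
      have "wa t \<le> wa (1/2)" unfolding wa_def using t x l by (intro powr_mono2') auto
      thus "wa t * P0 k t \<le> D * P0 k 1"
        using P0_mono[of t 1 k] t x w_P_of_real(4)[of t k] D1 by (intro mult_mono) (auto simp: D_def)
    qed (use x in auto)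
    moreover have "w0 k x \<le> w0 k 1 / 2" using elim w1 by (simp add: field_simps)
    ultimately have "w0 k 1 / 2 \<le> D * P0 k 1 * (1 - x)" by simp
    also have "D * P0 k 1 * (1 - x) = P0 k 1 / (2 * (\<bar>Z\<bar> + 1))"
    proof -
      have "D * p * (1 - (1 - 1 / (2 * a * D))) = p / (2 * a)" for p a :: real using D1 by simp
      thus ?thesis unfolding x_def .
    qed
    finally have "\<bar>Z\<bar> + 1 \<le> P0 k 1 / w0 k 1" using w1 by (simp add: field_simps)
    thus "Z \<le> m0 k" unfolding m0_def using l by linarith
  qed
qed

end

subsection \<open>Comparison with the free solution on the negative axis\<close>

context radial
begin

interpretation F: radial_free l
  by unfold_locales (rule l)

definition q_norm :: real where "q_norm = integral {0..1} (\<lambda>y. \<bar>q y\<bar>)"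

text \<open>For r = phi / phi0 reduction of order gives r'(t) = phi0(t)^-2 times the integral of q r
  phi0^2 over [0, t]. So \<open>cmph\<close> bounds |r'| relative to max |r|, and \<open>gam\<close>
  bounds the total change of r in the same sense. In \<open>cmph\<close> the quotient stands under
  the integral to make dominated convergence applicable.\<close>

definition cmpG :: "real \<Rightarrow> real \<Rightarrow> real" where
  "cmpG k t = integral {0..t} (\<lambda>y. \<bar>q y\<bar> * (F.phi0 k y)\<^sup>2)"

definition cmph :: "real \<Rightarrow> real \<Rightarrow> real" where
  "cmph k t = integral {0..t} (\<lambda>y. \<bar>q y\<bar> * (F.phi0 k y / F.phi0 k t)\<^sup>2)"

definition gam :: "real \<Rightarrow> real" where "gam k = integral {0..1} (cmph k)"

lemma phi0_continuous: "continuous_on {0..1} (F.phi0 k)"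
proof -
  have "continuous_on {0..1} (\<lambda>x. Re (F.phi (F.nz k) x))" by (intro continuous_intros F.phi_continuous)
  thus ?thesis by (rule continuous_on_eq) (simp add: F.phi_eq_phi0)
qed

lemma abs_q_integrable: "0 \<le> a \<Longrightarrow> b \<le> 1 \<Longrightarrow> (\<lambda>y. \<bar>q y\<bar>) integrable_on {a..b}"
  by (rule integrable_on_subinterval[of _ "{0..1}"]) (use q in \<open>auto simp: absolutely_integrable_on_def\<close>)

lemma q_norm_ge: "0 \<le> a \<Longrightarrow> b \<le> 1 \<Longrightarrow> integral {a..b} (\<lambda>y. \<bar>q y\<bar>) \<le> q_norm"
  unfolding q_norm_def by (intro integral_subset_le abs_q_integrable) auto

lemma q_norm_nonneg: "0 \<le> q_norm"
  unfolding q_norm_def by (intro Henstock_Kurzweil_Integration.integral_nonneg abs_q_integrable) auto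

lemma cmp_integrable:
  assumes "t \<le> 1"
  shows "(\<lambda>y. \<bar>q y\<bar> * (F.phi0 k y)\<^sup>2) integrable_on {0..t}"
proof -
  have "(\<lambda>y. (F.phi0 k y)\<^sup>2 * \<bar>q y\<bar>) absolutely_integrable_on {0..1}"
    by (intro absolutely_integrable_continuous_mult continuous_intros phi0_continuous set_integrable_abs q)
  hence "(\<lambda>y. \<bar>q y\<bar> * (F.phi0 k y)\<^sup>2) integrable_on {0..1}"
    by (simp add: absolutely_integrable_on_def mult.commute)
  thus ?thesis by (rule integrable_on_subinterval) (use assms in auto)
qed

lemma cmph_eq: "cmph k t = cmpG k t / (F.phi0 k t)\<^sup>2"
  unfolding cmph_def cmpG_def by (simp add: power_divide)

lemma cmph_integrable': "t \<le> 1 \<Longrightarrow> (\<lambda>y. \<bar>q y\<bar> * (F.phi0 k y / F.phi0 k t)\<^sup>2) integrable_on {0..t}"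
  using integrable_on_divide[OF cmp_integrable[of t k], of "(F.phi0 k t)\<^sup>2"] by (simp add: power_divide)

lemma cmp_term_le:
  assumes "0 \<le> y" "y \<le> t" "t \<le> 1"
  shows "\<bar>q y\<bar> * (F.phi0 k y / F.phi0 k t)\<^sup>2 \<le> \<bar>q y\<bar>"
proof (cases "t = 0")
  case False
  have "F.phi0 k y / F.phi0 k t \<le> 1" "0 \<le> F.phi0 k y / F.phi0 k t"
    using F.phi0_mono[of y t k] F.phi0_mono[of 0 y k] F.phi0_pos[of t k] assms False l by (auto simp: F.phi0_def)
  hence "(F.phi0 k y / F.phi0 k t)\<^sup>2 \<le> 1" by (intro power_le_one)
  thus ?thesis by (intro mult_left_le) auto
next
  case True
  thus ?thesis using l by (simp add: F.phi0_def)
qed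

lemma cmph_bounds:
  assumes "0 \<le> t" "t \<le> 1"
  shows "0 \<le> cmph k t" "cmph k t \<le> q_norm"
proof -
  show "0 \<le> cmph k t"
    unfolding cmph_def by (intro Henstock_Kurzweil_Integration.integral_nonneg cmph_integrable') (use assms in auto)
  have "cmph k t \<le> integral {0..t} (\<lambda>y. \<bar>q y\<bar>)"
    unfolding cmph_def by (intro integral_le cmph_integrable' abs_q_integrable) (use assms cmp_term_le in auto)
  also have "\<dots> \<le> q_norm" by (rule q_norm_ge) (use assms in auto)
  finally show "cmph k t \<le> q_norm" .
qed

lemma cmph_integrable: "cmph k absolutely_integrable_on {0..1}"
proof (rule integrable_on_bounded_continuous_interior)
  have "continuous_on {0..1} (cmpG k)"
    unfolding cmpG_def by (intro indefinite_integral_continuous_1 cmp_integrable) simp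
  hence G: "continuous_on {0<..<1} (cmpG k)" by (rule continuous_on_subset) auto
  have "continuous_on {0<..<1} (F.phi0 k)" by (rule continuous_on_subset[OF phi0_continuous]) auto
  hence "continuous_on {0<..<1} (\<lambda>t. (F.phi0 k t)\<^sup>2)" by (rule continuous_on_power)
  moreover have "(F.phi0 k t)\<^sup>2 \<noteq> 0" if "t \<in> {0<..<1}" for t using F.phi0_pos[of t k] that by simp
  ultimately have "continuous_on {0<..<1} (\<lambda>t. cmpG k t / (F.phi0 k t)\<^sup>2)"
    using G by (intro continuous_on_divide) auto
  thus "continuous_on {0<..<1} (cmph k)" by (rule continuous_on_eq) (rule cmph_eq[symmetric])
  show "norm (cmph k x) \<le> q_norm" if "x \<in> {0<..<1}" for x
    using cmph_bounds[of x k] that by simp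
qed

lemma cmph_tendsto:
  assumes t: "0 \<le> t" "t \<le> 1" and X: "filterlim X at_top sequentially"
  shows "(\<lambda>n. cmph (X n) t) \<longlonglongrightarrow> 0"
proof -
  \<comment> \<open>The integrands tend to 0 for y < t by the ratio limit, and |q| dominates. At y =
    t the quotient is 1, except for t = 0, where it is 0 / 0 = 0; this single point is removed
    afterwards.\<close>
  have "(\<lambda>n. integral {0..t} (\<lambda>y. \<bar>q y\<bar> * (F.phi0 (X n) y / F.phi0 (X n) t)\<^sup>2)) \<longlonglongrightarrow>
      integral {0..t} (\<lambda>y. if y = t then \<bar>q t\<bar> * (if t = 0 then 0 else 1) else 0)"
  proof (rule dominated_convergence(2))
    show "norm (\<bar>q y\<bar> * (F.phi0 (X n) y / F.phi0 (X n) t)\<^sup>2) \<le> \<bar>q y\<bar>" if "y \<in> {0..t}" for n y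
      using cmp_term_le[of y t "X n"] that t by simp
    show "(\<lambda>n. \<bar>q y\<bar> * (F.phi0 (X n) y / F.phi0 (X n) t)\<^sup>2) \<longlonglongrightarrow>
        (if y = t then \<bar>q t\<bar> * (if t = 0 then 0 else 1) else 0)" if y: "y \<in> {0..t}" for y
    proof -
      consider "y = 0" | "y = t" "t > 0" | "0 < y" "y < t" using y by force
      thus ?thesis
      proof cases
        case 1
        thus ?thesis using l by (auto simp: F.phi0_def)
      next
        case 2
        have "F.phi0 (X n) t \<noteq> 0" for n using F.phi0_pos[of t "X n"] 2 t by simp
        thus ?thesis using 2 by simp
      next
        case 3
        have "(\<lambda>n. \<bar>q y\<bar> * (F.phi0 (X n) y / F.phi0 (X n) t)\<^sup>2) \<longlonglongrightarrow> \<bar>q y\<bar> * 0\<^sup>2"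
          by (intro tendsto_intros F.phi0_ratio_tendsto X) (use 3 t in auto)
        thus ?thesis using 3 by simp
      qed
    qed
  qed (use t in \<open>auto intro!: cmph_integrable' abs_q_integrable\<close>)
  also have "integral {0..t} (\<lambda>y. if y = t then \<bar>q t\<bar> * (if t = 0 then 0 else 1) else 0) = integral {0..t} (\<lambda>_. 0)"
    by (rule integral_spike[of "{t}"]) auto
  finally show ?thesis unfolding cmph_def by simp
qed

lemma gam_tendsto: "(gam \<longlongrightarrow> 0) at_top"
proof (rule tendsto_at_topI_sequentially)
  fix X :: "nat \<Rightarrow> real" assume X: "filterlim X at_top sequentially"
  have "(\<lambda>n. integral {0..1} (cmph (X n))) \<longlonglongrightarrow> integral {0..1} (\<lambda>_::real. 0)"
  proof (rule dominated_convergence(2))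
    show "cmph (X n) integrable_on {0..1}" for n using cmph_integrable unfolding absolutely_integrable_on_def by blast
    show "norm (cmph (X n) t) \<le> q_norm" if "t \<in> {0..1}" for n t using cmph_bounds[of t "X n"] that by simp
    show "(\<lambda>n. cmph (X n) t) \<longlonglongrightarrow> 0" if "t \<in> {0..1}" for t using cmph_tendsto[OF _ _ X] that by simp
  qed auto
  thus "(\<lambda>n. gam (X n)) \<longlonglongrightarrow> 0" unfolding gam_def by simp
qed

text \<open>A self-improving bound: with rho = max |r| one has |r - 1| <= rho gam <= rho / 4, hence
  rho <= 1 + rho / 4, rho <= 4/3 and |r - 1| <= 1/3. The difference of the m functions is the
  Wronskian at 1 over phi phi0, at most (4/3) (3/2) \<open>q_norm\<close>.\<close>

lemma comparison:
  assumes g: "gam k \<le> 1 / 4"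
  defines "z \<equiv> F.nz k"
  shows "x \<in> {0<..1} \<Longrightarrow> norm (phi z x - F.phi0 k x) \<le> F.phi0 k x / 3"
    and "norm (phi1 z 1 / phi z 1 - F.m0 k) \<le> 2 * q_norm"
proof -
  define r where "r x = w z x / F.w z x" for x
  have Fw: "F.w z x \<noteq> 0" if "x \<in> {0..1}" for x
    using F.w_P_of_real(1)[OF that, of k] F.w0_ge_1[OF that, of k] unfolding z_def by auto
  have rc: "continuous_on {0..1} r"
    unfolding r_def by (intro continuous_intros w_continuous F.w_continuous) (use Fw in auto)
  have Fphi: "F.phi z x = complex_of_real (F.phi0 k x)" if "x \<in> {0..1}" for x
    using F.phi_eq_phi0[OF that] unfolding z_def .
  have phi_r: "phi z x = r x * complex_of_real (F.phi0 k x)" if "x \<in> {0..1}" for x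
  proof -
    have "phi z x = r x * F.phi z x" unfolding phi_def F.phi_def r_def using Fw[OF that] by simp
    thus ?thesis unfolding Fphi[OF that] .
  qed
  have "continuous_on {0..1} (\<lambda>x. norm (r x))" by (intro continuous_intros rc)
  then obtain xm where xm: "xm \<in> {0..1}" and max: "\<And>y. y \<in> {0..1} \<Longrightarrow> norm (r y) \<le> norm (r xm)"
    using continuous_attains_sup[of "{0..1::real}" "\<lambda>x. norm (r x)"] by auto
  define rho where "rho = norm (r xm)"
  have rho0: "rho \<ge> 0" unfolding rho_def by simp
  have r0: "r 0 = 1" unfolding r_def by (simp add: w_0 F.w_0)
  define Om where "Om x = phi1 z x * F.phi z x - phi z x * F.phi1 z x" for x
  define g where "g x = complex_of_real (q x) * (phi z x * F.phi z x)" for x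
  have "has_loc_ac_deriv Om (\<lambda>x. (complex_of_real (V x) - z) * phi z x * F.phi z x - phi z x * ((complex_of_real (F.V x) - z) * F.phi z x))"
    unfolding Om_def by (rule has_loc_ac_deriv_wronskian[OF solvesD[OF phi_solves] F.solvesD[OF F.phi_solves]])
  hence dOm: "has_loc_ac_deriv Om g"
    by (rule has_loc_ac_deriv_cong) (auto simp: g_def V_def F.V_def algebra_simps)
  have gi: "g absolutely_integrable_on {0..1}"
    unfolding g_def using absolutely_integrable_continuous_mult[OF _ absolutely_integrable_of_real[OF q], of "\<lambda>x. phi z x * F.phi z x"]
    by (simp add: mult.commute continuous_on_mult phi_continuous F.phi_continuous)
  obtain C where C: "\<And>x. x \<in> {0<..1} \<Longrightarrow> norm (phi z x) \<le> C * x powr (l + 1)" "\<And>x. x \<in> {0<..1} \<Longrightarrow> norm (phi1 z x) \<le> C * x powr l"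
    using phi_bounds[of "norm z"] by blast
  obtain D where D: "\<And>x. x \<in> {0<..1} \<Longrightarrow> norm (F.phi z x) \<le> D * x powr (l + 1)" "\<And>x. x \<in> {0<..1} \<Longrightarrow> norm (F.phi1 z x) \<le> D * x powr l"
    using F.phi_bounds[of "norm z"] by blast
  have lim: "(Om \<longlongrightarrow> 0) (at_right 0)"
    unfolding Om_def by (rule wronskian_tendsto_0[OF l, of _ C _ _ D]) (use C D in auto)
  have Om_bound: "norm (Om t) \<le> rho * cmpG k t" if t: "t \<in> {0<..1}" for t
  proof -
    have "Om t = integral {0..t} g" using has_loc_ac_deriv_from_0[OF dOm gi lim t] by simp
    also have "norm \<dots> \<le> rho * integral {0..t} (\<lambda>y. \<bar>q y\<bar> * (F.phi0 k y)\<^sup>2)"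
    proof (rule integral_abs_le_const)
      show "g integrable_on {0..t}"
        by (rule integrable_on_subinterval[of _ "{0..1}"]) (use gi t in \<open>auto simp: absolutely_integrable_on_def\<close>)
      show "(\<lambda>y. \<bar>q y\<bar> * (F.phi0 k y)\<^sup>2) integrable_on {0..t}" by (rule cmp_integrable) (use t in auto)
      fix y assume y: "y \<in> {0..t}"
      hence y1: "y \<in> {0..1}" using t by auto
      have "norm (g y) = norm (r y) * (\<bar>q y\<bar> * (F.phi0 k y)\<^sup>2)"
        unfolding g_def phi_r[OF y1] Fphi[OF y1] by (simp add: norm_mult power2_eq_square)
      also have "\<dots> \<le> rho * (\<bar>q y\<bar> * (F.phi0 k y)\<^sup>2)"
        unfolding rho_def by (intro mult_right_mono max y1) auto
      finally show "norm (g y) \<le> rho * (\<bar>q y\<bar> * (F.phi0 k y)\<^sup>2)" .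
    qed
    finally show ?thesis unfolding cmpG_def .
  qed
  have re: "norm (r x - r e) \<le> rho * gam k" if x: "x \<in> {0<..1}" and e: "0 < e" "e \<le> x" for x e
  proof -
    have pos: "F.phi0 k t > 0" if "t \<in> {e..x}" for t using F.phi0_pos[of t k] that x e by auto
    have q1: "phi z t / F.phi z t = r t" if "t \<in> {e..x}" for t
      using phi_r[of t] Fphi[of t] pos[OF that] that x e by auto
    have int: "((\<lambda>t. Om t / (F.phi z t)\<^sup>2) has_integral (r x - r e)) {e..x}"
    proof -
      have "((\<lambda>t. Om t / (F.phi z t)\<^sup>2) has_integral (phi z x / F.phi z x - phi z e / F.phi z e)) {e..x}"
        unfolding Om_def
      proof (rule has_loc_ac_deriv_quotient_has_integral[OF solvesD[OF phi_solves] F.solvesD[OF F.phi_solves]])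
        show "F.phi z t \<noteq> 0" if "t \<in> {e..x}" for t using Fphi[of t] pos[OF that] that x e by auto
      qed (use x e in auto)
      thus ?thesis using q1[of x] q1[of e] e by simp
    qed
    have hi: "cmph k integrable_on {e..x}"
      by (rule integrable_on_subinterval[of _ "{0..1}"]) (use cmph_integrable x e in \<open>auto simp: absolutely_integrable_on_def\<close>)
    have "r x - r e = integral {e..x} (\<lambda>t. Om t / (F.phi z t)\<^sup>2)" using int by (simp add: has_integral_iff)
    also have "norm \<dots> \<le> rho * integral {e..x} (cmph k)"
    proof (rule integral_abs_le_const[OF has_integral_integrable[OF int] hi])
      fix t assume t: "t \<in> {e..x}"
      have "norm (Om t / (F.phi z t)\<^sup>2) = norm (Om t) / (F.phi0 k t)\<^sup>2"
        using Fphi[of t] t x e by (simp add: norm_divide norm_power)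
      also have "\<dots> \<le> rho * cmpG k t / (F.phi0 k t)\<^sup>2"
        using t x e by (intro divide_right_mono Om_bound) auto
      finally show "norm (Om t / (F.phi z t)\<^sup>2) \<le> rho * cmph k t" unfolding cmph_eq by simp
    qed
    also have "\<dots> \<le> rho * gam k"
    proof (rule mult_left_mono[OF _ rho0])
      show "integral {e..x} (cmph k) \<le> gam k"
        unfolding gam_def using cmph_integrable x e hi cmph_bounds
        by (intro integral_subset_le) (auto simp: absolutely_integrable_on_def)
    qed
    finally show ?thesis .
  qed
  have r1: "norm (r x - 1) \<le> rho * gam k" if x: "x \<in> {0..1}" for x
  proof (cases "x = 0")
    case True
    have "0 \<le> gam k" unfolding gam_def
      using cmph_integrable cmph_bounds by (intro Henstock_Kurzweil_Integration.integral_nonneg) (auto simp: absolutely_integrable_on_def)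
    thus ?thesis using True r0 rho0 by simp
  next
    case False
    hence x0: "0 < x" using x by simp
    have "(r \<longlongrightarrow> r 0) (at 0 within {0..1})" using rc unfolding continuous_on_def by auto
    hence "(r \<longlongrightarrow> 1) (at_right 0)" by (simp add: r0 at_within_Icc_at_right)
    hence "((\<lambda>e. norm (r x - r e)) \<longlongrightarrow> norm (r x - 1)) (at_right 0)" by (intro tendsto_intros)
    thus ?thesis
    proof (rule tendsto_upperbound)
      show "\<forall>\<^sub>F e in at_right 0. norm (r x - r e) \<le> rho * gam k"
        using eventually_at_right_real[OF x0] by eventually_elim (use re x x0 in auto)
    qed simp
  qed
  have "rho \<le> 1 + rho * gam k"
    using r1[OF xm] norm_triangle_ineq2[of "r xm" 1] unfolding rho_def by simp
  moreover have "rho * gam k \<le> rho * (1 / 4)" by (intro mult_left_mono g rho0)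
  ultimately have rho: "rho \<le> 4 / 3" and rg: "rho * gam k \<le> 1 / 3" by linarith+
  show 1: "norm (phi z x - F.phi0 k x) \<le> F.phi0 k x / 3" if x: "x \<in> {0<..1}" for x
  proof -
    have xx: "x \<in> {0..1}" using x by auto
    have p: "F.phi0 k x > 0" using F.phi0_pos[OF x] .
    have "phi z x - F.phi0 k x = (r x - 1) * complex_of_real (F.phi0 k x)"
      unfolding phi_r[OF xx] by (simp add: algebra_simps)
    also have "norm \<dots> = norm (r x - 1) * F.phi0 k x" using p by (simp add: norm_mult)
    also have "\<dots> \<le> 1 / 3 * F.phi0 k x" using r1[OF xx] rg p by (intro mult_right_mono) auto
    finally show ?thesis by simp
  qed
  have p1: "F.phi0 k 1 > 0" using F.phi0_pos by simp
  have np: "norm (phi z 1) \<ge> 2 / 3 * F.phi0 k 1"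
    using 1[of 1] norm_triangle_ineq2[of "complex_of_real (F.phi0 k 1)" "phi z 1"] p1 by (simp add: norm_minus_commute)
  hence nz: "phi z 1 \<noteq> 0" using p1 by auto
  have f1: "F.phi1 z 1 = complex_of_real (F.m0 k * F.phi0 k 1)" unfolding z_def by (rule F.phi1_at_1)
  have "phi1 z 1 / phi z 1 - F.m0 k = Om 1 / (phi z 1 * complex_of_real (F.phi0 k 1))"
    unfolding Om_def f1 using Fphi[of 1] nz p1 by (simp add: field_simps)
  also have "norm \<dots> \<le> (rho * cmpG k 1) / (2 / 3 * F.phi0 k 1 * F.phi0 k 1)"
    unfolding norm_divide norm_mult using Om_bound[of 1] np p1 order_trans[OF norm_ge_zero Om_bound[of 1]]
    by (intro frac_le mult_mono) auto
  also have "\<dots> = rho * cmph k 1 * (3 / 2)"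
    unfolding cmph_eq by (simp add: power2_eq_square)
  also have "\<dots> \<le> 4 / 3 * q_norm * (3 / 2)"
    using cmph_bounds[of 1 k] rho rho0 by (intro mult_right_mono mult_mono) auto
  finally show "norm (phi1 z 1 / phi z 1 - F.m0 k) \<le> 2 * q_norm" by simp
qed

text \<open>Symmetry under conjugation makes phi real at -k^2, so \<open>comparison\<close> confines
  it between 2/3 and 4/3 of the free solution, in particular to positive values. The free constants
  are written with their global names because \<open>F\<close> is local to this block.\<close>

lemma negative_axis:
  obtains K where
    "\<And>k x. k \<ge> K \<Longrightarrow> x \<in> {0<..1} \<Longrightarrow> \<exists>p. phi (radial_free.nz k) x = complex_of_real p \<and>
       2 / 3 * radial_free.phi0 l k x \<le> p \<and> p \<le> 4 / 3 * radial_free.phi0 l k x"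
    "\<And>k. k \<ge> K \<Longrightarrow> norm (phi1 (radial_free.nz k) 1 / phi (radial_free.nz k) 1 - radial_free.m0 l k) \<le> 2 * q_norm"
proof -
  have "\<forall>\<^sub>F k in at_top. gam k < 1 / 4" using gam_tendsto by (rule order_tendstoD(2)) simp
  then obtain K where K: "\<And>k. k \<ge> K \<Longrightarrow> gam k < 1 / 4" unfolding eventually_at_top_linorder by blast
  show ?thesis
  proof
    fix k assume k: "k \<ge> K"
    hence g: "gam k \<le> 1 / 4" using K[of k] by simp
    show "norm (phi1 (radial_free.nz k) 1 / phi (radial_free.nz k) 1 - radial_free.m0 l k) \<le> 2 * q_norm"
      by (rule comparison(2)[OF g])
    fix x :: real assume x: "x \<in> {0<..1}"
    have c: "cnj (F.nz k) = F.nz k" unfolding F.nz_def by simp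
    have "Im (phi (F.nz k) x) = Im (cnj (phi (F.nz k) x))" using phi_cnj(1)[of x "F.nz k"] x unfolding c by simp
    hence im: "phi (F.nz k) x = complex_of_real (Re (phi (F.nz k) x))" by (simp add: complex_eq_iff)
    have "norm (complex_of_real (Re (phi (F.nz k) x)) - F.phi0 k x) \<le> F.phi0 k x / 3"
      using comparison(1)[OF g x] unfolding im[symmetric] .
    hence "\<bar>Re (phi (F.nz k) x) - F.phi0 k x\<bar> \<le> F.phi0 k x / 3" by (simp only: of_real_diff[symmetric] norm_of_real)
    moreover have "2 / 3 * a \<le> p \<and> p \<le> 4 / 3 * a" if "\<bar>p - a\<bar> \<le> a / 3" for a p :: real
      using that by linarith
    ultimately show "\<exists>p. phi (radial_free.nz k) x = complex_of_real p \<and>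
       2 / 3 * radial_free.phi0 l k x \<le> p \<and> p \<le> 4 / 3 * radial_free.phi0 l k x"
      using im by blast
  qed
qed

end

subsection \<open>Functions with vanishing interval integrals\<close>

text \<open>The rays [a, infinity) form a generator of the Borel sets that is stable under
  intersection, so the integral of f vanishes on every Borel set. A Lebesgue set differs from a
  Borel set by a null set, and f has density 0.\<close>

lemma AE_zero_if_tail_integrals_zero:
  fixes f :: "real \<Rightarrow> complex"
  assumes f: "f absolutely_integrable_on {0..1}" and z: "\<And>a. 0 < a \<Longrightarrow> a \<le> 1 \<Longrightarrow> integral {a..1} f = 0"
  shows "AE x in M01. f x = 0"
proof -
  have fi: "f integrable_on {0..1}" using f unfolding absolutely_integrable_on_def by blast
  \<comment> \<open>The hypothesis starts at a > 0; continuity of the indefinite integral adds a =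
    0.\<close>
  have z0: "integral {0..1} f = 0"
  proof -
    have c: "continuous_on {0..1} (\<lambda>x. integral {0..x} f)"
      by (rule indefinite_integral_continuous_1[OF fi])
    have eq: "integral {0..x} f = integral {0..1} f" if x: "x \<in> {0<..<1}" for x
    proof -
      have "integral {0..x} f + integral {x..1} f = integral {0..1} f"
        by (rule Henstock_Kurzweil_Integration.integral_combine[OF _ _ fi]) (use x in auto)
      moreover have "integral {x..1} f = 0" by (rule z) (use x in auto)
      ultimately show ?thesis by (simp only: add_0_right)
    qed
    have ev: "\<forall>\<^sub>F x in at_right 0. integral {0..x} f = integral {0..1} f"
      using eventually_at_right_real[OF zero_less_one] by eventually_elim (rule eq)
    have "((\<lambda>x. integral {0..x} f) \<longlongrightarrow> integral {0..0} f) (at 0 within {0..1})"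
      using c unfolding continuous_on_def by (rule bspec) simp
    hence "((\<lambda>x. integral {0..x} f) \<longlongrightarrow> 0) (at_right 0)" by (simp add: at_within_Icc_at_right)
    from Lim_transform_eventually[OF this ev]
    have "((\<lambda>x::real. integral {0..1} f) \<longlongrightarrow> 0) (at_right 0)" .
    thus ?thesis by (simp add: tendsto_const_iff)
  qed
  define F where "F x = (if x \<in> {0..1} then f x else 0)" for x
  have F: "integrable lebesgue F"
  proof -
    have "F = (\<lambda>x. indicat_real {0..1} x *\<^sub>R f x)" unfolding F_def by auto
    thus ?thesis using f unfolding set_integrable_def by simp
  qed
  have Fs: "set_integrable lebesgue A F" if "A \<in> sets lebesgue" for A
    unfolding set_integrable_def by (rule integrable_mult_indicator[OF that F])
  have bl: "A \<in> sets lebesgue" if "A \<in> sets borel" for A :: "real set" using that by simp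
  have tail: "(LINT x:{a..}|lebesgue. F x) = 0" for a
  proof -
    have "(LINT x:{a..}|lebesgue. F x) = integral {a..} F"
      by (rule set_lebesgue_integral_eq_integral(2)[OF Fs[OF bl]]) simp
    also have "\<dots> = integral ({a..} \<inter> {0..1}) f" unfolding F_def by (subst Henstock_Kurzweil_Integration.integral_restrict_Int) (simp only: Int_commute)
    also have "{a..} \<inter> {0..1} = {max a 0..1}" by auto
    also have "integral {max a 0..1} f = 0"
      using z[of a] z0 by (cases "a \<le> 0"; cases "a \<le> 1") auto
    finally show ?thesis .
  qed
  have whole: "(LINT x|lebesgue. F x) = 0"
  proof -
    have "(LINT x:{0..}|lebesgue. F x) = (LINT x|lebesgue. F x)"
      unfolding set_lebesgue_integral_def by (intro Bochner_Integration.integral_cong) (auto simp: F_def)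
    thus ?thesis using tail[of 0] by simp
  qed
  have bor: "(LINT x:A|lebesgue. F x) = 0" if "A \<in> sets borel" for A
  proof -
    have mem: "A \<in> sigma_sets UNIV (range (\<lambda>a::real. {a..}))"
      using that unfolding borel_Ici by simp
    have stable: "Int_stable (range (\<lambda>a::real. {a..}))"
    proof (rule Int_stableI)
      fix A B :: "real set" assume "A \<in> range (\<lambda>a. {a..})" "B \<in> range (\<lambda>a. {a..})"
      then obtain a b where "A = {a..}" "B = {b..}" by auto
      hence "A \<inter> B = {max a b..}" by auto
      thus "A \<inter> B \<in> range (\<lambda>a. {a..})" by blast
    qed
    have sub: "range (\<lambda>a::real. {a..}) \<subseteq> Pow UNIV" by simp
    from stable sub mem show ?thesis
    proof (induction A rule: sigma_sets_induct_disjoint)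
      case (basic A)
      thus ?case using tail by auto
    next
      case empty
      show ?case by (simp add: set_lebesgue_integral_def)
    next
      case (compl A)
      have A: "A \<in> sets lebesgue" by (rule bl) (use compl(1) in \<open>simp add: borel_Ici\<close>)
      have "(LINT x:UNIV - A|lebesgue. F x) + (LINT x:A|lebesgue. F x) = (LINT x:(UNIV - A) \<union> A|lebesgue. F x)"
        using A by (intro set_integral_Un[symmetric] Fs) auto
      also have "\<dots> = 0" using whole by (simp add: set_lebesgue_integral_def)
      finally show ?case using compl by simp
    next
      case (union A)
      have A: "A i \<in> sets lebesgue" for i by (rule bl) (use union(2) in \<open>auto simp: borel_Ici\<close>)
      have "(LINT x:(\<Union>i. A i)|lebesgue. F x) = (\<Sum>i. (LINT x:(A i)|lebesgue. F x))"
      proof (rule lebesgue_integral_countable_add[OF A])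
        show "A i \<inter> A j = {}" if "i \<noteq> j" for i j using union(1) that by (auto simp: disjoint_family_on_def)
        show "set_integrable lebesgue (\<Union>i. A i) F" using A by (intro Fs) auto
      qed
      thus ?case using union(3) by simp
    qed
  qed
  have fin: "finite_measure M01" by (intro finite_measureI) simp
  show ?thesis
  proof (rule sigma_finite_measure.density_zero[OF finite_measure.axioms(1)[OF fin]])
    show "integrable M01 f" using f by (simp add: integrable_M01_iff)
    fix A assume "A \<in> sets M01"
    hence A: "A \<in> sets lebesgue" "A \<subseteq> {0<..<1}" by (auto simp: sets_restrict_space)
    obtain B N where B: "B \<in> sets borel" "negligible N" "B \<union> N = A" using sets_lebesgue_almost_borel[OF A(1)] by blast
    have "(LINT x:A|M01. f x) = (LINT x|lebesgue. indicat_real {0<..<1} x *\<^sub>R (indicat_real A x *\<^sub>R f x))"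
      unfolding set_lebesgue_integral_def by (rule integral_restrict_space) simp
    also have "\<dots> = (LINT x:A|lebesgue. F x)"
      unfolding set_lebesgue_integral_def
      by (rule Bochner_Integration.integral_cong) (use A(2) in \<open>auto simp: F_def indicator_def\<close>)
    also have "\<dots> = integral A F" by (rule set_lebesgue_integral_eq_integral(2)[OF Fs[OF A(1)]])
    also have "\<dots> = integral B F"
      by (rule integral_spike_set; rule negligible_subset[OF B(2)]) (use B(3) in auto)
    also have "\<dots> = (LINT x:B|lebesgue. F x)" by (rule set_lebesgue_integral_eq_integral(2)[OF Fs[OF bl[OF B(1)]], symmetric])
    finally show "(LINT x:A|M01. f x) = 0" using bor[OF B(1)] by simp
  qed
qed

subsection \<open>Growth of the solutions with initial data at the right endpoint\<close>

lemma norm_sin_cos_le: "norm (sin (z :: complex)) \<le> exp \<bar>Im z\<bar>" "norm (cos z) \<le> exp \<bar>Im z\<bar>"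
proof -
  have e: "norm (exp (\<i> * z)) \<le> exp \<bar>Im z\<bar>" "norm (exp (- (\<i> * z))) \<le> exp \<bar>Im z\<bar>" by (simp_all add: norm_exp_eq_Re)
  have "norm (exp (\<i> * z) - exp (- (\<i> * z))) \<le> 2 * exp \<bar>Im z\<bar>"
    using norm_triangle_ineq4[of "exp (\<i> * z)" "exp (- (\<i> * z))"] e by linarith
  thus "norm (sin z) \<le> exp \<bar>Im z\<bar>" unfolding sin_exp_eq by (simp add: norm_divide norm_mult)
  have "norm (exp (\<i> * z) + exp (- (\<i> * z))) \<le> 2 * exp \<bar>Im z\<bar>"
    using norm_triangle_ineq[of "exp (\<i> * z)" "exp (- (\<i> * z))"] e by linarith
  thus "norm (cos z) \<le> exp \<bar>Im z\<bar>" unfolding cos_exp_eq by (simp add: norm_divide)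
qed

context radial
begin

text \<open>Variation of constants against -u'' = k^2 u. The whole of V, including l(l+1)/x^2, is
  the perturbation, which is possible because [x, 1] stays away from 0.\<close>

lemma chi_sin_equation:
  assumes x: "0 < x" "x \<le> 1" and k: "k \<noteq> 0"
  shows "chi c0 c1 (k\<^sup>2) x = c0 * cos (k * complex_of_real (1 - x)) - c1 * (sin (k * complex_of_real (1 - x)) / k) +
      integral {x..1} (\<lambda>y. complex_of_real (V y) * chi c0 c1 (k\<^sup>2) y * (sin (k * complex_of_real (y - x)) / k))"
    and "(\<lambda>y. complex_of_real (V y) * chi c0 c1 (k\<^sup>2) y * (sin (k * complex_of_real (y - x)) / k)) integrable_on {x..1}"
proof -
  define u u1 where "u = chi c0 c1 (k\<^sup>2)" and "u1 = chi1 c0 c1 (k\<^sup>2)"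
  define s where "s y = sin (k * complex_of_real (y - x)) / k" for y
  define c where "c y = cos (k * complex_of_real (y - x))" for y
  have U: "ac_on u u1 x 1" "ac_on u1 (\<lambda>y. (complex_of_real (V y) - k\<^sup>2) * u y) x 1"
    using has_loc_ac_derivD[OF solvesD(1)[OF chi_solves] x(1)] has_loc_ac_derivD[OF solvesD(2)[OF chi_solves] x(1)]
    unfolding u_def u1_def by auto
  have s: "ac_on s c x 1"
  proof (rule ac_on_C1)
    show "(s has_vector_derivative c y) (at y within {x..1})" for y
    proof -
      have "((\<lambda>w. sin (k * (w - complex_of_real x)) / k) has_field_derivative cos (k * (complex_of_real y - complex_of_real x))) (at (complex_of_real y))"
        using k by (auto intro!: derivative_eq_intros)
      from has_vector_derivative_real_field[OF this] show ?thesis unfolding s_def c_def by simp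
    qed
    show "continuous_on {x..1} c" unfolding c_def by (intro continuous_intros)
  qed
  have c: "ac_on c (\<lambda>y. - (k\<^sup>2 * s y)) x 1"
  proof (rule ac_on_C1)
    show "(c has_vector_derivative - (k\<^sup>2 * s y)) (at y within {x..1})" for y
    proof -
      have "((\<lambda>w. cos (k * (w - complex_of_real x))) has_field_derivative - (k\<^sup>2 * (sin (k * (complex_of_real y - complex_of_real x)) / k))) (at (complex_of_real y))"
        using k by (auto intro!: derivative_eq_intros simp: power2_eq_square)
      from has_vector_derivative_real_field[OF this] show ?thesis unfolding s_def c_def by simp
    qed
    show "continuous_on {x..1} (\<lambda>y. - (k\<^sup>2 * s y))" unfolding s_def using k by (intro continuous_intros) auto
  qed
  have "ac_on (\<lambda>y. u1 y * s y - u y * c y)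
     (\<lambda>y. ((complex_of_real (V y) - k\<^sup>2) * u y * s y + u1 y * c y) - (u1 y * c y + u y * (- (k\<^sup>2 * s y)))) x 1"
    by (intro ac_on_diff ac_on_mult U s c)
  hence ac: "ac_on (\<lambda>y. u1 y * s y - u y * c y) (\<lambda>y. complex_of_real (V y) * u y * s y) x 1"
    by (rule ac_on_cong) (auto simp: algebra_simps)
  have hi: "((\<lambda>y. complex_of_real (V y) * u y * s y) has_integral ((u1 1 * s 1 - u 1 * c 1) - (u1 x * s x - u x * c x))) {x..1}"
    by (rule ac_on_has_integral[OF ac]) (use x in auto)
  have v: "s x = 0" "c x = 1" "u 1 = c0" "u1 1 = c1" unfolding s_def c_def u_def u1_def by auto
  have "integral {x..1} (\<lambda>y. complex_of_real (V y) * u y * s y) = c1 * s 1 - c0 * c 1 + u x"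
    using hi v by (simp add: has_integral_iff)
  hence "u x = c0 * c 1 - c1 * s 1 + integral {x..1} (\<lambda>y. complex_of_real (V y) * u y * s y)" by simp
  thus "chi c0 c1 (k\<^sup>2) x = c0 * cos (k * complex_of_real (1 - x)) - c1 * (sin (k * complex_of_real (1 - x)) / k) +
      integral {x..1} (\<lambda>y. complex_of_real (V y) * chi c0 c1 (k\<^sup>2) y * (sin (k * complex_of_real (y - x)) / k))"
    unfolding u_def s_def c_def .
  show "(\<lambda>y. complex_of_real (V y) * chi c0 c1 (k\<^sup>2) y * (sin (k * complex_of_real (y - x)) / k)) integrable_on {x..1}"
    using has_integral_integrable[OF hi] unfolding u_def s_def .
qed

text \<open>Let M be the maximum of |u| after division by exp(|Im k| (1 - x)). The exponentials in
  the integral equation combine exactly, which leaves M <= C + M N / |k| and so M <= 2 C for large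
  |k|, whatever the data are.\<close>

lemma chi_growth:
  assumes a: "a \<in> {0<..<1}"
  obtains R where "R > 0"
    "\<And>k c0 c1 x. norm k \<ge> R \<Longrightarrow> x \<in> {a..1} \<Longrightarrow>
       norm (chi c0 c1 (k\<^sup>2) x) \<le> 2 * (norm c0 + norm c1 / norm k) * exp (\<bar>Im k\<bar> * (1 - x))"
proof -
  have Vi: "(\<lambda>y. \<bar>V y\<bar>) integrable_on {x..1}" if "a \<le> x" for x
    using V_integrable[of x] a that by (auto simp: absolutely_integrable_on_def)
  define N where "N = integral {a..1} (\<lambda>y. \<bar>V y\<bar>)"
  have N0: "N \<ge> 0" unfolding N_def by (intro Henstock_Kurzweil_Integration.integral_nonneg Vi) auto
  show ?thesis
  proof
    \<comment> \<open>|k| >= 2 N + 1 makes N / |k| <= 1/2 and also keeps k away from 0 when N =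
      0.\<close>
    show "2 * N + 1 > 0" using N0 by simp
    fix k c0 c1 :: complex and x :: real
    assume k: "norm k \<ge> 2 * N + 1" and x: "x \<in> {a..1}"
    have k0: "norm k > 0" "k \<noteq> 0" using k N0 by auto
    define u where "u = chi c0 c1 (k\<^sup>2)"
    define e where "e y = exp (\<bar>Im k\<bar> * (1 - y))" for y
    define C where "C = norm c0 + norm c1 / norm k"
    have e0: "e y > 0" for y unfolding e_def by simp
    have "continuous_on {a..1} u"
      unfolding u_def by (rule continuous_on_subset[OF chi_continuous]) (use a in auto)
    hence "continuous_on {a..1} (\<lambda>y. norm (u y) / e y)"
      unfolding e_def by (intro continuous_intros) auto
    then obtain xm where xm: "xm \<in> {a..1}" and max: "\<And>y. y \<in> {a..1} \<Longrightarrow> norm (u y) / e y \<le> norm (u xm) / e xm"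
      using continuous_attains_sup[of "{a..1}" "\<lambda>y. norm (u y) / e y"] a by auto
    define M where "M = norm (u xm) / e xm"
    have M0: "M \<ge> 0" unfolding M_def using e0[of xm] by simp
    have uM: "norm (u y) \<le> M * e y" if "y \<in> {a..1}" for y
      using max[OF that] e0[of y] unfolding M_def[symmetric] by (simp add: divide_le_eq)
    have sb: "norm (sin (k * complex_of_real t)) \<le> exp (\<bar>Im k\<bar> * t)" "norm (cos (k * complex_of_real t)) \<le> exp (\<bar>Im k\<bar> * t)"
      if "t \<ge> 0" for t
      using norm_sin_cos_le[of "k * complex_of_real t"] that by (auto simp: abs_mult)
    have bd: "norm (u y) \<le> (C + M * N / norm k) * e y" if y: "y \<in> {a..1}" for y
    proof -
      define I where "I = integral {y..1} (\<lambda>t. complex_of_real (V t) * u t * (sin (k * complex_of_real (t - y)) / k))"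
      have y0: "0 < y" "y \<le> 1" using y a by auto
      have "norm I \<le> (M * e y / norm k) * integral {y..1} (\<lambda>t. \<bar>V t\<bar>)"
        unfolding I_def
      proof (rule integral_abs_le_const)
        show "(\<lambda>t. complex_of_real (V t) * u t * (sin (k * complex_of_real (t - y)) / k)) integrable_on {y..1}"
          unfolding u_def by (rule chi_sin_equation(2)[OF y0 k0(2)])
        show "(\<lambda>t. \<bar>V t\<bar>) integrable_on {y..1}" using Vi y by auto
        fix t assume t: "t \<in> {y..1}"
        have "norm (complex_of_real (V t) * u t * (sin (k * complex_of_real (t - y)) / k)) =
           \<bar>V t\<bar> * (norm (u t) * norm (sin (k * complex_of_real (t - y)))) / norm k"
          by (simp add: norm_mult norm_divide)
        also have "\<dots> \<le> \<bar>V t\<bar> * ((M * e t) * exp (\<bar>Im k\<bar> * (t - y))) / norm k"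
          using t y e0[of t] M0
          by (intro divide_right_mono mult_left_mono mult_mono uM sb) auto
        also have "e t * exp (\<bar>Im k\<bar> * (t - y)) = e y"
          unfolding e_def by (simp add: exp_add[symmetric] algebra_simps)
        hence "\<bar>V t\<bar> * ((M * e t) * exp (\<bar>Im k\<bar> * (t - y))) / norm k = M * e y / norm k * \<bar>V t\<bar>"
          by (simp add: mult_ac)
        finally show "norm (complex_of_real (V t) * u t * (sin (k * complex_of_real (t - y)) / k)) \<le> M * e y / norm k * \<bar>V t\<bar>" .
      qed
      also have "\<dots> \<le> (M * e y / norm k) * N"
      proof (rule mult_left_mono)
        show "integral {y..1} (\<lambda>t. \<bar>V t\<bar>) \<le> N" unfolding N_def using y by (intro integral_subset_le Vi) auto
      qed (use M0 e0[of y] in auto)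
      finally have I: "norm I \<le> M * N / norm k * e y" by (simp add: mult_ac)
      have "u y = c0 * cos (k * complex_of_real (1 - y)) - c1 * (sin (k * complex_of_real (1 - y)) / k) + I"
        unfolding I_def u_def by (rule chi_sin_equation(1)[OF y0 k0(2)])
      hence "norm (u y) \<le> norm (c0 * cos (k * complex_of_real (1 - y))) + norm (c1 * (sin (k * complex_of_real (1 - y)) / k)) + norm I"
        by (metis (no_types, lifting) norm_triangle_ineq norm_triangle_ineq4 add_right_mono order_trans)
      also have "norm (c0 * cos (k * complex_of_real (1 - y))) \<le> norm c0 * e y"
        unfolding norm_mult e_def using y0 by (intro mult_left_mono sb) auto
      also have "norm (c1 * (sin (k * complex_of_real (1 - y)) / k)) \<le> norm c1 * (e y / norm k)"
        unfolding norm_mult norm_divide e_def using y0 k0 by (intro mult_left_mono divide_right_mono sb) auto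
      also note I
      finally show ?thesis unfolding C_def by (simp add: algebra_simps)
    qed
    have "M \<le> C + M * N / norm k" unfolding M_def using bd[OF xm] e0[of xm] by (simp add: divide_le_eq M_def)
    moreover have "M * N / norm k \<le> M * (1 / 2)"
    proof -
      have "N / norm k \<le> 1 / 2" using k N0 k0 by (simp add: field_simps)
      thus ?thesis using M0 mult_left_mono[of "N / norm k" "1 / 2" M] by simp
    qed
    ultimately have "M \<le> 2 * C" by linarith
    hence "M * e x \<le> 2 * C * e x" using e0[of x] by (intro mult_right_mono) auto
    thus "norm (chi c0 c1 (k\<^sup>2) x) \<le> 2 * (norm c0 + norm c1 / norm k) * exp (\<bar>Im k\<bar> * (1 - x))"
      using uM[OF x] unfolding u_def e_def C_def by linarith
  qed
qed

end

subsection \<open>The uniqueness theorem\<close>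

lemma zero_if_subintervals_zero:
  fixes f :: "real \<Rightarrow> complex"
  assumes "continuous_on {a..b} f" "a < b" "\<And>x. x \<in> {a..b} \<Longrightarrow> integral {a..x} f = 0" "x \<in> {a..b}"
  shows "f x = 0"
proof (rule vector_derivative_unique_within_closed_interval[OF assms(2), of x "\<lambda>u. integral {a..u} f"])
  show "((\<lambda>u. integral {a..u} f) has_vector_derivative f x) (at x within cbox a b)"
    using integral_has_vector_derivative[OF assms(1,4)] by simp
  have "((\<lambda>u. 0) has_vector_derivative 0) (at x within cbox a b)" by simp
  thus "((\<lambda>u. integral {a..u} f) has_vector_derivative 0) (at x within cbox a b)"
    by (rule has_vector_derivative_transform[rotated 2]) (use assms in auto)
qed (use assms in auto)

context radial
begin

lemma chi_wronskian:
  assumes "x \<in> {0<..1}"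
  shows "chi 1 0 z x * chi1 0 1 z x - chi1 1 0 z x * chi 0 1 z x = 1"
  using solves_wronskian_const[OF chi_solves chi_solves assms, of 1 0 z 0 1] by (simp add: algebra_simps)

lemma phi_expansion:
  assumes "x \<in> {0<..1}"
  shows "phi z x = phi z 1 * chi 1 0 z x + phi1 z 1 * chi 0 1 z x"
proof -
  have 1: "phi z x * chi1 1 0 z x - phi1 z x * chi 1 0 z x = - phi1 z 1"
    using phi_chi_wronskian[OF assms, of z 1 0] by (simp add: bform_def)
  have 2: "phi z x * chi1 0 1 z x - phi1 z x * chi 0 1 z x = phi z 1"
    using phi_chi_wronskian[OF assms, of z 0 1] by (simp add: bform_def)
  have "phi z 1 * chi 1 0 z x + phi1 z 1 * chi 0 1 z x =
     (phi z x * chi1 0 1 z x - phi1 z x * chi 0 1 z x) * chi 1 0 z x - (phi z x * chi1 1 0 z x - phi1 z x * chi 1 0 z x) * chi 0 1 z x"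
    unfolding 1 2 by simp
  also have "\<dots> = phi z x * (chi 1 0 z x * chi1 0 1 z x - chi1 1 0 z x * chi 0 1 z x)" by (simp add: algebra_simps)
  finally show ?thesis unfolding chi_wronskian[OF assms] by simp
qed

lemma chi_over_phi_has_integral:
  assumes "0 < x" "x \<le> y" "y \<le> 1" "\<And>t. t \<in> {x..y} \<Longrightarrow> phi z t \<noteq> 0"
  shows "((\<lambda>t. phi z 1 / (phi z t)\<^sup>2) has_integral (chi 0 1 z y / phi z y - chi 0 1 z x / phi z x)) {x..y}"
  using solves_quotient_has_integral[OF chi_solves[of z 0 1] phi_solves[of z] assms] by simp

lemma phi_negative_axis:
  obtains K where "\<And>k x. k \<ge> K \<Longrightarrow> x \<in> {0<..1} \<Longrightarrow> \<exists>p. phi (radial_free.nz k) x = complex_of_real p \<and>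
       2 / 3 * radial_free.phi0 l k x \<le> p \<and> p \<le> 4 / 3 * radial_free.phi0 l k x"
  by (rule negative_axis, erule that)

text \<open>As s(1) = 0, the quotient s / phi at x is minus phi(1) times the integral of phi^-2 over
  [x, 1], and phi0 is increasing. The two bounds are reciprocal up to constants: their product is 8,
  independent of k.\<close>

lemma chi_negative_axis_bound:
  assumes x: "x \<in> {0<..1}"
    and p: "\<And>x. x \<in> {0<..1} \<Longrightarrow> \<exists>p. phi (radial_free.nz k) x = complex_of_real p \<and>
       2 / 3 * radial_free.phi0 l k x \<le> p \<and> p \<le> 4 / 3 * radial_free.phi0 l k x"
  shows "norm (chi 0 1 (radial_free.nz k) x) \<le> 4 * radial_free.phi0 l k 1 / radial_free.phi0 l k x"
    and "norm (phi (radial_free.nz k) x / phi (radial_free.nz k) 1) \<le> 2 * (radial_free.phi0 l k x / radial_free.phi0 l k 1)"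
proof -
  interpret F: radial_free l by unfold_locales (rule l)
  define z where "z = F.nz k"
  have pos: "F.phi0 k t > 0" if "t \<in> {0<..1}" for t using F.phi0_pos[OF that] .
  have up: "norm (phi z t) \<le> 4 / 3 * F.phi0 k t" and lo: "2 / 3 * F.phi0 k t \<le> norm (phi z t)" if t: "t \<in> {0<..1}" for t
  proof -
    obtain p where "phi z t = complex_of_real p" "2 / 3 * F.phi0 k t \<le> p" "p \<le> 4 / 3 * F.phi0 k t"
      using p[OF t] unfolding z_def by blast
    thus "norm (phi z t) \<le> 4 / 3 * F.phi0 k t" "2 / 3 * F.phi0 k t \<le> norm (phi z t)" using pos[OF t] by auto
  qed
  have nz: "phi z t \<noteq> 0" if "t \<in> {0<..1}" for t using lo[OF that] pos[OF that] by auto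
  have one: "(1::real) \<in> {0<..1}" by simp
  have hi: "((\<lambda>t. phi z 1 / (phi z t)\<^sup>2) has_integral (chi 0 1 z 1 / phi z 1 - chi 0 1 z x / phi z x)) {x..1}"
    by (rule chi_over_phi_has_integral) (use x nz in auto)
  \<comment> \<open>3 = (4/3) / (2/3)^2; a further factor 4/3 from phi(x) yields the 4 of the
    statement.\<close>
  define c where "c = 3 * F.phi0 k 1 / (F.phi0 k x)\<^sup>2"
  have "norm (integral {x..1} (\<lambda>t. phi z 1 / (phi z t)\<^sup>2)) \<le> c * integral {x..1} (\<lambda>_. 1)"
  proof (rule integral_abs_le_const[OF has_integral_integrable[OF hi]])
    fix t assume t: "t \<in> {x..1}"
    hence t1: "t \<in> {0<..1}" using x by auto
    have "2 / 3 * F.phi0 k x \<le> norm (phi z t)" using lo[OF t1] F.phi0_mono[of x t k] t x by auto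
    hence "(2 / 3 * F.phi0 k x)\<^sup>2 \<le> (norm (phi z t))\<^sup>2" using pos[OF x] by (intro power_mono) auto
    hence "norm (phi z 1) / (norm (phi z t))\<^sup>2 \<le> (4 / 3 * F.phi0 k 1) / (2 / 3 * F.phi0 k x)\<^sup>2"
      using up[OF one] pos[OF x] pos[OF one] by (intro frac_le) auto
    also have "\<dots> = c" unfolding c_def by (simp add: power_mult_distrib power2_eq_square)
    finally show "norm (phi z 1 / (phi z t)\<^sup>2) \<le> c * 1" by (simp add: norm_divide norm_power)
  qed auto
  also have "\<dots> \<le> c * 1" using x pos[OF one] by (intro mult_left_mono) (auto simp: c_def)
  finally have "norm (chi 0 1 z x / phi z x) \<le> c" using hi by (simp add: has_integral_iff)
  moreover have "norm (chi 0 1 z x) = norm (chi 0 1 z x / phi z x) * norm (phi z x)" using nz[OF x] by (simp add: norm_divide)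
  ultimately have "norm (chi 0 1 z x) \<le> c * (4 / 3 * F.phi0 k x)"
    using up[OF x] pos[OF one] pos[OF x] by (simp only:) (intro mult_mono, auto simp: c_def)
  also have "\<dots> = 4 * F.phi0 k 1 / F.phi0 k x" unfolding c_def using pos[OF x] by (simp add: power2_eq_square)
  finally show "norm (chi 0 1 (radial_free.nz k) x) \<le> 4 * radial_free.phi0 l k 1 / radial_free.phi0 l k x" unfolding z_def .
  have "norm (phi z x / phi z 1) \<le> (4 / 3 * F.phi0 k x) / (2 / 3 * F.phi0 k 1)"
    unfolding norm_divide using up[OF x] lo[OF one] pos[OF one] pos[OF x] by (intro frac_le) auto
  thus "norm (phi (radial_free.nz k) x / phi (radial_free.nz k) 1) \<le> 2 * (radial_free.phi0 l k x / radial_free.phi0 l k 1)"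
    unfolding z_def by simp
qed

end

section \<open>Two potentials with the same spectra\<close>

locale radial_pair = A: radial l q + B: radial l q2 for l q q2
begin

text \<open>Along z = -k^2 both functions m stay within a bounded distance of the same
  \<open>m0\<close>, which tends to infinity, so their quotient tends to 1. The multiplied-out form
  holds at the poles as well.\<close>

lemma weyl_functions_equal:
  assumes d: "\<And>z. A.phi z 1 = 0 \<longleftrightarrow> B.phi z 1 = 0" and n: "\<And>z. A.phi1 z 1 = 0 \<longleftrightarrow> B.phi1 z 1 = 0"
  shows "A.phi1 z 1 * B.phi z 1 = B.phi1 z 1 * A.phi z 1"
proof -
  interpret F: radial_free l by unfold_locales (rule A.l)
  obtain KA where KA: "\<And>k x. k \<ge> KA \<Longrightarrow> x \<in> {0<..1} \<Longrightarrow> \<exists>p. A.phi (F.nz k) x = complex_of_real p \<and>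
       2 / 3 * F.phi0 k x \<le> p \<and> p \<le> 4 / 3 * F.phi0 k x"
    "\<And>k. k \<ge> KA \<Longrightarrow> norm (A.phi1 (F.nz k) 1 / A.phi (F.nz k) 1 - F.m0 k) \<le> 2 * A.q_norm"
    using A.negative_axis by blast
  obtain KB where KB: "\<And>k x. k \<ge> KB \<Longrightarrow> x \<in> {0<..1} \<Longrightarrow> \<exists>p. B.phi (F.nz k) x = complex_of_real p \<and>
       2 / 3 * F.phi0 k x \<le> p \<and> p \<le> 4 / 3 * F.phi0 k x"
    "\<And>k. k \<ge> KB \<Longrightarrow> norm (B.phi1 (F.nz k) 1 / B.phi (F.nz k) 1 - F.m0 k) \<le> 2 * B.q_norm"
    using B.negative_axis by blast
  have "\<forall>\<^sub>F k in at_top. F.m0 k \<ge> 2 * A.q_norm + 1" using F.m0_at_top unfolding filterlim_at_top by blast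
  then obtain KM where KM: "\<And>k. k \<ge> KM \<Longrightarrow> F.m0 k \<ge> 2 * A.q_norm + 1" unfolding eventually_at_top_linorder by blast
  define K where "K = max KA (max KB KM)"
  define k where "k n = K + real n" for n
  have kK: "k n \<ge> KA" "k n \<ge> KB" "k n \<ge> KM" for n unfolding k_def K_def by auto
  have klim: "filterlim k at_top sequentially"
    unfolding k_def by (intro filterlim_tendsto_add_at_top[OF tendsto_const] filterlim_real_sequentially)
  have m0lim: "filterlim (\<lambda>n. F.m0 (k n)) at_top sequentially"
    by (rule filterlim_compose[OF F.m0_at_top klim])
  have nzr: "complex_of_real (- (k n)\<^sup>2) = F.nz (k n)" for n unfolding F.nz_def ..
  have m0pos: "F.m0 (k n) \<ge> 1" for n using KM[OF kK(3)[of n]] A.q_norm_nonneg by simp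
  have dA: "A.phi (F.nz (k n)) 1 \<noteq> 0" for n
    using KA(1)[OF kK(1)[of n], of 1] F.phi0_pos[of 1 "k n"] by auto
  have nA: "A.phi1 (F.nz (k n)) 1 \<noteq> 0" for n
  proof
    assume "A.phi1 (F.nz (k n)) 1 = 0"
    hence "\<bar>F.m0 (k n)\<bar> \<le> 2 * A.q_norm" using KA(2)[OF kK(1)[of n]] by simp
    thus False using KM[OF kK(3)[of n]] A.q_norm_nonneg by simp
  qed
  have ratio: "(\<lambda>n. f n / complex_of_real (F.m0 (k n))) \<longlonglongrightarrow> 1"
    if "\<And>n. norm (f n - complex_of_real (F.m0 (k n))) \<le> c" for f :: "nat \<Rightarrow> complex" and c
  proof -
    have "(\<lambda>n. (f n - complex_of_real (F.m0 (k n))) / complex_of_real (F.m0 (k n))) \<longlonglongrightarrow> 0"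
    proof (rule Lim_null_comparison)
      show "\<forall>\<^sub>F n in sequentially. norm ((f n - complex_of_real (F.m0 (k n))) / complex_of_real (F.m0 (k n))) \<le> c / F.m0 (k n)"
      proof (rule always_eventually, rule allI)
        fix n
        show "norm ((f n - complex_of_real (F.m0 (k n))) / complex_of_real (F.m0 (k n))) \<le> c / F.m0 (k n)"
          unfolding norm_divide norm_of_real using that[of n] m0pos[of n] by (simp add: divide_right_mono)
      qed
      show "(\<lambda>n. c / F.m0 (k n)) \<longlonglongrightarrow> 0" by (rule tendsto_divide_0[OF tendsto_const filterlim_at_top_imp_at_infinity[OF m0lim]])
    qed
    hence "(\<lambda>n. 1 + (f n - complex_of_real (F.m0 (k n))) / complex_of_real (F.m0 (k n))) \<longlonglongrightarrow> 1 + 0"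
      by (intro tendsto_intros)
    moreover have "1 + (f n - complex_of_real (F.m0 (k n))) / complex_of_real (F.m0 (k n)) = f n / complex_of_real (F.m0 (k n))" for n
      using m0pos[of n] by (simp add: field_simps)
    ultimately show ?thesis by simp
  qed
  have limA: "(\<lambda>n. (A.phi1 (F.nz (k n)) 1 / A.phi (F.nz (k n)) 1) / complex_of_real (F.m0 (k n))) \<longlonglongrightarrow> 1"
    by (rule ratio) (rule KA(2)[OF kK(1)])
  have limB: "(\<lambda>n. (B.phi1 (F.nz (k n)) 1 / B.phi (F.nz (k n)) 1) / complex_of_real (F.m0 (k n))) \<longlonglongrightarrow> 1"
    by (rule ratio) (rule KB(2)[OF kK(2)])
  have lim: "(\<lambda>n. (A.phi1 (F.nz (k n)) 1 / A.phi (F.nz (k n)) 1) / (B.phi1 (F.nz (k n)) 1 / B.phi (F.nz (k n)) 1)) \<longlonglongrightarrow> 1"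
  proof -
    have e: "(a / complex_of_real (F.m0 (k n))) / (b / complex_of_real (F.m0 (k n))) = a / b" for a b n
      using m0pos[of n] by simp
    show ?thesis using tendsto_divide[OF limA limB] by (simp only: e div_by_1 one_neq_zero not_False_eq_True)
  qed
  have one: "(1::real) \<in> {0..1}" by simp
  show ?thesis
  proof (rule herglotz_quotients_equal[of "\<lambda>z. A.phi z 1" "\<lambda>z. A.phi1 z 1" "\<lambda>z. B.phi z 1" "\<lambda>z. B.phi1 z 1" "\<lambda>n. - (k n)\<^sup>2"])
    show "(\<lambda>n. (A.phi1 (complex_of_real (- (k n)\<^sup>2)) 1 / A.phi (complex_of_real (- (k n)\<^sup>2)) 1) /
       (B.phi1 (complex_of_real (- (k n)\<^sup>2)) 1 / B.phi (complex_of_real (- (k n)\<^sup>2)) 1)) \<longlonglongrightarrow> 1"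
      unfolding nzr by (rule lim)
    show "A.phi (complex_of_real (- (k n)\<^sup>2)) 1 \<noteq> 0" "A.phi1 (complex_of_real (- (k n)\<^sup>2)) 1 \<noteq> 0" for n
      unfolding nzr using dA nA by auto
  qed (rule A.phi_holomorphic[OF one] B.phi_holomorphic[OF one] A.phi_cnj[OF one] B.phi_cnj[OF one]
      A.phi_herglotz_neg B.phi_herglotz_neg d n A.phi_simple_zeros B.phi_simple_zeros; assumption)+
qed

definition D :: "real \<Rightarrow> complex \<Rightarrow> complex" where
  "D x z = A.chi 1 0 z x * B.chi 0 1 z x - B.chi 1 0 z x * A.chi 0 1 z x"

text \<open>Adding m s to c and m s2 to c2 with the same m leaves c s2 - c2 s unchanged, and c + m s
  = phi(x) / phi(1).\<close>

lemma D_eq: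
  assumes x: "x \<in> {0<..1}" and m: "A.phi1 z 1 * B.phi z 1 = B.phi1 z 1 * A.phi z 1"
    and nz: "A.phi z 1 \<noteq> 0" "B.phi z 1 \<noteq> 0"
  shows "D x z = A.phi z x / A.phi z 1 * B.chi 0 1 z x - B.phi z x / B.phi z 1 * A.chi 0 1 z x"
proof -
  define a where "a = A.phi1 z 1 / A.phi z 1"
  have a: "a = B.phi1 z 1 / B.phi z 1" unfolding a_def using m nz by (simp add: field_simps)
  have 1: "A.phi z x / A.phi z 1 = A.chi 1 0 z x + a * A.chi 0 1 z x"
    unfolding a_def A.phi_expansion[OF x, of z] using nz by (simp add: field_simps)
  have 2: "B.phi z x / B.phi z 1 = B.chi 1 0 z x + a * B.chi 0 1 z x"
    unfolding a B.phi_expansion[OF x, of z] using nz by (simp add: field_simps)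
  show ?thesis unfolding D_def 1 2 by (simp add: algebra_simps)
qed

lemma D_zero:
  assumes x: "x \<in> {0<..<1}" and m: "\<And>z. A.phi1 z 1 * B.phi z 1 = B.phi1 z 1 * A.phi z 1"
  shows "D x z = 0"
proof -
  interpret F: radial_free l by unfold_locales (rule A.l)
  have x1: "x \<in> {0<..1}" using x by auto
  obtain KA where KA: "\<And>k x. k \<ge> KA \<Longrightarrow> x \<in> {0<..1} \<Longrightarrow> \<exists>p. A.phi (F.nz k) x = complex_of_real p \<and>
       2 / 3 * F.phi0 k x \<le> p \<and> p \<le> 4 / 3 * F.phi0 k x"
    by (rule A.phi_negative_axis, erule that)
  obtain KB where KB: "\<And>k x. k \<ge> KB \<Longrightarrow> x \<in> {0<..1} \<Longrightarrow> \<exists>p. B.phi (F.nz k) x = complex_of_real p \<and>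
       2 / 3 * F.phi0 k x \<le> p \<and> p \<le> 4 / 3 * F.phi0 k x"
    by (rule B.phi_negative_axis, erule that)
  obtain RA where RA: "RA > 0" "\<And>k c0 c1 y. norm k \<ge> RA \<Longrightarrow> y \<in> {x..1} \<Longrightarrow>
       norm (A.chi c0 c1 (k\<^sup>2) y) \<le> 2 * (norm c0 + norm c1 / norm k) * exp (\<bar>Im k\<bar> * (1 - y))"
    by (rule A.chi_growth[OF x], erule that)
  obtain RB where RB: "RB > 0" "\<And>k c0 c1 y. norm k \<ge> RB \<Longrightarrow> y \<in> {x..1} \<Longrightarrow>
       norm (B.chi c0 c1 (k\<^sup>2) y) \<le> 2 * (norm c0 + norm c1 / norm k) * exp (\<bar>Im k\<bar> * (1 - y))"
    by (rule B.chi_growth[OF x], erule that)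
  define R where "R = max 1 (max (max RA RB) (max KA KB))"
  have R: "R \<ge> 1" "R \<ge> RA" "R \<ge> RB" "R \<ge> KA" "R \<ge> KB" unfolding R_def by auto
  \<comment> \<open>Each of the two products contributes 2 times 2/|k|. The factor 1/|k|, due to s
    and s2, gives the decay on the positive axis, where k is real.\<close>
  have Dk: "norm (D x (k\<^sup>2)) \<le> 8 / norm k * exp (2 * \<bar>Im k\<bar>)" if k: "norm k \<ge> R" for k
  proof -
    have k0: "norm k > 0" using k R by linarith
    define e where "e = exp (\<bar>Im k\<bar> * (1 - x))"
    have e: "e \<ge> 0" "e * e \<le> exp (2 * \<bar>Im k\<bar>)"
    proof -
      have "\<bar>Im k\<bar> * (1 - x) \<le> \<bar>Im k\<bar> * 1" by (rule mult_left_mono) (use x in auto)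
      hence "\<bar>Im k\<bar> * (1 - x) + \<bar>Im k\<bar> * (1 - x) \<le> 2 * \<bar>Im k\<bar>" by linarith
      hence "exp (\<bar>Im k\<bar> * (1 - x) + \<bar>Im k\<bar> * (1 - x)) \<le> exp (2 * \<bar>Im k\<bar>)" by (subst exp_le_cancel_iff)
      thus "e * e \<le> exp (2 * \<bar>Im k\<bar>)" by (simp only: e_def exp_add)
    qed (simp add: e_def)
    have xx: "x \<in> {x..1}" using x by auto
    have b: "norm (A.chi 1 0 (k\<^sup>2) x) \<le> 2 * e" "norm (B.chi 1 0 (k\<^sup>2) x) \<le> 2 * e"
      "norm (A.chi 0 1 (k\<^sup>2) x) \<le> 2 / norm k * e" "norm (B.chi 0 1 (k\<^sup>2) x) \<le> 2 / norm k * e"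
      using RA(2)[of k x 1 0, OF _ xx] RB(2)[of k x 1 0, OF _ xx] RA(2)[of k x 0 1, OF _ xx] RB(2)[of k x 0 1, OF _ xx] k R
      unfolding e_def by auto
    have "norm (D x (k\<^sup>2)) \<le> norm (A.chi 1 0 (k\<^sup>2) x) * norm (B.chi 0 1 (k\<^sup>2) x) + norm (B.chi 1 0 (k\<^sup>2) x) * norm (A.chi 0 1 (k\<^sup>2) x)"
      unfolding D_def norm_mult[symmetric] by (rule norm_triangle_ineq4)
    also have "\<dots> \<le> (2 * e) * (2 / norm k * e) + (2 * e) * (2 / norm k * e)"
      using b e(1) by (intro add_mono mult_mono) auto
    also have "\<dots> = 8 / norm k * (e * e)" by simp
    also have "\<dots> \<le> 8 / norm k * exp (2 * \<bar>Im k\<bar>)" using e k0 by (intro mult_left_mono) auto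
    finally show ?thesis .
  qed
  have pos_axis: "norm (D x (complex_of_real y)) \<le> 8 / sqrt y" if y: "y \<ge> R\<^sup>2" for y
  proof -
    have y0: "y \<ge> 0" by (rule order_trans[OF zero_le_power2 y])
    have "R \<le> sqrt y" using y R by (intro real_le_rsqrt) auto
    hence "norm (complex_of_real (sqrt y)) \<ge> R" using y0 by simp
    from Dk[OF this] have "norm (D x ((complex_of_real (sqrt y))\<^sup>2)) \<le> 8 / sqrt y" using y0 by simp
    also have "(complex_of_real (sqrt y))\<^sup>2 = complex_of_real y"
      using y0 by (simp only: of_real_power[symmetric] real_sqrt_pow2)
    finally show ?thesis .
  qed
  have "1 * R \<le> R * R" using R(1) by (intro mult_right_mono) auto
  hence R2: "R \<le> R\<^sup>2" "1 \<le> R\<^sup>2" using R(1) unfolding power2_eq_square by linarith+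
  show ?thesis
  proof (rule phragmen_lindelof_zero[where f = "D x" and A = 8 and B = 2 and R = "R\<^sup>2" and M = 16])
    show "D x holomorphic_on UNIV"
      unfolding D_def[abs_def] by (intro holomorphic_intros A.chi_holomorphic B.chi_holomorphic x1)
    show "norm (D x z) \<le> 8 * exp (2 * sqrt (norm z))" if z: "norm z \<ge> R\<^sup>2" for z
    proof -
      \<comment> \<open>|Im k| <= |k| = sqrt |z| is the source of the order 1/2.\<close>
      define k where "k = csqrt z"
      have kz: "k\<^sup>2 = z" "norm k = sqrt (norm z)" unfolding k_def by auto
      have kR: "norm k \<ge> R" unfolding kz(2) using z R by (intro real_le_rsqrt) auto
      have "norm (D x z) \<le> 8 / norm k * exp (2 * \<bar>Im k\<bar>)" using Dk[OF kR] unfolding kz(1) .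
      also have "\<dots> \<le> 8 * exp (2 * sqrt (norm z))"
      proof (intro mult_mono)
        show "8 / norm k \<le> 8" using kR R(1) by (simp add: divide_le_eq)
        show "exp (2 * \<bar>Im k\<bar>) \<le> exp (2 * sqrt (norm z))" using abs_Im_le_cmod[of k] unfolding kz(2) by simp
      qed auto
      finally show ?thesis .
    qed
    show "norm (D x (complex_of_real y)) \<le> 16" if y: "\<bar>y\<bar> \<ge> R\<^sup>2" for y
    proof (cases "y \<ge> 0")
      case True
      hence yR: "y \<ge> R\<^sup>2" using y by simp
      have "1 \<le> sqrt y" using yR R2 by simp
      hence "8 / sqrt y \<le> 8" by (simp add: divide_le_eq)
      thus ?thesis using pos_axis[OF yR] by linarith
    next
      case False
      define k where "k = sqrt (- y)"
      have "k \<ge> R" unfolding k_def using y False R(1) by (intro real_le_rsqrt) auto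
      hence k: "k \<ge> KA" "k \<ge> KB" using R by auto
      have ky: "complex_of_real y = F.nz k" unfolding F.nz_def k_def using False by simp
      have p: "F.phi0 k x > 0" "F.phi0 k 1 > 0" using F.phi0_pos x by auto
      have nz: "A.phi (F.nz k) 1 \<noteq> 0" "B.phi (F.nz k) 1 \<noteq> 0"
        using KA[OF k(1), of 1] KB[OF k(2), of 1] p by auto
      note a = A.chi_negative_axis_bound[OF x1 KA[OF k(1)]] and b = B.chi_negative_axis_bound[OF x1 KB[OF k(2)]]
      have "norm (D x (F.nz k)) \<le> norm (A.phi (F.nz k) x / A.phi (F.nz k) 1) * norm (B.chi 0 1 (F.nz k) x) +
           norm (B.phi (F.nz k) x / B.phi (F.nz k) 1) * norm (A.chi 0 1 (F.nz k) x)"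
        unfolding D_eq[OF x1 m nz] norm_mult[symmetric] by (rule norm_triangle_ineq4)
      \<comment> \<open>The exponentially small and large factors cancel, which leaves 8 for each
        product.\<close>
      also have "\<dots> \<le> (2 * (F.phi0 k x / F.phi0 k 1)) * (4 * F.phi0 k 1 / F.phi0 k x) +
          (2 * (F.phi0 k x / F.phi0 k 1)) * (4 * F.phi0 k 1 / F.phi0 k x)"
        using p by (intro add_mono mult_mono a b) auto
      also have "\<dots> = 16" using p by simp
      finally show ?thesis unfolding ky .
    qed
    show "((\<lambda>y. D x (complex_of_real y)) \<longlongrightarrow> 0) at_top"
    proof (rule Lim_null_comparison)
      show "\<forall>\<^sub>F y in at_top. norm (D x (complex_of_real y)) \<le> 8 / sqrt y"
        using eventually_ge_at_top[of "R\<^sup>2"] by eventually_elim (rule pos_axis)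
      show "((\<lambda>y. 8 / sqrt y) \<longlongrightarrow> 0) at_top" by real_asymp
    qed
  qed auto
qed

theorem potentials_equal:
  assumes d: "\<And>z. A.phi z 1 = 0 \<longleftrightarrow> B.phi z 1 = 0" and n: "\<And>z. A.phi1 z 1 = 0 \<longleftrightarrow> B.phi1 z 1 = 0"
  shows "AE x in M01. q x = q2 x"
proof -
  interpret F: radial_free l by unfold_locales (rule A.l)
  have m: "A.phi1 z 1 * B.phi z 1 = B.phi1 z 1 * A.phi z 1" for z by (rule weyl_functions_equal[OF d n])
  obtain KA where KA: "\<And>k x. k \<ge> KA \<Longrightarrow> x \<in> {0<..1} \<Longrightarrow> \<exists>p. A.phi (F.nz k) x = complex_of_real p \<and>
       2 / 3 * F.phi0 k x \<le> p \<and> p \<le> 4 / 3 * F.phi0 k x"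
    by (rule A.phi_negative_axis, erule that)
  obtain KB where KB: "\<And>k x. k \<ge> KB \<Longrightarrow> x \<in> {0<..1} \<Longrightarrow> \<exists>p. B.phi (F.nz k) x = complex_of_real p \<and>
       2 / 3 * F.phi0 k x \<le> p \<and> p \<le> 4 / 3 * F.phi0 k x"
    by (rule B.phi_negative_axis, erule that)
  \<comment> \<open>From here on a single z = -k^2 is enough; both functions phi are positive
    there.\<close>
  define k where "k = max KA KB"
  define z where "z = F.nz k"
  define u v where "u = A.phi z" and "v = B.phi z"
  have u: "\<exists>p>0. u x = complex_of_real p" and v: "\<exists>p>0. v x = complex_of_real p" if x: "x \<in> {0<..1}" for x
  proof -
    have p: "F.phi0 k x > 0" by (rule F.phi0_pos[OF x])
    obtain p1 where p1: "u x = complex_of_real p1" "2 / 3 * F.phi0 k x \<le> p1"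
      using KA[of k x] x unfolding u_def z_def k_def by auto
    obtain p2 where p2: "v x = complex_of_real p2" "2 / 3 * F.phi0 k x \<le> p2"
      using KB[of k x] x unfolding v_def z_def k_def by auto
    show "\<exists>p>0. u x = complex_of_real p" "\<exists>p>0. v x = complex_of_real p"
      using p1 p2 p by (auto intro!: exI[of _ p1] exI[of _ p2])
  qed
  have nzu: "u x \<noteq> 0" and nzv: "v x \<noteq> 0" if "x \<in> {0<..1}" for x using u[OF that] v[OF that] by auto
  have uc: "continuous_on {0<..1} u" "continuous_on {0<..1} v"
    unfolding u_def v_def
    by (auto intro: has_loc_ac_deriv_continuous A.solvesD(1)[OF A.phi_solves] B.solvesD(1)[OF B.phi_solves])
  \<comment> \<open>This is D = 0 divided by u(x) v(x) and multiplied by u(1) v(1). At x = 1 both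
    sides are 0.\<close>
  have S: "A.chi 0 1 z x / u x * u 1 = B.chi 0 1 z x / v x * v 1" if x: "x \<in> {0<..1}" for x
  proof (cases "x = 1")
    case False
    hence x': "x \<in> {0<..<1}" using x by auto
    have "A.phi z x / A.phi z 1 * B.chi 0 1 z x = B.phi z x / B.phi z 1 * A.chi 0 1 z x"
      using D_zero[OF x' m, of z] D_eq[OF x m, of z] nzu[of 1] nzv[of 1] unfolding u_def v_def by simp
    thus ?thesis using nzu[OF x] nzv[OF x] nzu[of 1] nzv[of 1] unfolding u_def v_def by (simp add: field_simps)
  qed simp
  \<comment> \<open>The derivative of the identity \<open>S\<close>, since (s / phi)' = phi(1) /
    phi^2; it is obtained from integrals over all intervals [a, y] of a continuous function.\<close>
  have sq: "(u 1)\<^sup>2 / (u x)\<^sup>2 = (v 1)\<^sup>2 / (v x)\<^sup>2" if x: "x \<in> {0<..1}" for x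
  proof -
    define a where "a = x / 2"
    have a: "0 < a" "a < 1" "x \<in> {a..1}" using x unfolding a_def by auto
    define f where "f t = (u 1)\<^sup>2 / (u t)\<^sup>2 - (v 1)\<^sup>2 / (v t)\<^sup>2" for t
    have "f x = 0"
    proof (rule zero_if_subintervals_zero[OF _ a(2) _ a(3)])
      show "continuous_on {a..1} f"
        unfolding f_def using nzu nzv a
        by (intro continuous_intros continuous_on_subset[OF uc(1)] continuous_on_subset[OF uc(2)]) auto
      fix y assume y: "y \<in> {a..1}"
      have 1: "((\<lambda>t. u 1 / (u t)\<^sup>2) has_integral (A.chi 0 1 z y / u y - A.chi 0 1 z a / u a)) {a..y}"
        unfolding u_def by (rule A.chi_over_phi_has_integral) (use a y nzu u_def in auto)
      have 2: "((\<lambda>t. v 1 / (v t)\<^sup>2) has_integral (B.chi 0 1 z y / v y - B.chi 0 1 z a / v a)) {a..y}"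
        unfolding v_def by (rule B.chi_over_phi_has_integral) (use a y nzv v_def in auto)
      have 3: "((\<lambda>t. u 1 * (u 1 / (u t)\<^sup>2) - v 1 * (v 1 / (v t)\<^sup>2)) has_integral
          (u 1 * (A.chi 0 1 z y / u y - A.chi 0 1 z a / u a) - v 1 * (B.chi 0 1 z y / v y - B.chi 0 1 z a / v a))) {a..y}"
        by (intro has_integral_diff has_integral_mult_right 1 2)
      have "u 1 * (A.chi 0 1 z y / u y - A.chi 0 1 z a / u a) - v 1 * (B.chi 0 1 z y / v y - B.chi 0 1 z a / v a) =
         (A.chi 0 1 z y / u y * u 1 - B.chi 0 1 z y / v y * v 1) - (A.chi 0 1 z a / u a * u 1 - B.chi 0 1 z a / v a * v 1)"
        by (simp add: algebra_simps)
      also have "\<dots> = 0" using S[of y] S[of a] y a by simp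
      finally have "(f has_integral 0) {a..y}" using 3 unfolding f_def by (simp add: power2_eq_square)
      thus "integral {a..y} f = 0" by (simp add: has_integral_iff)
    qed
    thus ?thesis unfolding f_def by simp
  qed
  define c where "c = v 1 / u 1"
  \<comment> \<open>Positivity of both functions at this z allows square roots to be taken.\<close>
  have vcu: "v x = c * u x" if x: "x \<in> {0<..1}" for x
  proof -
    obtain p p1 r r1 where *: "p > 0" "p1 > 0" "r > 0" "r1 > 0" "u x = complex_of_real p" "u 1 = complex_of_real p1"
      "v x = complex_of_real r" "v 1 = complex_of_real r1" using u[OF x] u[of 1] v[OF x] v[of 1] by auto
    have "complex_of_real ((p1 / p)\<^sup>2) = complex_of_real ((r1 / r)\<^sup>2)"
      using sq[OF x] unfolding * by (simp add: power_divide)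
    hence "(p1 / p)\<^sup>2 = (r1 / r)\<^sup>2" by (simp only: of_real_eq_iff)
    hence "p1 / p = r1 / r" using * by (simp add: power2_eq_iff_nonneg)
    hence "r = r1 / p1 * p" using * by (simp add: field_simps)
    thus ?thesis unfolding c_def * by (simp flip: of_real_mult of_real_divide)
  qed
  define u1 v1 where "u1 = A.phi1 z" and "v1 = B.phi1 z"
  have us: "has_loc_ac_deriv u u1" "has_loc_ac_deriv u1 (\<lambda>x. (complex_of_real (A.V x) - z) * u x)"
    unfolding u_def u1_def using A.solvesD[OF A.phi_solves] by auto
  have vs: "has_loc_ac_deriv v v1" "has_loc_ac_deriv v1 (\<lambda>x. (complex_of_real (B.V x) - z) * v x)"
    unfolding v_def v1_def using B.solvesD[OF B.phi_solves] by auto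
  have v1: "v1 x = c * u1 x" if x: "x \<in> {0<..1}" for x
  proof -
    define a where "a = x / 2"
    have a: "0 < a" "a < 1" "x \<in> {a..1}" using x unfolding a_def by auto
    have "(v has_vector_derivative v1 x) (at x within {a..1})"
      by (rule has_loc_ac_deriv_vector_derivative[OF vs a(1) _ a(3)]) simp
    moreover have "((\<lambda>x. c * u x) has_vector_derivative c * u1 x) (at x within {a..1})"
      by (rule has_vector_derivative_mult_right[OF has_loc_ac_deriv_vector_derivative[OF us a(1) _ a(3)]]) simp
    hence "(v has_vector_derivative c * u1 x) (at x within {a..1})"
      by (rule has_vector_derivative_transform[rotated 2]) (use a vcu in auto)
    ultimately show ?thesis
      using vector_derivative_unique_within_closed_interval[OF a(2), of x v "v1 x" "c * u1 x"] a(3) by simp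
  qed
  \<comment> \<open>The Wronskian of v and u vanishes identically because v = c u and v' = c u'. Its
    derivative is \<open>g\<close>, so g = 0 almost everywhere, and v u has no zeros.\<close>
  define g where "g x = complex_of_real (q2 x - q x) * (v x * u x)" for x
  have "has_loc_ac_deriv (\<lambda>x. v1 x * u x - v x * u1 x)
      (\<lambda>x. ((complex_of_real (B.V x) - z) * v x) * u x - v x * ((complex_of_real (A.V x) - z) * u x))"
    by (rule has_loc_ac_deriv_wronskian[OF vs us])
  hence W: "has_loc_ac_deriv (\<lambda>x. 0) g"
    by (rule has_loc_ac_deriv_cong) (auto simp: v1 vcu g_def A.V_def B.V_def algebra_simps)
  have gi: "g absolutely_integrable_on {0..1}"
  proof -
    have "(\<lambda>x. v x * u x * complex_of_real (q2 x - q x)) absolutely_integrable_on {0..1}"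
      unfolding u_def v_def
      by (intro absolutely_integrable_continuous_mult absolutely_integrable_of_real set_integral_diff(1) A.q B.q
          continuous_intros A.phi_continuous B.phi_continuous)
    thus ?thesis unfolding g_def by (simp add: mult.commute)
  qed
  have "AE x in M01. g x = 0"
  proof (rule AE_zero_if_tail_integrals_zero[OF gi])
    fix a :: real assume a: "0 < a" "a \<le> 1"
    show "integral {a..1} g = 0" using ac_on_integral[OF has_loc_ac_derivD[OF W a(1)], of 1 a 1] a by simp
  qed
  moreover have "AE x in M01. x \<in> {0<..<1}" by (rule AE_I2) (simp add: space_restrict_space)
  ultimately show ?thesis
  proof eventually_elim
    case (elim x)
    hence "x \<in> {0<..1}" by auto
    hence "complex_of_real (q2 x - q x) = 0" using elim(1) nzu nzv unfolding g_def by simp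
    thus ?case by (simp only: of_real_eq_0_iff)
  qed
qed

end

text \<open>For finite p = r the pointwise bound |q| <= 1 + |q|^r is integrable because the interval
  has finite measure.\<close>

lemma Lp_imp_integrable:
  fixes q :: "real \<Rightarrow> real"
  assumes p: "1 \<le> p" and q: "q \<in> Lp p"
  shows "q absolutely_integrable_on {0..1}"
proof -
  have m: "q \<in> borel_measurable M01" using q unfolding Lp_def by blast
  have "integrable M01 q"
  proof (cases "p = \<infinity>")
    case True
    then obtain C where C: "AE x in M01. norm (q x) \<le> C" using q unfolding Lp_def by auto
    show ?thesis
      by (rule Bochner_Integration.integrable_bound[of _ "\<lambda>_. C", OF _ m]) (use C in \<open>auto elim: eventually_mono\<close>)
  next
    case False
    then obtain r where r: "p = ereal r" "r \<ge> 1" using p by (cases p) auto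
    have i: "integrable M01 (\<lambda>x. norm (q x) powr r)" using q False r unfolding Lp_def by simp
    show ?thesis
    proof (rule Bochner_Integration.integrable_bound[OF Bochner_Integration.integrable_add[OF integrable_const_M01 i] m])
      have "norm (q x) \<le> norm (1 + norm (q x) powr r)" for x
      proof (cases "\<bar>q x\<bar> \<le> 1")
        case False
        have "\<bar>q x\<bar> powr 1 \<le> \<bar>q x\<bar> powr r" using False r by (intro powr_mono) auto
        thus ?thesis using False by simp
      next
        case True
        have "\<bar>q x\<bar> \<le> 1 + \<bar>q x\<bar> powr r" using True powr_ge_zero[of "\<bar>q x\<bar>" r] by linarith
        thus ?thesis by simp
      qed
      thus "AE x in M01. norm (q x) \<le> norm (1 + norm (q x) powr r)" by simp
    qed
  qed
  thus ?thesis by (simp add: integrable_M01_iff)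
qed

theorem corollary5p3:
  fixes l :: real and p :: ereal and q q2 :: "real \<Rightarrow> real"
  assumes "l > - 1 / 2"
    and "1 \<le> p"
    and "q \<in> Lp p" and "q2 \<in> Lp p"
    and "radial_spectrum l q \<infinity> = radial_spectrum l q2 \<infinity>"
    and "radial_spectrum l q 0 = radial_spectrum l q2 0"
  shows "AE x in lebesgue_on {0<..<1}. q x = q2 x"
proof -
  interpret radial_pair l q q2
    by unfold_locales (use assms(1) Lp_imp_integrable[OF assms(2)] assms(3,4) in auto)
  show ?thesis
  proof (rule potentials_equal)
    show "A.phi z 1 = 0 \<longleftrightarrow> B.phi z 1 = 0" for z
      using assms(5) unfolding A.radial_spectrum_infinity B.radial_spectrum_infinity by blast
    show "A.phi1 z 1 = 0 \<longleftrightarrow> B.phi1 z 1 = 0" for z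
      using assms(6) unfolding A.radial_spectrum_0 B.radial_spectrum_0 by blast
  qed
qed

end
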